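(* For $y>1$ put $\mathcal{S}_y=\{p+\lfloor y^k\rfloor \mid p\in\mathcal{P},\ k\in\mathbb{N}\}$ and $$\delta_y=\liminf_{N\to\infty}\frac{|\mathcal{S}_y\cap[1,N]|}{N}.$$ Then, for almost every real $y>1$ (with respect to Lebesgue measure), $$\delta_y\ge \frac{1}{\log y+9C_0/\pi^2},$$ where $C_0$ is the absolute constant defined in the context. In particular, $\mathcal{P}+\{\lfloor y^k\rfloor\mid k\ge1\}$ has positive lower asymptotic density for almost all $y>1$.
   Context: $\mathbb{N}=\{1,2,3,\ldots\}$; $\mathcal{P}$ is the set of primes; $\lfloor x\rfloor$ is the greatest integer not exceeding $x$. For a nonzero integer $h$ put $W(h)=\prod_{p\mid h}(1+1/p)$, the product over primes dividing $h$. The absolute constant $C_0$ is $$C_0=\limsup_{x\to\infty}\ \sup_{h\in\mathbb{Z}\setminus\{0\}}\frac{(\log x)^2}{xW(h)}\,\#\{p\le x\mid p\in\mathcal{P},\ p+h\in\mathcal{P}\},$$ which is finite (a known consequence of the Selberg upper bound sieve). The lower asymptotic density of $\mathcal{A}\subseteq\mathbb{N}$ is $\liminf_{N\to\infty}|\mathcal{A}\cap[1,N]|/N$. For sets $X,Y$ of integers, $X+Y=\{x+y\mid x\in X, y\in Y\}$. *)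

theory Defs
  imports
    "HOL-Analysis.Analysis"
    "HOL-Computational_Algebra.Primes"
begin

(* Primes are taken in the type int, where "prime p" entails p > 0. *)

definition W :: "int \<Rightarrow> real" where
  "W h = (\<Prod>p | prime p \<and> p dvd h. 1 + 1 / real_of_int p)"

definition prime_pair_count :: "int \<Rightarrow> real \<Rightarrow> nat" where
  "prime_pair_count h x = card {p :: int. prime p \<and> real_of_int p \<le> x \<and> prime (p + h)}"

(* Extended-real valued, so that the supremum and the limit superior need no
   boundedness side condition; the finiteness of C0 is a theorem (Selberg's sieve). *)
definition C0 :: ereal where
  "C0 = Limsup at_top (\<lambda>x :: real.
     SUP h \<in> UNIV - {0 :: int}. ereal ((ln x)\<^sup>2 / (x * W h) * real (prime_pair_count h x)))"

definition lower_density :: "int set \<Rightarrow> ereal" where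
  "lower_density A = liminf (\<lambda>N :: nat. ereal (real (card (A \<inter> {1..int N})) / real N))"

definition S :: "real \<Rightarrow> int set" where
  "S y = {p + \<lfloor>y ^ k\<rfloor> | (p :: int) (k :: nat). prime p \<and> k \<ge> 1}"

end

theory Submission
  imports Defs "HOL-Real_Asymp.Real_Asymp" "HOL-Computational_Algebra.Squarefree" "HOL-Number_Theory.Cong"
    "HOL-Number_Theory.Prime_Powers" "HOL-Complex_Analysis.Complex_Analysis"
begin

text \<open>
  Count the pairs \<open>(p, k)\<close> with \<open>p + \<lfloor>y ^ k\<rfloor> \<le> N\<close>. By the prime number theorem there are about
  \<open>N / ln y\<close> of them, so by Cauchy--Schwarz it suffices to bound the number of coincidences
  \<open>p + \<lfloor>y ^ k\<rfloor> = q + \<lfloor>y ^ l\<rfloor>\<close>. The diagonal \<open>k = l\<close> contributes \<open>N / ln y\<close>, and by the definition of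
  \<open>C0\<close> the rest contributes at most about \<open>C0 N / (ln N)\<^sup>2\<close> times the sum of \<open>W (\<lfloor>y ^ l\<rfloor> - \<lfloor>y ^ k\<rfloor>)\<close> over
  \<open>k, l \<le> K = ln N / ln y\<close>, where odd differences are negligible. Writing \<open>W\<close> as a divisor sum over
  squarefree numbers reduces this to the frequency of \<open>d dvd \<lfloor>y ^ l\<rfloor> - \<lfloor>y ^ k\<rfloor>\<close>, which is \<open>1 / d\<close> on average
  over \<open>y\<close>. As that frequency is at least \<open>1 / d\<close> for every \<open>y\<close>, a first moment bound suffices to
  conclude for almost every \<open>y\<close>. The resulting constant is \<open>3 / 4\<close> times the product of
  \<open>1 + 1 / p\<^sup>2\<close> over the odd primes, that is \<open>9 / pi\<^sup>2\<close>.

  The prime number theorem comes from Newman's contour argument, and the finiteness of \<open>C0\<close>, needed for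
  the positivity of the density, from Selberg's sieve.
\<close>

text \<open>The input on the powers is equidistribution on average over \<open>y\<close>. For
  \<open>k < l\<close>, on an interval where the integer part of \<open>y ^ k\<close> is constant,
  the \<open>y\<close> for which the integer part of \<open>y ^ l\<close> lies in a given class
  modulo \<open>d\<close> fill \<open>1 / d\<close> of the length up to one boundary term. Summed
  over the intervals this error decays geometrically in \<open>l - k\<close>, uniformly in
  \<open>d\<close>, so over all pairs up to \<open>K\<close> it is \<open>O(K)\<close> against the
  main term \<open>K^2 / d\<close>. Weighting by the reciprocals of squarefree \<open>d\<close>
  built from odd primes up to \<open>K\<close> costs at most a further \<open>sqrt K\<close>, which
  leaves a power saving. Since the excess over the main term is never negative, a summable mean
  along the cubes makes it negligible almost everywhere, and monotonicity in \<open>K\<close> fills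
  the gaps between cubes. The prime 2 contributes \<open>1 + 1 / 2\<close> through \<open>W\<close>
  and \<open>1 / 2\<close> as the frequency of even differences, whence the \<open>3 / 4\<close>.
  With \<open>L = ln y\<close>, Cauchy--Schwarz gives
  \<open>(1 / L)^2 / (1 / L + 9 C0 / (pi^2 L^2))\<close>, which is the asserted bound.\<close>

section \<open>Elementary facts on subset sums, \<open>W\<close> and prime pairs\<close>

lemma sum_Pow_prod: 
  fixes g :: "'a \<Rightarrow> real"
  assumes "finite P"
  shows "(\<Sum>A\<in>Pow P. \<Prod>p\<in>A. g p) = (\<Prod>p\<in>P. 1 + g p)"
proof -
  have "(\<Prod>p\<in>P. 1 + g p) = (\<Prod>p\<in>P. g p + 1)" by (simp add: add.commute)
  also have "\<dots> = (\<Sum>A\<in>Pow P. \<Prod>p\<in>A. g p)" by (subst prod_add) (use assms in auto)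
  finally show ?thesis ..
qed
lemma W_pos: "W h > 0"
  unfolding W_def by (rule prod_pos) (auto intro!: add_pos_nonneg simp: prime_ge_0_int)

lemma finite_primes_le [simp]: "finite {p :: int. prime p \<and> real_of_int p \<le> x}"
proof (rule finite_subset)
  show "{p :: int. prime p \<and> real_of_int p \<le> x} \<subseteq> {0..\<lfloor>x\<rfloor>}"
    by (auto simp: le_floor_iff prime_ge_0_int)
qed simp

text \<open>One of \<open>p\<close> and \<open>p + h\<close> is even, hence equal to 2. This is what
  makes odd differences negligible.\<close>

lemma prime_pairs_odd_difference:
  assumes "odd h"
  shows "card {p :: int. prime p \<and> real_of_int p \<le> x \<and> prime (p + h)} \<le> 2"
proof -
  have "{p :: int. prime p \<and> real_of_int p \<le> x \<and> prime (p + h)} \<subseteq> {2, 2 - h}"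
  proof
    fix p assume "p \<in> {p :: int. prime p \<and> real_of_int p \<le> x \<and> prime (p + h)}"
    then have p: "prime p" "prime (p + h)" by auto
    have "even p \<or> even (p + h)" using assms by auto
    moreover have "q = 2" if "prime q" "even q" for q :: int
      using that prime_odd_int[of q] prime_ge_2_int[of q] by force
    ultimately have "p = 2 \<or> p + h = 2" using p by blast
    then show "p \<in> {2, 2 - h}" by auto
  qed
  then have "card {p :: int. prime p \<and> real_of_int p \<le> x \<and> prime (p + h)} \<le> card {2, 2 - h}"
    by (intro card_mono) auto
  also have "\<dots> \<le> 2" by (simp add: card_insert_if)
  finally show ?thesis .
qed

section \<open>Selberg's upper bound sieve\<close>

text \<open>Moebius inversion on the Boolean lattice: the alternating sum over the interval from
  \<open>C\<close> to \<open>B\<close> factors as a product of \<open>1 - 1\<close> over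
  \<open>B - C\<close>.\<close>

lemma sum_alternating_between:
  assumes "finite B" "C \<subseteq> B"
  shows "(\<Sum>A\<in>{A. C \<subseteq> A \<and> A \<subseteq> B}. (-1) ^ card A) = (if B = C then (-1) ^ card C else (0 :: real))"
proof -
  have fin: "finite C" using assms finite_subset by auto
  have "(\<Sum>A\<in>{A. C \<subseteq> A \<and> A \<subseteq> B}. (-1) ^ card A) = (\<Sum>A\<in>Pow (B - C). (-1) ^ card C * (\<Prod>x\<in>A. -1 :: real))"
  proof (rule sum.reindex_bij_witness[of _ "\<lambda>A. C \<union> A" "\<lambda>A. A - C"])
    fix A assume "A \<in> {A. C \<subseteq> A \<and> A \<subseteq> B}"
    then have "C \<subseteq> A" "finite A" using assms finite_subset by auto
    then have "card A = card C + card (A - C)"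
      using fin by (simp add: card_Diff_subset card_mono)
    then show "(-1) ^ card C * (\<Prod>x\<in>A - C. -1 :: real) = (-1) ^ card A" by (simp add: power_add)
  qed (use assms in auto)
  also have "\<dots> = (-1) ^ card C * (\<Prod>x\<in>B - C. 1 + (-1 :: real))"
    using assms by (simp only: sum_distrib_left[symmetric] sum_Pow_prod finite_Diff)
  also have "\<dots> = (if B = C then (-1) ^ card C else 0)" using assms by (auto simp: prod_zero_iff)
  finally show ?thesis .
qed

text \<open>Squarefree numbers are encoded by their sets of prime factors: \<open>D\<close> plays the role of the sieve level, and
  \<open>wt\<close> below are the weights minimising the quadratic form of \<open>quadratic_form\<close>.\<close>

locale selberg_weights =
  fixes P :: "'a set" and g :: "'a \<Rightarrow> real" and D :: "'a set set"
  assumes finP: "finite P" and g: "\<And>p. p \<in> P \<Longrightarrow> 0 < g p \<and> g p < 1"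
    and DP: "D \<subseteq> Pow P" and Dne: "{} \<in> D" and Ddown: "\<And>A C. C \<in> D \<Longrightarrow> A \<subseteq> C \<Longrightarrow> A \<in> D"
begin

text \<open>The multiplicative function whose reciprocals, summed over the subsets of
  \<open>A\<close>, give the reciprocal of the product of \<open>g\<close> over \<open>A\<close>.
  This identity diagonalises the quadratic form of the sieve.\<close>

definition j where "j C = (\<Prod>p\<in>C. g p / (1 - g p))"
definition G where "G = (\<Sum>C\<in>D. j C)"
definition wt where "wt A = (-1) ^ card A / (\<Prod>p\<in>A. g p) * ((\<Sum>C\<in>{C\<in>D. A \<subseteq> C}. j C) / G)"

lemma finD: "finite D" using finP DP finite_subset by (metis finite_Pow_iff)

lemma j_pos: "C \<subseteq> P \<Longrightarrow> j C > 0"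
  unfolding j_def using g by (intro prod_pos) (auto simp: subset_iff)

lemma G_pos: "G > 0"
proof -
  have "(\<Sum>C\<in>{{}}. j C) \<le> G" unfolding G_def
  proof (rule sum_mono2)
    fix C assume "C \<in> D - {{}}"
    then have "C \<subseteq> P" using DP by blast
    then show "0 \<le> j C" using j_pos[of C] by simp
  qed (use finD Dne in auto)
  then show ?thesis by (simp add: j_def)
qed

lemma wt_empty: "wt {} = 1"
  using G_pos by (simp add: wt_def G_def)

lemma wt_eq_0: "A \<notin> D \<Longrightarrow> wt A = 0"
proof -
  assume "A \<notin> D"
  then have "{C\<in>D. A \<subseteq> C} = {}" using Ddown by auto
  then show ?thesis unfolding wt_def by (simp only: sum.empty)
qed

lemma prod_g_pos: "A \<subseteq> P \<Longrightarrow> (\<Prod>p\<in>A. g p) > 0"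
  using g by (intro prod_pos) (auto simp: subset_iff)

text \<open>For \<open>C\<close> containing \<open>A\<close>, \<open>j C = j A * j (C - A)\<close>,
  and \<open>C - A\<close> is again in \<open>D\<close> because \<open>D\<close> is closed under
  subsets. So the inner sum is at most \<open>j A * G\<close>.\<close>

lemma abs_wt_le:
  assumes "A \<subseteq> P"
  shows "\<bar>wt A\<bar> \<le> (\<Prod>p\<in>A. 1 / (1 - g p))"
proof -
  have fin: "finite C" if "C \<in> D" for C using that DP finP finite_subset by blast
  have "(\<Sum>C\<in>{C\<in>D. A \<subseteq> C}. j C) = (\<Sum>C\<in>{C\<in>D. A \<subseteq> C}. j A * j (C - A))"
  proof (intro sum.cong refl)
    fix C assume "C \<in> {C\<in>D. A \<subseteq> C}"
    then show "j C = j A * j (C - A)" unfolding j_def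
      using prod.subset_diff[of A C "\<lambda>p. g p / (1 - g p)"] fin by (simp add: mult.commute)
  qed
  also have "\<dots> = j A * (\<Sum>C\<in>(\<lambda>C. C - A) ` {C\<in>D. A \<subseteq> C}. j C)"
    by (subst sum.reindex) (auto simp: inj_on_def sum_distrib_left)
  also have "\<dots> \<le> j A * G"
    unfolding G_def using j_pos[OF assms] finD Ddown DP
    by (intro mult_left_mono sum_mono2) (auto intro!: less_imp_le[OF j_pos])
  finally have le: "(\<Sum>C\<in>{C\<in>D. A \<subseteq> C}. j C) / G \<le> j A" using G_pos by (simp add: pos_divide_le_eq)
  have ge: "(\<Sum>C\<in>{C\<in>D. A \<subseteq> C}. j C) / G \<ge> 0"
  proof (intro divide_nonneg_pos sum_nonneg G_pos)
    fix C assume "C \<in> {C \<in> D. A \<subseteq> C}"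
    then have "C \<subseteq> P" using DP by blast
    then show "0 \<le> j C" using j_pos[of C] by simp
  qed
  have "\<bar>wt A\<bar> = 1 / (\<Prod>p\<in>A. g p) * ((\<Sum>C\<in>{C\<in>D. A \<subseteq> C}. j C) / G)"
  proof -
    have "\<bar>(-1) ^ card A / x * t\<bar> = 1 / x * t" if "x > 0" "t \<ge> 0" for x t :: real
      using that by (simp add: abs_mult power_abs)
    then show ?thesis unfolding wt_def using ge prod_g_pos[OF assms] by blast
  qed
  also have "\<dots> \<le> 1 / (\<Prod>p\<in>A. g p) * j A"
    using prod_g_pos[OF assms] le by (intro mult_left_mono) auto
  also have "\<dots> = (\<Prod>p\<in>A. 1 / (1 - g p))"
    using prod_g_pos[OF assms] by (simp add: j_def prod_dividef)
  finally show ?thesis .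
qed

text \<open>The left side is the variable in which the quadratic form is diagonal. After swapping
  the sums, \<open>sum_alternating_between\<close> leaves only the term
  \<open>B = C\<close>.\<close>

lemma wt_inversion:
  assumes "C \<subseteq> P"
  shows "(\<Sum>A\<in>{A\<in>Pow P. C \<subseteq> A}. wt A * (\<Prod>p\<in>A. g p)) = (if C \<in> D then (-1) ^ card C * j C / G else 0)"
proof -
  have "(\<Sum>A\<in>{A\<in>Pow P. C \<subseteq> A}. wt A * (\<Prod>p\<in>A. g p)) =
    (\<Sum>A\<in>{A\<in>Pow P. C \<subseteq> A}. \<Sum>B\<in>D. of_bool (A \<subseteq> B) * ((-1) ^ card A * (j B / G)))"
  proof (intro sum.cong refl)
    fix A assume "A \<in> {A\<in>Pow P. C \<subseteq> A}"
    then have "(\<Prod>p\<in>A. g p) \<noteq> 0" using prod_g_pos[of A] by auto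
    then have "wt A * (\<Prod>p\<in>A. g p) = (-1) ^ card A * ((\<Sum>B\<in>{B\<in>D. A \<subseteq> B}. j B) / G)"
      by (simp add: wt_def)
    also have "(\<Sum>B\<in>{B\<in>D. A \<subseteq> B}. j B) = (\<Sum>B\<in>D. of_bool (A \<subseteq> B) * j B)"
      using finD by (intro sum.mono_neutral_cong_left) auto
    finally show "wt A * (\<Prod>p\<in>A. g p) = (\<Sum>B\<in>D. of_bool (A \<subseteq> B) * ((-1) ^ card A * (j B / G)))"
      by (simp add: sum_distrib_left sum_divide_distrib mult_ac)
  qed
  also have "\<dots> = (\<Sum>B\<in>D. \<Sum>A\<in>{A\<in>Pow P. C \<subseteq> A}. of_bool (A \<subseteq> B) * ((-1) ^ card A * (j B / G)))"
    by (rule sum.swap)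
  also have "\<dots> = (\<Sum>B\<in>D. if B = C then (-1) ^ card C * j C / G else 0)"
  proof (intro sum.cong refl)
    fix B assume B: "B \<in> D"
    then have BP: "B \<subseteq> P" using DP by auto
    then have BP: "B \<subseteq> P" "finite B" using finP finite_subset by auto
    have "(\<Sum>A\<in>{A\<in>Pow P. C \<subseteq> A}. of_bool (A \<subseteq> B) * ((-1) ^ card A * (j B / G))) =
       (\<Sum>A\<in>{A. C \<subseteq> A \<and> A \<subseteq> B}. (-1) ^ card A * (j B / G))"
      using BP finP by (intro sum.mono_neutral_cong_right) auto
    also have "\<dots> = (\<Sum>A\<in>{A. C \<subseteq> A \<and> A \<subseteq> B}. (-1) ^ card A) * (j B / G)" by (simp only: sum_distrib_right)
    also have "\<dots> = (if B = C then (-1) ^ card C * j C / G else 0)"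
    proof (cases "C \<subseteq> B")
      case True
      then show ?thesis using sum_alternating_between[OF BP(2) True] by auto
    next
      case False
      then have "{A. C \<subseteq> A \<and> A \<subseteq> B} = {}" by auto
      moreover have "B \<noteq> C" using False by auto
      ultimately show ?thesis by (simp only: sum.empty if_False)
    qed
    finally show "(\<Sum>A\<in>{A\<in>Pow P. C \<subseteq> A}. of_bool (A \<subseteq> B) * ((-1) ^ card A * (j B / G))) =
      (if B = C then (-1) ^ card C * j C / G else 0)" .
  qed
  also have "\<dots> = (if C \<in> D then (-1) ^ card C * j C / G else 0)" using finD by simp
  finally show ?thesis .
qed

text \<open>The product over \<open>A \<union> B\<close> is that over \<open>A\<close> times that
  over \<open>B\<close> divided by that over \<open>A \<inter> B\<close>; expanding the last
  reciprocal as a sum of \<open>1 / j C\<close> turns the form into a sum of squares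
  \<open>(y C)^2 / j C\<close>. By \<open>wt_inversion\<close> each square equals
  \<open>j C / G^2\<close>, and these sum to \<open>1 / G\<close>.\<close>

lemma quadratic_form: "(\<Sum>A\<in>Pow P. \<Sum>B\<in>Pow P. wt A * wt B * (\<Prod>p\<in>A \<union> B. g p)) = 1 / G"
proof -
  define y where "y = (\<lambda>C. \<Sum>A\<in>Pow P. of_bool (C \<subseteq> A) * (wt A * (\<Prod>p\<in>A. g p)))"
  have y: "y C = (if C \<in> D then (-1) ^ card C * j C / G else 0)" if "C \<subseteq> P" for C
  proof -
    have "y C = (\<Sum>A\<in>{A\<in>Pow P. C \<subseteq> A}. wt A * (\<Prod>p\<in>A. g p))"
      unfolding y_def using finP by (intro sum.mono_neutral_cong_right) auto
    then show ?thesis using wt_inversion[OF that] by simp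
  qed
  have union: "(\<Prod>p\<in>A \<union> B. g p) = (\<Prod>p\<in>A. g p) * (\<Prod>p\<in>B. g p) * (\<Sum>C\<in>Pow P. of_bool (C \<subseteq> A) * of_bool (C \<subseteq> B) / j C)"
    if AB: "A \<in> Pow P" "B \<in> Pow P" for A B
  proof -
    have fin: "finite A" "finite B" using AB finP finite_subset by auto
    have "(\<Sum>C\<in>Pow P. of_bool (C \<subseteq> A) * of_bool (C \<subseteq> B) / j C) = (\<Sum>C\<in>Pow (A \<inter> B). \<Prod>p\<in>C. (1 - g p) / g p)"
      using AB finP by (intro sum.mono_neutral_cong_right) (auto simp: j_def prod_dividef)
    also have "\<dots> = (\<Prod>p\<in>A \<inter> B. 1 + (1 - g p) / g p)" using fin by (intro sum_Pow_prod) auto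
    also have "\<dots> = (\<Prod>p\<in>A \<inter> B. 1 / g p)"
      using AB g by (intro prod.cong refl) (force simp: field_simps)
    also have "\<dots> = 1 / (\<Prod>p\<in>A \<inter> B. g p)" by (simp add: prod_dividef)
    finally have 1: "(\<Sum>C\<in>Pow P. of_bool (C \<subseteq> A) * of_bool (C \<subseteq> B) / j C) = 1 / (\<Prod>p\<in>A \<inter> B. g p)" .
    have "(\<Prod>p\<in>A \<union> B. g p) * (\<Prod>p\<in>A \<inter> B. g p) = (\<Prod>p\<in>A. g p) * (\<Prod>p\<in>B. g p)"
      by (rule prod.union_inter[OF fin])
    moreover have "A \<inter> B \<subseteq> P" using AB by auto
    then have "(\<Prod>p\<in>A \<inter> B. g p) \<noteq> 0" using prod_g_pos[of "A \<inter> B"] by simp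
    ultimately show ?thesis unfolding 1 by (simp add: field_simps)
  qed
  have "(\<Sum>A\<in>Pow P. \<Sum>B\<in>Pow P. wt A * wt B * (\<Prod>p\<in>A \<union> B. g p)) =
    (\<Sum>A\<in>Pow P. \<Sum>B\<in>Pow P. \<Sum>C\<in>Pow P. (of_bool (C \<subseteq> A) * (wt A * (\<Prod>p\<in>A. g p))) * (of_bool (C \<subseteq> B) * (wt B * (\<Prod>p\<in>B. g p))) / j C)"
    by (intro sum.cong refl) (simp add: union sum_distrib_left mult_ac)
  also have "\<dots> = (\<Sum>A\<in>Pow P. \<Sum>C\<in>Pow P. \<Sum>B\<in>Pow P. (of_bool (C \<subseteq> A) * (wt A * (\<Prod>p\<in>A. g p))) * (of_bool (C \<subseteq> B) * (wt B * (\<Prod>p\<in>B. g p))) / j C)"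
    by (intro sum.cong refl sum.swap)
  also have "\<dots> = (\<Sum>C\<in>Pow P. \<Sum>A\<in>Pow P. \<Sum>B\<in>Pow P. (of_bool (C \<subseteq> A) * (wt A * (\<Prod>p\<in>A. g p))) * (of_bool (C \<subseteq> B) * (wt B * (\<Prod>p\<in>B. g p))) / j C)"
    by (rule sum.swap)
  also have "\<dots> = (\<Sum>C\<in>Pow P. (y C)\<^sup>2 / j C)"
    unfolding y_def power2_eq_square sum_product by (simp only: sum_divide_distrib)
  also have "\<dots> = (\<Sum>C\<in>D. j C / G\<^sup>2)"
  proof (rule sum.mono_neutral_cong_right)
    fix C assume "C \<in> D"
    then have "C \<subseteq> P" "C \<in> D" using DP by auto
    then show "(y C)\<^sup>2 / j C = j C / G\<^sup>2"
      using j_pos[of C] y[of C] by (simp add: power_mult_distrib power_divide power2_eq_square flip: power_add)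
  qed (use finP DP y in auto)
  also have "\<dots> = 1 / G" using G_pos by (simp add: power2_eq_square G_def flip: sum_divide_distrib)
  finally show ?thesis .
qed

text \<open>As \<open>wt {} = 1\<close>, the square of the sum of \<open>wt A\<close> over the sets
  \<open>A\<close> of conditions met by \<open>n\<close> is 1 if \<open>n\<close> meets none, and
  nonnegative otherwise. Expanding the square gives the quadratic form, and the product bound on
  \<open>r (A \<union> B)\<close> makes the remainder a square too.\<close>

lemma sieve:
  fixes E :: "'a \<Rightarrow> 'b \<Rightarrow> bool" and X :: real and r :: "'a set \<Rightarrow> real"
  assumes I: "finite I"
    and count: "\<And>C. C \<subseteq> P \<Longrightarrow> \<bar>real (card {n\<in>I. \<forall>p\<in>C. E p n}) - X * (\<Prod>p\<in>C. g p)\<bar> \<le> r C"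
    and r: "\<And>A B. A \<in> D \<Longrightarrow> B \<in> D \<Longrightarrow> r (A \<union> B) \<le> s A * s B"
  shows "real (card {n\<in>I. \<forall>p\<in>P. \<not> E p n}) \<le> X / G + (\<Sum>A\<in>D. \<bar>wt A\<bar> * s A)\<^sup>2"
proof -
  define e where "e = (\<lambda>A n. of_bool (\<forall>p\<in>A. E p n) :: real)"
  have "real (card {n\<in>I. \<forall>p\<in>P. \<not> E p n}) = (\<Sum>n\<in>I. of_bool (\<forall>p\<in>P. \<not> E p n))"
    using I by (simp add: Int_def)
  also have "\<dots> \<le> (\<Sum>n\<in>I. (\<Sum>A\<in>Pow P. wt A * e A n)\<^sup>2)"
  proof (rule sum_mono)
    fix n
    show "of_bool (\<forall>p\<in>P. \<not> E p n) \<le> (\<Sum>A\<in>Pow P. wt A * e A n)\<^sup>2"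
    proof (cases "\<forall>p\<in>P. \<not> E p n")
      case True
      have "(\<Sum>A\<in>Pow P. wt A * e A n) = (\<Sum>A\<in>{{}}. wt A * e A n)"
        using finP True by (intro sum.mono_neutral_right) (auto simp: e_def)
      then show ?thesis by (simp add: e_def wt_empty)
    qed auto
  qed
  also have "\<dots> = (\<Sum>n\<in>I. \<Sum>A\<in>Pow P. \<Sum>B\<in>Pow P. wt A * wt B * e (A \<union> B) n)"
    unfolding power2_eq_square sum_product
    by (intro sum.cong refl) (auto simp: e_def)
  also have "\<dots> = (\<Sum>A\<in>Pow P. \<Sum>n\<in>I. \<Sum>B\<in>Pow P. wt A * wt B * e (A \<union> B) n)"
    by (rule sum.swap)
  also have "\<dots> = (\<Sum>A\<in>Pow P. \<Sum>B\<in>Pow P. \<Sum>n\<in>I. wt A * wt B * e (A \<union> B) n)"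
    by (intro sum.cong refl sum.swap)
  also have "\<dots> = (\<Sum>A\<in>Pow P. \<Sum>B\<in>Pow P. wt A * wt B * real (card {n\<in>I. \<forall>p\<in>A \<union> B. E p n}))"
    using I by (simp only: e_def sum_distrib_left[symmetric]) (simp add: Int_def)
  also have "\<dots> \<le> (\<Sum>A\<in>Pow P. \<Sum>B\<in>Pow P. X * (wt A * wt B * (\<Prod>p\<in>A \<union> B. g p)) + (\<bar>wt A\<bar> * s A) * (\<bar>wt B\<bar> * s B))"
  proof (intro sum_mono)
    fix A B assume AB: "A \<in> Pow P" "B \<in> Pow P"
    define c where "c = real (card {n\<in>I. \<forall>p\<in>A \<union> B. E p n})"
    show "wt A * wt B * c \<le> X * (wt A * wt B * (\<Prod>p\<in>A \<union> B. g p)) + (\<bar>wt A\<bar> * s A) * (\<bar>wt B\<bar> * s B)"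
    proof (cases "A \<in> D \<and> B \<in> D")
      case True
      have "wt A * wt B * c - X * (wt A * wt B * (\<Prod>p\<in>A \<union> B. g p)) = wt A * wt B * (c - X * (\<Prod>p\<in>A \<union> B. g p))"
        by (simp add: algebra_simps)
      also have "\<dots> \<le> \<bar>wt A * wt B * (c - X * (\<Prod>p\<in>A \<union> B. g p))\<bar>" by simp
      also have "\<dots> = \<bar>wt A\<bar> * \<bar>wt B\<bar> * \<bar>c - X * (\<Prod>p\<in>A \<union> B. g p)\<bar>" by (simp add: abs_mult)
      also have "\<dots> \<le> \<bar>wt A\<bar> * \<bar>wt B\<bar> * (s A * s B)"
        using count[of "A \<union> B"] r[of A B] AB True unfolding c_def by (intro mult_left_mono) auto
      finally show ?thesis by (simp add: mult_ac)
    next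
      case False
      then show ?thesis using wt_eq_0 by auto
    qed
  qed
  also have "\<dots> = X * (1 / G) + (\<Sum>A\<in>Pow P. \<bar>wt A\<bar> * s A)\<^sup>2"
    unfolding quadratic_form[symmetric] power2_eq_square sum_product
    by (simp add: sum.distrib sum_distrib_left)
  also have "(\<Sum>A\<in>Pow P. \<bar>wt A\<bar> * s A) = (\<Sum>A\<in>D. \<bar>wt A\<bar> * s A)"
    using finP DP wt_eq_0 by (intro sum.mono_neutral_right) auto
  finally show ?thesis by simp
qed

end

section \<open>Truncated sums of multiplicative functions\<close>

text \<open>For a set \<open>P\<close> of primes this is the sum of a multiplicative function over
  the squarefree numbers up to \<open>z\<close> with all prime factors in \<open>P\<close>.\<close>

definition trunc_sum :: "int set \<Rightarrow> (int \<Rightarrow> real) \<Rightarrow> real \<Rightarrow> real" where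
  "trunc_sum P w z = (\<Sum>C\<in>{C\<in>Pow P. real_of_int (\<Prod>C) \<le> z}. \<Prod>p\<in>C. w p)"

lemma trunc_sum_empty: "trunc_sum {} w z = of_bool (1 \<le> z)"
proof -
  have "{C\<in>Pow {}. real_of_int (\<Prod>C) \<le> z} = (if 1 \<le> z then {{}} else {})" by auto
  then show ?thesis unfolding trunc_sum_def by simp
qed

text \<open>Split by whether \<open>p\<close> is chosen; choosing it divides the remaining bound by
  \<open>p\<close>. The later comparisons are inductions along this recursion.\<close>

lemma trunc_sum_insert:
  assumes "finite P" "p \<notin> P" "p > 0"
  shows "trunc_sum (insert p P) w z = trunc_sum P w z + w p * trunc_sum P w (z / p)"
proof -
  have fin: "finite C" if "C \<in> Pow P" for C using that assms finite_subset by auto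
  have "{C\<in>Pow (insert p P). real_of_int (\<Prod>C) \<le> z} =
      {C\<in>Pow P. real_of_int (\<Prod>C) \<le> z} \<union> insert p ` {C\<in>Pow P. real_of_int (\<Prod>C) \<le> z / p}" (is "?L = ?A \<union> ?B")
  proof -
    have "real_of_int (\<Prod>(insert p C)) \<le> z \<longleftrightarrow> real_of_int (\<Prod>C) \<le> z / p" if "C \<in> Pow P" for C
    proof -
      have "\<Prod>(insert p C) = p * \<Prod>C" using fin[OF that] that assms by (subst prod.insert) auto
      then show ?thesis using assms by (simp add: pos_le_divide_eq mult.commute)
    qed
    then show ?thesis by (auto simp: Pow_insert)
  qed
  moreover have "?A \<inter> ?B = {}" using assms by auto
  moreover have "finite ?A" "finite ?B" using assms by auto
  moreover have "inj_on (insert p) {C\<in>Pow P. real_of_int (\<Prod>C) \<le> z / p}"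
    using assms by (auto simp: inj_on_def)
  ultimately have "trunc_sum (insert p P) w z = trunc_sum P w z + (\<Sum>C\<in>{C\<in>Pow P. real_of_int (\<Prod>C) \<le> z / p}. \<Prod>q\<in>insert p C. w q)"
    unfolding trunc_sum_def by (simp add: sum.union_disjoint sum.reindex)
  also have "(\<Sum>C\<in>{C\<in>Pow P. real_of_int (\<Prod>C) \<le> z / p}. \<Prod>q\<in>insert p C. w q) = w p * trunc_sum P w (z / p)"
    unfolding trunc_sum_def sum_distrib_left using fin assms by (intro sum.cong refl prod.insert) auto
  finally show ?thesis .
qed

lemma trunc_sum_nonneg: "(\<And>p. p \<in> P \<Longrightarrow> w p \<ge> 0) \<Longrightarrow> trunc_sum P w z \<ge> 0"
  unfolding trunc_sum_def by (intro sum_nonneg prod_nonneg) auto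

lemma trunc_sum_mono:
  assumes "finite P" "\<And>p. p \<in> P \<Longrightarrow> w p \<ge> 0" "y \<le> z"
  shows "trunc_sum P w y \<le> trunc_sum P w z"
  unfolding trunc_sum_def using assms by (intro sum_mono2) (auto intro!: prod_nonneg)

text \<open>The hypothesis says \<open>1 + t p \<le> (1 + u p) * (1 + s p)\<close>. The factors from
  \<open>s\<close> are released from the truncation, which only enlarges the right side.\<close>

lemma trunc_sum_compare:
  assumes "finite P" "\<And>p. p \<in> P \<Longrightarrow> p > 0 \<and> 0 \<le> t p \<and> 0 \<le> u p \<and> 0 \<le> s p \<and> t p \<le> u p + s p + u p * s p"
  shows "trunc_sum P t z \<le> (\<Prod>p\<in>P. 1 + s p) * trunc_sum P u z"
  using assms
proof (induction P arbitrary: z)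
  case (insert p P)
  define Q where "Q = (\<Prod>p\<in>P. 1 + s p)"
  have Q: "Q \<ge> 0" unfolding Q_def using insert by (intro prod_nonneg) (auto intro: add_nonneg_nonneg)
  have p: "p > 0" "0 \<le> t p" "0 \<le> u p" "0 \<le> s p" "t p \<le> u p + s p + u p * s p" using insert.prems by auto
  have nn: "trunc_sum P u y \<ge> 0" for y using insert by (intro trunc_sum_nonneg) auto
  \<comment> \<open>For negative \<open>z\<close>, dividing by \<open>p\<close> makes
    \<open>z\<close> larger, so monotonicity does not apply; but then the sum at
    \<open>z / p\<close> is empty.\<close>
  have "z / p \<le> z \<or> z < 0"
  proof (cases "z < 0")
    case False
    then have "z / p \<le> z / 1" using p by (intro divide_left_mono) auto
    then show ?thesis by simp
  qed auto
  then have mono: "trunc_sum P u (z / p) \<le> trunc_sum P u z"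
  proof
    assume "z / p \<le> z" then show ?thesis using insert by (intro trunc_sum_mono) auto
  next
    assume z: "z < 0"
    have "\<not> real_of_int (\<Prod>C) \<le> z / p" if "C \<subseteq> P" for C
    proof -
      have "\<Prod>C > 0" using that insert.prems by (intro prod_pos) auto
      then have "real_of_int (\<Prod>C) > 0" by (simp only: of_int_0_less_iff)
      moreover have "z / p \<le> 0" using z p by (simp add: divide_nonpos_pos)
      ultimately show ?thesis by linarith
    qed
    then have "{C\<in>Pow P. real_of_int (\<Prod>C) \<le> z / p} = {}" by auto
    then have "trunc_sum P u (z / p) = 0" unfolding trunc_sum_def by (simp only: sum.empty)
    then show ?thesis using nn by simp
  qed
  have "trunc_sum (insert p P) t z = trunc_sum P t z + t p * trunc_sum P t (z / p)"
    using insert p by (intro trunc_sum_insert) auto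
  also have "\<dots> \<le> Q * trunc_sum P u z + t p * (Q * trunc_sum P u (z / p))"
    unfolding Q_def using insert p by (intro add_mono mult_left_mono insert.IH) auto
  also have "\<dots> \<le> Q * trunc_sum P u z + (u p + s p + u p * s p) * (Q * trunc_sum P u (z / p))"
    using p Q nn by (intro add_left_mono mult_right_mono) auto
  also have "\<dots> = Q * ((1 + s p) * (u p * trunc_sum P u (z / p)) + trunc_sum P u z + s p * trunc_sum P u (z / p))"
    by (simp add: algebra_simps)
  also have "\<dots> \<le> Q * ((1 + s p) * (u p * trunc_sum P u (z / p)) + trunc_sum P u z + s p * trunc_sum P u z)"
    using Q p mono by (intro mult_left_mono add_left_mono) auto
  also have "\<dots> = (1 + s p) * Q * (trunc_sum P u z + u p * trunc_sum P u (z / p))"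
    by (simp add: algebra_simps)
  also have "trunc_sum P u z + u p * trunc_sum P u (z / p) = trunc_sum (insert p P) u z"
    using insert p by (intro trunc_sum_insert[symmetric]) auto
  finally show ?case using insert by (simp add: Q_def)
qed (auto simp: trunc_sum_empty)

text \<open>The weight is \<open>(1 + u p)^2 - 1\<close>: a prime may divide either factor, giving
  \<open>2 * u p\<close>, or both, giving \<open>(u p)^2\<close>.\<close>

lemma trunc_sum_product:
  assumes "finite P" "\<And>p. p \<in> P \<Longrightarrow> p > 0 \<and> 0 \<le> u p" "0 \<le> y" "0 \<le> z"
  shows "trunc_sum P u y * trunc_sum P u z \<le> trunc_sum P (\<lambda>p. 2 * u p + (u p)\<^sup>2) (y * z)"
  using assms
proof (induction P arbitrary: y z)
  case empty
  then show ?case using mult_mono[of 1 y 1 z] by (auto simp: trunc_sum_empty)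
next
  case (insert p P)
  define t where "t = (\<lambda>p. 2 * u p + (u p)\<^sup>2)"
  have p: "p > 0" "0 \<le> u p" using insert.prems by auto
  have IH: "trunc_sum P u y * trunc_sum P u z \<le> trunc_sum P t (y * z)" if "0 \<le> y" "0 \<le> z" for y z
    unfolding t_def using insert.prems that by (intro insert.IH) auto
  \<comment> \<open>A prime dividing both factors uses up \<open>p^2\<close> of the bound on the
    left but only \<open>p\<close> on the right.\<close>
  have mono: "trunc_sum P t (y * z / p / p) \<le> trunc_sum P t (y * z / p)"
  proof (rule trunc_sum_mono)
    have "1 \<le> real_of_int p" "0 \<le> y * z / p" using p insert.prems(2,3) by auto
    then have "y * z / p / p \<le> y * z / p / 1" by (intro divide_left_mono) auto
    then show "y * z / p / p \<le> y * z / p" by simp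
  qed (use insert in \<open>auto simp: t_def\<close>)
  have "trunc_sum (insert p P) u y * trunc_sum (insert p P) u z =
    (trunc_sum P u y + u p * trunc_sum P u (y / p)) * (trunc_sum P u z + u p * trunc_sum P u (z / p))"
    using insert p by (simp add: trunc_sum_insert)
  also have "\<dots> = trunc_sum P u y * trunc_sum P u z + u p * (trunc_sum P u y * trunc_sum P u (z / p)) +
     u p * (trunc_sum P u (y / p) * trunc_sum P u z) + (u p)\<^sup>2 * (trunc_sum P u (y / p) * trunc_sum P u (z / p))"
    by (simp add: algebra_simps power2_eq_square)
  also have "\<dots> \<le> trunc_sum P t (y * z) + u p * trunc_sum P t (y * (z / p)) + u p * trunc_sum P t (y / p * z) + (u p)\<^sup>2 * trunc_sum P t (y / p * (z / p))"
    using p insert.prems(2,3) divide_nonneg_pos[of y "real_of_int p"] divide_nonneg_pos[of z "real_of_int p"]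
    by (intro add_mono mult_left_mono IH) auto
  also have "\<dots> = trunc_sum P t (y * z) + 2 * u p * trunc_sum P t (y * z / p) + (u p)\<^sup>2 * trunc_sum P t (y * z / p / p)"
    by (simp add: algebra_simps)
  also have "\<dots> \<le> trunc_sum P t (y * z) + 2 * u p * trunc_sum P t (y * z / p) + (u p)\<^sup>2 * trunc_sum P t (y * z / p)"
    using mono by (intro add_left_mono mult_left_mono) auto
  also have "\<dots> = trunc_sum P t (y * z) + t p * trunc_sum P t (y * z / p)" by (simp add: t_def algebra_simps)
  also have "\<dots> = trunc_sum (insert p P) t (y * z)"
    using insert p by (intro trunc_sum_insert[symmetric]) auto
  finally show ?case unfolding t_def .
qed

section \<open>Upper bound for prime pairs\<close>

text \<open>The Chinese remainder theorem, added one prime at a time: sieve conditions at several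
  primes become one condition modulo their product, and the number of admissible residues is
  multiplicative.\<close>

lemma residues_prod_primes:
  fixes A :: "int set" and \<Omega> :: "int \<Rightarrow> int set"
  assumes "finite A" "\<And>p. p \<in> A \<Longrightarrow> prime p \<and> \<Omega> p \<subseteq> {0..<p}"
  shows "\<exists>R. R \<subseteq> {0..<\<Prod>A} \<and> card R = (\<Prod>p\<in>A. card (\<Omega> p)) \<and>
    (\<forall>n. (\<forall>p\<in>A. n mod p \<in> \<Omega> p) \<longleftrightarrow> n mod \<Prod>A \<in> R)"
  using assms
proof (induction A)
  case empty
  then show ?case by (intro exI[of _ "{0}"]) auto
next
  case (insert p A)
  define d where "d = \<Prod>A"
  obtain R where R: "R \<subseteq> {0..<d}" "card R = (\<Prod>p\<in>A. card (\<Omega> p))"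
    "\<And>n. (\<forall>p\<in>A. n mod p \<in> \<Omega> p) \<longleftrightarrow> n mod d \<in> R"
    using insert unfolding d_def by auto
  have p: "prime p" "\<Omega> p \<subseteq> {0..<p}" "p > 0" using insert.prems by (auto simp: prime_gt_0_int)
  have d: "d > 0" unfolding d_def using insert.prems by (intro prod_pos) (auto simp: prime_gt_0_int)
  have cop: "coprime p d" unfolding d_def
    by (rule prod_coprime_right) (use insert in \<open>auto intro!: primes_coprime\<close>)
  define R' where "R' = {m\<in>{0..<p * d}. m mod p \<in> \<Omega> p \<and> m mod d \<in> R}"
  have iff: "(\<forall>q\<in>insert p A. n mod q \<in> \<Omega> q) \<longleftrightarrow> n mod (p * d) \<in> R'" for n
    using R(3)[of n] p d by (auto simp: R'_def mod_mod_cancel)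
  have "bij_betw (\<lambda>m. (m mod p, m mod d)) R' (\<Omega> p \<times> R)"
  proof (rule bij_betwI')
    fix m m' assume m: "m \<in> R'" "m' \<in> R'"
    show "(m mod p, m mod d) = (m' mod p, m' mod d) \<longleftrightarrow> m = m'"
    proof
      assume "(m mod p, m mod d) = (m' mod p, m' mod d)"
      then have "p dvd m - m'" "d dvd m - m'" by (auto simp: mod_eq_dvd_iff)
      then have "p * d dvd m - m'" using cop by (intro divides_mult)
      then have "m mod (p * d) = m' mod (p * d)" by (simp add: mod_eq_dvd_iff)
      then show "m = m'" using m by (auto simp: R'_def)
    qed auto
  next
    fix m assume "m \<in> R'"
    then show "(m mod p, m mod d) \<in> \<Omega> p \<times> R" by (auto simp: R'_def)
  next
    fix z assume z: "z \<in> \<Omega> p \<times> R"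
    obtain x where x: "[x = fst z] (mod p)" "[x = snd z] (mod d)"
      using binary_chinese_remainder_int[OF cop] by blast
    define m where "m = x mod (p * d)"
    have "m mod p = fst z" "m mod d = snd z"
      using x z p R(1) unfolding m_def cong_def by (auto simp: mod_mod_cancel)
    moreover have "m \<in> {0..<p * d}" unfolding m_def using p d by auto
    ultimately show "\<exists>m\<in>R'. z = (m mod p, m mod d)" using z by (intro bexI[of _ m]) (auto simp: R'_def)
  qed
  then have "card R' = card (\<Omega> p \<times> R)" by (rule bij_betw_same_card)
  then have "card R' = card (\<Omega> p) * card R" by (simp add: card_cartesian_product)
  then have "card R' = (\<Prod>q\<in>insert p A. card (\<Omega> q))" using insert R by simp
  moreover have "\<Prod>(insert p A) = p * d" using insert by (simp add: d_def)
  moreover have "R' \<subseteq> {0..<p * d}" by (auto simp: R'_def)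
  ultimately show ?case using iff by (intro exI[of _ R']) simp
qed

text \<open>The elements are \<open>r + d * q\<close> with \<open>q\<close> between two integer
  quotients whose real versions differ by exactly \<open>X / d\<close>; rounding both changes the
  difference by at most 1.\<close>

lemma card_residue_class:
  fixes X d r :: int
  assumes "X \<ge> 0" "d > 0"
  shows "\<bar>real (card {n\<in>{1..X}. n mod d = r mod d}) - X / d\<bar> \<le> 1"
proof -
  have dv: "k \<le> x div d \<longleftrightarrow> k * d \<le> x" for k x
  proof
    assume "k \<le> x div d"
    then have "k * d \<le> x div d * d" using assms by (intro mult_right_mono) auto
    also have "\<dots> \<le> x" using div_mult_mod_eq[of x d] pos_mod_sign[OF assms(2), of x] by linarith
    finally show "k * d \<le> x" .
  next
    assume "k * d \<le> x"
    then have "k * d div d \<le> x div d" using assms by (intro zdiv_mono1) auto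
    then show "k \<le> x div d" using assms by simp
  qed
  define a where "a = (- r) div d"
  define b where "b = (X - r) div d"
  have "{n\<in>{1..X}. n mod d = r mod d} = (\<lambda>q. r + d * q) ` {a<..b}"
  proof (intro equalityI subsetI)
    fix n assume n: "n \<in> {n\<in>{1..X}. n mod d = r mod d}"
    then have "d dvd n - r" by (auto simp: mod_eq_dvd_iff)
    then obtain q where q: "n = r + d * q" by (metis dvdE add.commute diff_add_cancel)
    then have "q = (n - r) div d" using assms by simp
    then have "q \<le> b" unfolding b_def using n assms by (auto intro: zdiv_mono1)
    moreover have "a < q"
    proof -
      have "- r < q * d" using n q by (simp add: mult.commute)
      then show ?thesis using dv[of q "- r"] unfolding a_def by linarith
    qed
    ultimately show "n \<in> (\<lambda>q. r + d * q) ` {a<..b}" using q by auto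
  next
    fix n assume "n \<in> (\<lambda>q. r + d * q) ` {a<..b}"
    then obtain q where "n = r + d * q" "q \<in> {a<..b}" by (elim imageE)
    then have q: "n = r + d * q" "a < q" "q \<le> b" by (simp_all del: greaterThanAtMost_iff add: greaterThanAtMost_iff)
    have "- r < q * d" using q(2) dv[of q "- r"] unfolding a_def by linarith
    moreover have "q * d \<le> X - r" using q(3) dv[of q "X - r"] unfolding b_def by linarith
    ultimately show "n \<in> {n\<in>{1..X}. n mod d = r mod d}" using q(1) by (auto simp: mult.commute)
  qed
  moreover have "inj_on (\<lambda>q. r + d * q) {a<..b}" using assms by (auto simp: inj_on_def)
  ultimately have "card {n\<in>{1..X}. n mod d = r mod d} = card {a<..b}" by (simp add: card_image)
  moreover have "a \<le> b" unfolding a_def b_def using assms by (intro zdiv_mono1) auto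
  ultimately have c: "real (card {n\<in>{1..X}. n mod d = r mod d}) = real_of_int b - real_of_int a" by simp
  have f: "real_of_int (x div d) \<le> x / d" "x / d < real_of_int (x div d) + 1" for x
    using real_of_int_div4[of x d] floor_correct[of "x / d"] by (auto simp: floor_divide_of_int_eq)
  have "real_of_int (X - r) / d - real_of_int (- r) / d = X / d" by (simp add: diff_divide_distrib)
  then show ?thesis unfolding c using f[of "X - r"] f[of "- r"] unfolding a_def b_def by linarith
qed

lemma card_residues:
  fixes X d :: int
  assumes "X \<ge> 0" "d > 0" "R \<subseteq> {0..<d}"
  shows "\<bar>real (card {n\<in>{1..X}. n mod d \<in> R}) - X * (real (card R) / d)\<bar> \<le> card R"
proof -
  have fin: "finite R" using assms finite_subset by blast
  have "{n\<in>{1..X}. n mod d \<in> R} = (\<Union>r\<in>R. {n\<in>{1..X}. n mod d = r mod d})"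
    using assms by (auto simp: subset_iff)
  also have "card \<dots> = (\<Sum>r\<in>R. card {n\<in>{1..X}. n mod d = r mod d})"
  proof (rule card_UN_disjoint)
    show "\<forall>i\<in>R. \<forall>k\<in>R. i \<noteq> k \<longrightarrow> {n\<in>{1..X}. n mod d = i mod d} \<inter> {n\<in>{1..X}. n mod d = k mod d} = {}"
      using assms by (force simp: subset_iff)
  qed (use fin in \<open>auto intro: finite_subset[of _ "{1..X}"]\<close>)
  finally have "real (card {n\<in>{1..X}. n mod d \<in> R}) - X * (real (card R) / d) =
    (\<Sum>r\<in>R. real (card {n\<in>{1..X}. n mod d = r mod d}) - X / d)"
    by (simp add: sum_subtractf)
  also have "\<bar>\<dots>\<bar> \<le> (\<Sum>r\<in>R. 1)"
    by (rule order_trans[OF sum_abs sum_mono]) (use card_residue_class assms in auto)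
  finally show ?thesis by simp
qed

lemma prod_prime_factors_squarefree:
  fixes n :: int
  assumes "squarefree n" "n > 0"
  shows "\<Prod>(prime_factors n) = n"
proof -
  have "n = (\<Prod>p\<in>prime_factors n. p ^ multiplicity p n)"
    using prod_prime_factors[of n] assms by simp
  also have "\<dots> = (\<Prod>p\<in>prime_factors n. p)"
  proof (rule prod.cong[OF refl])
    fix p assume "p \<in> prime_factors n"
    then have "multiplicity p n = 1" using assms squarefree_factorial_semiring'[of n] by auto
    then show "p ^ multiplicity p n = p" by simp
  qed
  finally show ?thesis by simp
qed

text \<open>Every \<open>n \<le> z\<close> is a squarefree number times a square, and the reciprocals of the squares sum to less than 3.\<close>

lemma ln_le_trunc_sum:
  fixes z :: real and P :: "int set"
  assumes z: "z \<ge> 1" and P: "finite P" "\<And>p. p \<in> P \<Longrightarrow> prime p" "\<And>p. prime p \<Longrightarrow> real_of_int p \<le> z \<Longrightarrow> p \<in> P"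
  shows "ln z \<le> 3 * trunc_sum P (\<lambda>p. 1 / real_of_int p) z"
proof -
  define N where "N = nat \<lfloor>z\<rfloor>"
  have N: "real N \<le> z" "z < real N + 1" using z unfolding N_def by linarith+
  define D where "D = {C\<in>Pow P. real_of_int (\<Prod>C) \<le> z}"
  define \<phi> where "\<phi> = (\<lambda>(C, m::int). 1 / real_of_int (\<Prod>C) * (1 / (real_of_int m)\<^sup>2))"
  define f where "f = (\<lambda>n::int. (prime_factors (squarefree_part n), square_part n))"
  have f: "\<Prod>(fst (f n)) * (snd (f n))\<^sup>2 = n" "fst (f n) \<in> D" "snd (f n) \<in> {1..int N}" if n: "n \<in> {1..int N}" for n
  proof -
    have dec: "n = squarefree_part n * square_part n ^ 2" by (rule squarefree_decompose)
    have "normalize (square_part n) = square_part n" by (rule normalize_square_part)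
    then have "\<bar>square_part n\<bar> = square_part n" by (simp only: normalize_int_def)
    moreover have "square_part n \<noteq> 0" using n by auto
    ultimately have sq: "square_part n \<ge> 1" by linarith
    have sf: "squarefree_part n > 0"
    proof (rule ccontr)
      assume "\<not> squarefree_part n > 0"
      then have "squarefree_part n * square_part n ^ 2 \<le> 0" by (intro mult_nonpos_nonneg) auto
      then show False using dec n by auto
    qed
    have pf: "\<Prod>(prime_factors (squarefree_part n)) = squarefree_part n"
      using sf by (intro prod_prime_factors_squarefree) auto
    show 1: "\<Prod>(fst (f n)) * (snd (f n))\<^sup>2 = n" unfolding f_def fst_conv snd_conv pf by (rule dec[symmetric])
    have "squarefree_part n * 1 \<le> squarefree_part n * square_part n ^ 2"
      using sf sq by (intro mult_left_mono one_le_power) auto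
    then have sfn: "squarefree_part n \<le> n" using dec by simp
    have "square_part n * 1 \<le> squarefree_part n * square_part n ^ 2"
    proof -
      have "1 * (square_part n * 1) \<le> squarefree_part n * (square_part n * square_part n)"
        using sf sq by (intro mult_mono) auto
      then show ?thesis by (simp add: power2_eq_square)
    qed
    then have "square_part n \<le> n" using dec by simp
    then show "snd (f n) \<in> {1..int N}" using n sq by (auto simp: f_def)
    have "prime_factors (squarefree_part n) \<subseteq> P"
    proof
      fix p assume p: "p \<in> prime_factors (squarefree_part n)"
      then have "p dvd squarefree_part n" "prime p" by auto
      then have "p \<le> squarefree_part n" using sf zdvd_imp_le by blast
      then have "real_of_int p \<le> z" using sfn n N by auto
      then show "p \<in> P" using P \<open>prime p\<close> by auto
    qed
    moreover have "real_of_int (squarefree_part n) \<le> z" using sfn n N by auto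
    ultimately show "fst (f n) \<in> D" unfolding D_def f_def fst_conv mem_Collect_eq pf by auto
  qed
  have inj: "inj_on f {1..int N}" by (metis f(1) inj_onI)
  have finD: "finite D" unfolding D_def using P by auto
  have pos: "\<phi> x \<ge> 0" if "x \<in> D \<times> {1..int N}" for x
  proof -
    have "\<Prod>(fst x) \<ge> 0" by (rule prod_nonneg) (use that P in \<open>auto simp: D_def prime_ge_0_int\<close>)
    then show ?thesis unfolding \<phi>_def by (auto simp: case_prod_beta simp del: of_int_prod)
  qed
  have "ln z \<le> ln (real N + 1)" using N z by (subst ln_le_cancel_iff) auto
  also have "\<dots> \<le> harm N" using ln_le_harm[of N] by simp
  also have "\<dots> = (\<Sum>k=1..N. 1 / real k)" by (simp add: harm_def inverse_eq_divide)
  also have "\<dots> = (\<Sum>n=1..int N. 1 / real_of_int n)"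
    by (rule sum.reindex_bij_witness[of _ nat int]) auto
  also have "\<dots> = (\<Sum>n=1..int N. \<phi> (f n))"
  proof (rule sum.cong[OF refl])
    fix n assume n: "n \<in> {1..int N}"
    have "real_of_int n = real_of_int (\<Prod>(fst (f n))) * (real_of_int (snd (f n)))\<^sup>2"
      using arg_cong[OF f(1)[OF n], of real_of_int] by (simp only: of_int_mult of_int_power)
    then show "1 / real_of_int n = \<phi> (f n)" unfolding \<phi>_def by (simp add: case_prod_beta)
  qed
  also have "\<dots> = (\<Sum>x\<in>f ` {1..int N}. \<phi> x)" by (subst sum.reindex[OF inj]) simp
  also have "\<dots> \<le> (\<Sum>x\<in>D \<times> {1..int N}. \<phi> x)"
  proof (rule sum_mono2)
    show "f ` {1..int N} \<subseteq> D \<times> {1..int N}" using f(2,3) by (metis (no_types) image_subsetI mem_Times_iff)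
  qed (use finD pos in auto)
  also have "\<dots> = (\<Sum>C\<in>D. 1 / real_of_int (\<Prod>C)) * (\<Sum>m=1..int N. 1 / (real_of_int m)\<^sup>2)"
    unfolding \<phi>_def sum_product by (simp add: sum.cartesian_product)
  also have "(\<Sum>C\<in>D. 1 / real_of_int (\<Prod>C)) = trunc_sum P (\<lambda>p. 1 / real_of_int p) z"
    unfolding trunc_sum_def D_def by (simp add: prod_dividef)
  also have "(\<Sum>m=1..int N. 1 / (real_of_int m)\<^sup>2) = (\<Sum>i<N. 1 / (real i + 1)\<^sup>2)"
    by (rule sum.reindex_bij_witness[of _ "\<lambda>i. int i + 1" "\<lambda>m. nat (m - 1)"]) auto
  also have "trunc_sum P (\<lambda>p. 1 / real_of_int p) z * (\<Sum>i<N. 1 / (real i + 1)\<^sup>2) \<le> trunc_sum P (\<lambda>p. 1 / real_of_int p) z * 3"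
  proof (rule mult_left_mono)
    have "(\<Sum>i<N. 1 / (real i + 1)\<^sup>2) \<le> (\<Sum>i. 1 / (real i + 1)\<^sup>2)"
      using inverse_squares_sums by (intro sum_le_suminf) (auto simp: sums_iff add.commute)
    also have "\<dots> = pi\<^sup>2 / 6" using inverse_squares_sums by (simp add: sums_iff add.commute)
    also have "\<dots> \<le> 4\<^sup>2 / 6" using pi_less_4 by (intro divide_right_mono power_mono) auto
    finally show "(\<Sum>i<N. 1 / (real i + 1)\<^sup>2) \<le> 3" by simp
    show "0 \<le> trunc_sum P (\<lambda>p. 1 / real_of_int p) z"
      using P by (intro trunc_sum_nonneg) (auto simp: prime_ge_0_int)
  qed
  finally show ?thesis by simp
qed

text \<open>A set of primes is recovered from its product as the primes dividing it, so these sets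
  inject into the positive integers up to \<open>z\<close>.\<close>

lemma card_prod_primes_le:
  fixes z :: real and P :: "int set"
  assumes P: "finite P" "\<And>p. p \<in> P \<Longrightarrow> prime p" and z: "z \<ge> 0"
  shows "real (card {C\<in>Pow P. real_of_int (\<Prod>C) \<le> z}) \<le> z"
proof -
  define D where "D = {C\<in>Pow P. real_of_int (\<Prod>C) \<le> z}"
  have mem: "p \<in> C \<longleftrightarrow> p dvd \<Prod>C" if "C \<in> D" "p \<in> P" for p C
  proof -
    have "C \<subseteq> P" "finite C" using that P finite_subset by (auto simp: D_def)
    note pP = P(2)[OF that(2)]
    show ?thesis
    proof
      assume "p \<in> C"
      then show "p dvd \<Prod>C" using \<open>finite C\<close> using dvd_prodI[of C p "\<lambda>x. x"] by simp
    next
      assume "p dvd \<Prod>C"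
      then obtain x where x: "x \<in> C" "p dvd x"
        using prime_dvd_prod_iff[OF \<open>finite C\<close> pP, of "\<lambda>x. x"] by blast
      then have "p = x" using primes_dvd_imp_eq[of p x] P(2) pP \<open>C \<subseteq> P\<close> by blast
      then show "p \<in> C" using x by simp
    qed
  qed
  have "inj_on Prod D"
  proof (rule inj_onI)
    fix A B assume AB: "A \<in> D" "B \<in> D" "\<Prod>A = \<Prod>B"
    then have "A \<subseteq> P" "B \<subseteq> P" by (simp_all add: D_def)
    moreover have "x \<in> A \<longleftrightarrow> x \<in> B" if "x \<in> P" for x
      unfolding mem[OF AB(1) that] mem[OF AB(2) that] AB(3) ..
    ultimately show "A = B" by blast
  qed
  moreover have "Prod ` D \<subseteq> {1..\<lfloor>z\<rfloor>}"
  proof clarify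
    fix C assume C: "C \<in> D"
    have "\<Prod>C > 0" by (rule prod_pos) (use C P in \<open>auto simp: D_def prime_gt_0_int\<close>)
    then show "\<Prod>C \<in> {1..\<lfloor>z\<rfloor>}" using C by (simp add: D_def le_floor_iff)
  qed
  ultimately have "card D \<le> card {1..\<lfloor>z\<rfloor>}" by (intro card_inj_on_le) auto
  also have "real (card {1..\<lfloor>z\<rfloor>}) \<le> z" using z by simp
  finally show ?thesis by (simp add: D_def)
qed

lemma W_ge_1: "W h \<ge> 1"
  unfolding W_def by (rule prod_ge_1) (auto simp: prime_ge_0_int)

text \<open>Selberg's sieve removes the \<open>n\<close> for which some prime up to \<open>z\<close>
  divides \<open>n * (n + h)\<close>. The three terms are the main term, the remainder, and the
  pairs in which \<open>p\<close> or \<open>p + h\<close> is itself a sieving prime.\<close>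

lemma prime_pair_count_sieve_bound:
  fixes x z :: real
  assumes h: "h \<noteq> 0" "even h" and z: "z > 1" and x: "x \<ge> 0"
  shows "real (prime_pair_count h x) \<le> 36 * W h * x / (ln z)\<^sup>2 + z ^ 6 + 2 * z"
proof -
  define P where "P = {p :: int. prime p \<and> real_of_int p \<le> z}"
  have P: "finite P" "\<And>p. p \<in> P \<Longrightarrow> prime p" by (auto simp: P_def)
  \<comment> \<open>The number of classes modulo \<open>p\<close> on which \<open>p\<close> divides
    \<open>n * (n + h)\<close>.\<close>
  define \<rho> where "\<rho> = (\<lambda>p::int. if p dvd h then 1 else 2 :: real)"
  define g where "g = (\<lambda>p::int. \<rho> p / real_of_int p)"
  define D where "D = {C\<in>Pow P. real_of_int (\<Prod>C) \<le> z}"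
  \<comment> \<open>At \<open>p = 2\<close> this rests on \<open>h\<close> being even: the classes
    of 0 and \<open>- h\<close> then coincide, so that \<open>g 2 < 1\<close>.\<close>
  have \<rho>: "1 \<le> \<rho> p" "\<rho> p \<le> p - 1" if "p \<in> P" for p
  proof -
    have "prime p" using that P by auto
    then have "p \<ge> 2" by (rule prime_ge_2_int)
    moreover have "p \<noteq> 2" if "\<not> p dvd h" using that h by auto
    ultimately show "1 \<le> \<rho> p" "\<rho> p \<le> p - 1" by (auto simp: \<rho>_def)
  qed
  have ppos: "p > 0" if "p \<in> P" for p using that P by (auto simp: prime_gt_0_int)
  have g: "0 < g p \<and> g p < 1" if "p \<in> P" for p
    using \<rho>[OF that] ppos[OF that] by (auto simp: g_def)
  have prod_ge1: "\<Prod>C \<ge> 1" if "C \<subseteq> P" for C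
  proof -
    have "\<Prod>C > 0" by (rule prod_pos) (use that ppos in auto)
    then show ?thesis by simp
  qed
  interpret selberg_weights P g D
  proof
    show "{} \<in> D" using z by (auto simp: D_def)
    fix A C assume AC: "C \<in> D" "A \<subseteq> C"
    have CP: "C \<subseteq> P" "finite C" using AC P finite_subset by (auto simp: D_def)
    have "\<Prod>C = \<Prod>(C - A) * \<Prod>A" using AC CP by (intro prod.subset_diff) auto
    moreover have "1 * \<Prod>A \<le> \<Prod>(C - A) * \<Prod>A"
      using prod_ge1[of A] prod_ge1[of "C - A"] AC CP by (intro mult_right_mono) (auto simp: subset_iff)
    ultimately have "\<Prod>A \<le> \<Prod>C" by simp
    then have "real_of_int (\<Prod>A) \<le> real_of_int (\<Prod>C)" by (simp only: of_int_le_iff)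
    then have "real_of_int (\<Prod>A) \<le> z" using AC unfolding D_def by (auto simp del: of_int_prod)
    then show "A \<in> D" using AC CP by (auto simp: D_def)
  qed (use P g in \<open>auto simp: D_def\<close>)
  define X where "X = \<lfloor>x\<rfloor>"
  have X: "X \<ge> 0" "real_of_int X \<le> x" using x by (auto simp: X_def)
  define E where "E = (\<lambda>p n. p dvd n * (n + h))"
  define r where "r = (\<lambda>C. \<Prod>p\<in>C. \<rho> p)"
  have count: "\<bar>real (card {n\<in>{1..X}. \<forall>p\<in>C. E p n}) - real_of_int X * (\<Prod>p\<in>C. g p)\<bar> \<le> r C" if C: "C \<subseteq> P" for C
  proof -
    have finC: "finite C" using C P finite_subset by auto
    define \<Omega> where "\<Omega> = (\<lambda>p. {0, (- h) mod p})"
    have \<Omega>: "\<Omega> p \<subseteq> {0..<p}" "real (card (\<Omega> p)) = \<rho> p" "E p n \<longleftrightarrow> n mod p \<in> \<Omega> p" if "p \<in> C" for p n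
    proof -
      have p: "p \<in> P" "prime p" "p > 0" using that C P ppos by auto
      show "\<Omega> p \<subseteq> {0..<p}" using p by (auto simp: \<Omega>_def)
      have "(- h) mod p = 0 \<longleftrightarrow> p dvd h" by (simp add: dvd_eq_mod_eq_0[symmetric])
      then show "real (card (\<Omega> p)) = \<rho> p" by (auto simp: \<Omega>_def \<rho>_def card_insert_if)
      have "E p n \<longleftrightarrow> p dvd n \<or> p dvd n + h" unfolding E_def using p by (simp add: prime_dvd_mult_iff)
      also have "p dvd n + h \<longleftrightarrow> n mod p = (- h) mod p" by (simp add: mod_eq_dvd_iff)
      finally show "E p n \<longleftrightarrow> n mod p \<in> \<Omega> p" by (auto simp: \<Omega>_def dvd_eq_mod_eq_0)
    qed
    obtain R where R: "R \<subseteq> {0..<\<Prod>C}" "card R = (\<Prod>p\<in>C. card (\<Omega> p))"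
      "\<And>n. (\<forall>p\<in>C. n mod p \<in> \<Omega> p) \<longleftrightarrow> n mod \<Prod>C \<in> R"
      using residues_prod_primes[OF finC, of \<Omega>] \<Omega>(1) C P by blast
    have cR: "real (card R) = r C" unfolding R(2) r_def using \<Omega>(2) by simp
    have "{n\<in>{1..X}. \<forall>p\<in>C. E p n} = {n\<in>{1..X}. n mod \<Prod>C \<in> R}" using \<Omega>(3) R(3) by auto
    moreover have "r C / real_of_int (\<Prod>C) = (\<Prod>p\<in>C. g p)" by (simp add: r_def g_def prod_dividef)
    ultimately show ?thesis
      using card_residues[OF X(1) _ R(1)] prod_ge1[OF C] unfolding cR by simp
  qed
  have r1: "r A \<ge> 1" if "A \<subseteq> P" for A unfolding r_def using that \<rho> by (intro prod_ge_1) auto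
  have rU: "r (A \<union> B) \<le> r A * r B" if "A \<in> D" "B \<in> D" for A B
  proof -
    have AB: "A \<subseteq> P" "B \<subseteq> P" using that DP by auto
    have fin: "finite A" "finite B" using finite_subset[OF AB(1) P(1)] finite_subset[OF AB(2) P(1)] .
    have "r (A \<union> B) * 1 \<le> r (A \<union> B) * r (A \<inter> B)"
      using r1[of "A \<union> B"] r1[of "A \<inter> B"] AB by (intro mult_left_mono) auto
    also have "\<dots> = r A * r B" unfolding r_def by (rule prod.union_inter[OF fin])
    finally show ?thesis by simp
  qed
  have sv: "real (card {n\<in>{1..X}. \<forall>p\<in>P. \<not> E p n}) \<le> real_of_int X / G + (\<Sum>A\<in>D. \<bar>wt A\<bar> * r A)\<^sup>2"
    by (rule sieve[where r = r, OF _ count rU]) auto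
  \<comment> \<open>Both factors of a summand are at most the product of \<open>A\<close>, hence at
    most \<open>z\<close>, and \<open>D\<close> has at most \<open>z\<close> elements.\<close>
  have err: "(\<Sum>A\<in>D. \<bar>wt A\<bar> * r A) \<le> z ^ 3"
  proof -
    have "(\<Sum>A\<in>D. \<bar>wt A\<bar> * r A) \<le> (\<Sum>A\<in>D. z\<^sup>2)"
    proof (rule sum_mono)
      fix A assume A: "A \<in> D"
      then have AP: "A \<subseteq> P" using DP by auto
      have "\<bar>wt A\<bar> \<le> (\<Prod>p\<in>A. 1 / (1 - g p))" by (rule abs_wt_le[OF AP])
      also have "\<dots> \<le> (\<Prod>p\<in>A. real_of_int p)"
      proof (rule prod_mono, safe)
        fix p assume "p \<in> A"
        then have p: "p \<in> P" using AP by auto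
        then show "0 \<le> 1 / (1 - g p)" using g by (simp add: less_imp_le)
        have "1 / (1 - g p) = real_of_int p / (real_of_int p - \<rho> p)"
          using ppos[OF p] by (simp add: g_def divide_simps)
        also have "\<dots> \<le> real_of_int p / 1"
          using \<rho>[OF p] ppos[OF p] by (intro divide_left_mono) auto
        finally show "1 / (1 - g p) \<le> real_of_int p" by simp
      qed
      finally have 1: "\<bar>wt A\<bar> \<le> real_of_int (\<Prod>A)" by simp
      have "r A \<le> (\<Prod>p\<in>A. real_of_int p)"
        unfolding r_def
      proof (rule prod_mono, safe)
        fix p assume "p \<in> A"
        then have p: "p \<in> P" using AP by auto
        then show "0 \<le> \<rho> p" "\<rho> p \<le> real_of_int p" using \<rho>[OF p] by auto
      qed
      then have 2: "r A \<le> real_of_int (\<Prod>A)" by simp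
      have z': "real_of_int (\<Prod>A) \<le> z" using A by (simp add: D_def)
      have "\<bar>wt A\<bar> * r A \<le> z * z"
        using 1 2 z' r1[OF AP] z by (intro mult_mono) (auto simp del: of_int_prod)
      then show "\<bar>wt A\<bar> * r A \<le> z\<^sup>2" by (simp add: power2_eq_square)
    qed
    also have "\<dots> = real (card D) * z\<^sup>2" by simp
    also have "\<dots> \<le> z * z\<^sup>2"
      unfolding D_def using P z by (intro mult_right_mono card_prod_primes_le) auto
    finally show ?thesis by (simp add: power2_eq_square power3_eq_cube)
  qed
  have err0: "0 \<le> (\<Sum>A\<in>D. \<bar>wt A\<bar> * r A)"
    using r1 DP by (intro sum_nonneg mult_nonneg_nonneg) (auto intro: order_trans[OF zero_le_one])
  have "(\<Sum>A\<in>D. \<bar>wt A\<bar> * r A)\<^sup>2 \<le> (z ^ 3)\<^sup>2" by (intro power_mono err err0)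
  then have err2: "(\<Sum>A\<in>D. \<bar>wt A\<bar> * r A)\<^sup>2 \<le> z ^ 6" by (simp flip: power_mult)
  \<comment> \<open>The square of the harmonic sum up to \<open>sqrt z\<close> is at most a
    truncated sum up to \<open>z\<close>, matching two classes per prime. A prime dividing
    \<open>h\<close> offers only one class, and the missing \<open>1 + 1 / p\<close> is collected in
    \<open>W h\<close>. The 36 is the square of 6: a 3 from \<open>ln_le_trunc_sum\<close> and a 2
    from \<open>ln (sqrt z)\<close>.\<close>
  have Gge: "G \<ge> (ln z)\<^sup>2 / (36 * W h)"
  proof -
    define u where "u = (\<lambda>p::int. 1 / real_of_int p)"
    define s where "s = (\<lambda>p::int. if p dvd h then 1 / real_of_int p else 0)"
    define jj where "jj = (\<lambda>p::int. g p / (1 - g p))"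
    have "ln z / 6 = ln (sqrt z) / 3" using z by (simp add: ln_sqrt)
    also have "\<dots> \<le> trunc_sum P u (sqrt z)"
    proof -
      have "sqrt z \<le> z"
      proof -
        have "sqrt z \<le> sqrt (z * z)" using z by (intro real_sqrt_le_mono) auto
        then show ?thesis using z by simp
      qed
      then have "ln (sqrt z) \<le> 3 * trunc_sum P u (sqrt z)"
        unfolding u_def
      proof (intro ln_le_trunc_sum P)
        fix p :: int assume "prime p" "real_of_int p \<le> sqrt z"
        then show "p \<in> P" using \<open>sqrt z \<le> z\<close> unfolding P_def by simp
      qed (use z in simp_all)
      then show ?thesis by simp
    qed
    finally have "(ln z / 6)\<^sup>2 \<le> (trunc_sum P u (sqrt z))\<^sup>2" using z by (intro power_mono) auto
    also have "\<dots> \<le> trunc_sum P (\<lambda>p. 2 * u p + (u p)\<^sup>2) (sqrt z * sqrt z)"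
      unfolding power2_eq_square[of "trunc_sum P u (sqrt z)"]
      using P ppos z by (intro trunc_sum_product) (auto simp: u_def intro: less_imp_le)
    also have "sqrt z * sqrt z = z" using z by simp
    also have "trunc_sum P (\<lambda>p. 2 * u p + (u p)\<^sup>2) z \<le> (\<Prod>p\<in>P. 1 + s p) * trunc_sum P jj z"
    proof (rule trunc_sum_compare[OF P(1)])
      fix p assume p: "p \<in> P"
      define q where "q = real_of_int p"
      have pr: "prime p" using p P by auto
      have q: "q \<ge> 2" "q > 0" using prime_ge_2_int[OF pr] by (auto simp: q_def)
      have jj: "jj p = \<rho> p / (q - \<rho> p)"
        unfolding jj_def g_def q_def[symmetric] using q by (simp add: divide_simps)
      have jj0: "jj p \<ge> 0" unfolding jj_def using g[OF p] by auto
      have "2 * u p + (u p)\<^sup>2 \<le> jj p + s p + jj p * s p"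
      proof (cases "p dvd h")
        case True
        have e: "jj p \<ge> u p"
        proof -
          have "jj p = 1 / (q - 1)" using True by (simp add: jj \<rho>_def)
          moreover have "1 / (q - 1) \<ge> 1 / q" using q by (intro divide_left_mono) auto
          ultimately show ?thesis by (simp add: u_def q_def)
        qed
        have sp: "s p = u p" using True by (simp add: s_def u_def)
        have "u p * (1 + u p) \<le> jj p * (1 + u p)" using e q by (intro mult_right_mono) (auto simp: u_def q_def)
        then show ?thesis unfolding sp by (simp add: power2_eq_square algebra_simps)
      next
        case False
        have "p \<noteq> 2" using False h by auto
        then have q3: "q \<ge> 3" using prime_ge_2_int[OF pr] by (auto simp: q_def)
        have "2 * u p + (u p)\<^sup>2 = (2 * q + 1) / q\<^sup>2"
          using q by (simp add: u_def q_def[symmetric] power2_eq_square field_simps)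
        also have "\<dots> \<le> 2 / (q - 2)"
        proof -
          have "(2 * q + 1) * (q - 2) \<le> 2 * q\<^sup>2" using q by (simp add: power2_eq_square algebra_simps)
          then show ?thesis using q3 by (simp add: divide_simps mult.commute)
        qed
        also have "\<dots> = jj p" using False by (simp add: jj \<rho>_def)
        finally show ?thesis using False by (simp add: s_def)
      qed
      then show "p > 0 \<and> 0 \<le> 2 * u p + (u p)\<^sup>2 \<and> 0 \<le> jj p \<and> 0 \<le> s p \<and> 2 * u p + (u p)\<^sup>2 \<le> jj p + s p + jj p * s p"
        using ppos[OF p] jj0 by (auto simp: u_def s_def)
    qed
    also have "trunc_sum P jj z = G" unfolding trunc_sum_def D_def[symmetric] jj_def by (simp add: G_def j_def)
    also have "(\<Prod>p\<in>P. 1 + s p) * G \<le> W h * G"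
    proof (rule mult_right_mono)
      have "(\<Prod>p\<in>P. 1 + s p) = (\<Prod>p\<in>{p\<in>P. p dvd h}. 1 + 1 / real_of_int p)"
        using P by (intro prod.mono_neutral_cong_right) (auto simp: s_def)
      also have "\<dots> \<le> W h" unfolding W_def
      proof (rule prod_mono2)
        show "finite {p. prime p \<and> p dvd h}"
          using h by (intro finite_subset[OF _ finite_divisors_int[of h]]) auto
      qed (use P ppos in \<open>auto simp: prime_ge_0_int intro!: add_nonneg_nonneg\<close>)
      finally show "(\<Prod>p\<in>P. 1 + s p) \<le> W h" .
    qed (use G_pos in auto)
    finally show ?thesis using W_pos[of h] by (simp add: power_divide pos_divide_le_eq mult_ac)
  qed
  have main: "real_of_int X / G \<le> 36 * W h * x / (ln z)\<^sup>2"
  proof -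
    have lz: "(ln z)\<^sup>2 > 0" using z by simp
    have "real_of_int X / G \<le> x / G" using X G_pos by (intro divide_right_mono) auto
    also have "\<dots> \<le> x / ((ln z)\<^sup>2 / (36 * W h))"
      using Gge lz W_pos[of h] x G_pos by (intro divide_left_mono) auto
    finally show ?thesis by (simp add: mult_ac)
  qed
  \<comment> \<open>If a sieving prime divides \<open>p * (p + h)\<close> with both factors prime,
    it equals one of them. So at most \<open>2 * z\<close> of the counted \<open>p\<close> escape
    the sifted set.\<close>
  define Z where "Z = {1..\<lfloor>z\<rfloor>}"
  have "{p :: int. prime p \<and> real_of_int p \<le> x \<and> prime (p + h)} \<subseteq>
      {n\<in>{1..X}. \<forall>p\<in>P. \<not> E p n} \<union> (Z \<union> (\<lambda>q. q - h) ` Z)"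
  proof
    fix p assume "p \<in> {p :: int. prime p \<and> real_of_int p \<le> x \<and> prime (p + h)}"
    then have p: "prime p" "real_of_int p \<le> x" "prime (p + h)" by auto
    show "p \<in> {n\<in>{1..X}. \<forall>p\<in>P. \<not> E p n} \<union> (Z \<union> (\<lambda>q. q - h) ` Z)"
    proof (cases "\<forall>q\<in>P. \<not> E q p")
      case True
      then show ?thesis using p prime_gt_0_int[OF p(1)] by (auto simp: X_def le_floor_iff)
    next
      case False
      then obtain q where q: "q \<in> P" "q dvd p * (p + h)" by (auto simp: E_def)
      then have "prime q" "real_of_int q \<le> z" by (auto simp: P_def)
      then have qZ: "q \<in> Z" using prime_gt_0_int[of q] by (auto simp: Z_def le_floor_iff)
      have "q dvd p \<or> q dvd p + h" using q \<open>prime q\<close> by (simp add: prime_dvd_mult_iff)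
      then have "q = p \<or> q = p + h" using p \<open>prime q\<close> by (auto dest: primes_dvd_imp_eq)
      then show ?thesis using qZ by force
    qed
  qed
  then have "prime_pair_count h x \<le> card ({n\<in>{1..X}. \<forall>p\<in>P. \<not> E p n} \<union> (Z \<union> (\<lambda>q. q - h) ` Z))"
    unfolding prime_pair_count_def by (intro card_mono) (auto simp: Z_def intro: finite_subset[of _ "{1..X}"])
  also have "\<dots> \<le> card {n\<in>{1..X}. \<forall>p\<in>P. \<not> E p n} + (card Z + card ((\<lambda>q. q - h) ` Z))"
    by (meson add_left_mono card_Un_le order_trans)
  also have "card ((\<lambda>q. q - h) ` Z) \<le> card Z" by (rule card_image_le) (simp add: Z_def)
  finally have "real (prime_pair_count h x) \<le> real (card {n\<in>{1..X}. \<forall>p\<in>P. \<not> E p n}) + 2 * real (card Z)" by linarith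
  moreover have "real (card Z) \<le> z" using z by (simp add: Z_def)
  ultimately show ?thesis using sv main err2 by linarith
qed

lemma C0_finite: "C0 < \<infinity>"
proof -
  \<comment> \<open>The choice \<open>z = x powr (1 / 12)\<close> makes
    \<open>z ^ 6 = sqrt x\<close> negligible. The main term is then \<open>36 * 12^2 = 5184\<close>,
    and 1 covers the remainder.\<close>
  have "C0 \<le> ereal 5185"
    unfolding C0_def
  proof (rule Limsup_bounded)
    have 1: "\<forall>\<^sub>F x::real in at_top. (ln x)\<^sup>2 * (x powr (1 / 2) + 2 * x powr (1 / 12)) / x \<le> 1" by real_asymp
    have 2: "\<forall>\<^sub>F x::real in at_top. 2 * (ln x)\<^sup>2 / x \<le> 1" by real_asymp
    show "\<forall>\<^sub>F x in at_top. (SUP h \<in> UNIV - {0 :: int}. ereal ((ln x)\<^sup>2 / (x * W h) * real (prime_pair_count h x))) \<le> ereal 5185"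
      using 1 2 eventually_gt_at_top[of 1]
    proof eventually_elim
      case (elim x)
      show ?case
      proof (rule SUP_least)
        fix h :: int assume h: "h \<in> UNIV - {0}"
        define c where "c = real (prime_pair_count h x)"
        define w where "w = W h"
        have w: "w \<ge> 1" unfolding w_def by (rule W_ge_1)
        define q where "q = (ln x)\<^sup>2 / (x * w)"
        have q: "q \<ge> 0" "q \<le> (ln x)\<^sup>2 / x" using elim w
          by (auto simp: q_def intro!: divide_left_mono)
        have "q * c \<le> 5185"
        proof (cases "even h")
          case True
          define z where "z = x powr (1 / 12)"
          have z: "z > 1" "ln z = ln x / 12" using elim by (auto simp: z_def ln_powr)
          have z6: "z ^ 6 = x powr (1 / 2)" using elim unfolding z_def
            by (subst powr_power) auto
          have "c \<le> 36 * w * x / (ln z)\<^sup>2 + z ^ 6 + 2 * z"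
            unfolding c_def w_def using h True z elim by (intro prime_pair_count_sieve_bound) auto
          then have "q * c \<le> q * (36 * w * x / (ln z)\<^sup>2 + z ^ 6 + 2 * z)" using q by (intro mult_left_mono) auto
          also have "\<dots> = q * (36 * w * x / (ln z)\<^sup>2) + q * (z ^ 6 + 2 * z)" by (simp add: algebra_simps)
          also have "q * (36 * w * x / (ln z)\<^sup>2) = 5184"
            using elim w unfolding q_def z by (simp add: power_divide)
          also have "q * (z ^ 6 + 2 * z) \<le> (ln x)\<^sup>2 / x * (z ^ 6 + 2 * z)" using q z by (intro mult_right_mono) auto
          also have "\<dots> = (ln x)\<^sup>2 * (x powr (1 / 2) + 2 * x powr (1 / 12)) / x"
            unfolding z6 by (simp add: z_def)
          also have "\<dots> \<le> 1" by (rule elim)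
          finally show ?thesis by simp
        next
          case False
          have "prime_pair_count h x \<le> 2" unfolding prime_pair_count_def by (rule prime_pairs_odd_difference[OF False])
          then have "c \<le> 2" by (simp add: c_def)
          then have "q * c \<le> (ln x)\<^sup>2 / x * 2" using q elim by (intro mult_mono) (auto simp: c_def)
          also have "\<dots> \<le> 1" using elim by (simp add: mult.commute)
          finally show ?thesis by simp
        qed
        then show "ereal ((ln x)\<^sup>2 / (x * W h) * real (prime_pair_count h x)) \<le> ereal 5185"
          by (simp add: q_def c_def w_def)
      qed
    qed
  qed
  also have "\<dots> < \<infinity>" by simp
  finally show ?thesis .
qed

section \<open>Congruences between integer parts of powers\<close>

definition floor_cong_set :: "nat \<Rightarrow> int \<Rightarrow> int \<Rightarrow> real \<Rightarrow> real \<Rightarrow> real set" where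
  "floor_cong_set l d s a b = {y \<in> {a..<b}. d dvd \<lfloor>y ^ l\<rfloor> - s}"

text \<open>On a piece \<open>n \<le> y ^ l \<le> n + 1\<close>, increments of \<open>cong_cmp\<close> bound the measure of \<open>floor_cong_set\<close>;
  the term \<open>saw\<close> is chosen so that consecutive pieces fit together.\<close>

definition saw :: "int \<Rightarrow> int \<Rightarrow> real" where
  "saw d j = (if d dvd j then 0 else 1 - real_of_int (j mod d) / real_of_int d)"

definition cong_cmp :: "nat \<Rightarrow> int \<Rightarrow> int \<Rightarrow> int \<Rightarrow> real \<Rightarrow> real" where
  "cong_cmp l d s n y = y / d + (saw d (n - s) + (y ^ l - n) * (of_bool (d dvd n - s) - 1 / real_of_int d) - 1)
      / (l * y ^ (l - 1))"

text \<open>\<open>saw\<close> is a discrete primitive of the indicator of \<open>d dvd j\<close>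
  minus its mean \<open>1 / d\<close>. These increments are the slopes of the linear interpolation
  in \<open>cong_cmp\<close>.\<close>

lemma saw_step:
  assumes "d \<ge> 1"
  shows "saw d (j + 1) = saw d j + of_bool (d dvd j) - 1 / d"
proof (cases "d dvd j")
  case True
  then have "j mod d = 0" by simp
  then have "(j + 1) mod d = 1 mod d" by (metis add_0 mod_add_left_eq)
  then show ?thesis using True assms
    by (cases "d = 1") (auto simp: saw_def dvd_eq_mod_eq_0)
next
  case False
  define m where "m = j mod d"
  have m: "0 \<le> m" "m < d" "m \<noteq> 0" using False assms by (auto simp: m_def dvd_eq_mod_eq_0)
  have e: "(j + 1) mod d = (m + 1) mod d" by (simp add: m_def mod_add_left_eq)
  show ?thesis
  proof (cases "m + 1 = d")
    case True
    then have "d dvd j + 1" using e by (simp add: dvd_eq_mod_eq_0)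
    then show ?thesis using False True assms
      by (auto simp: saw_def field_simps simp flip: m_def)
  next
    case F: False
    then have "(j + 1) mod d = m + 1" using e m by simp
    moreover from this have "\<not> d dvd j + 1" using m by (simp add: dvd_eq_mod_eq_0)
    ultimately show ?thesis using False assms
      by (auto simp: saw_def field_simps simp flip: m_def)
  qed
qed

lemma saw_bounds: "d \<ge> 1 \<Longrightarrow> 0 \<le> saw d j" "d \<ge> 1 \<Longrightarrow> saw d j \<le> 1"
proof -
  assume d: "d \<ge> 1"
  have "j mod d < d" "0 \<le> j mod d" using d by (auto simp: pos_mod_bound)
  then have "j mod d \<le> d" by linarith
  then have "real_of_int (j mod d) / d \<le> 1" "real_of_int (j mod d) / d \<ge> 0" using d \<open>0 \<le> j mod d\<close>
    by (auto simp: divide_simps)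
  then show "0 \<le> saw d j" "saw d j \<le> 1" by (auto simp: saw_def)
qed

text \<open>The expression is the convex combination of two consecutive values of
  \<open>saw\<close>, which lie between 0 and 1.\<close>

lemma saw_interp:
  fixes d n s :: int and t :: real
  assumes "d \<ge> 1" "real_of_int n \<le> t" "t \<le> n + 1"
  shows "0 \<le> saw d (n - s) + (t - n) * (of_bool (d dvd n - s) - 1 / real_of_int d)" (is "0 \<le> ?S")
    and "saw d (n - s) + (t - n) * (of_bool (d dvd n - s) - 1 / real_of_int d) \<le> 1"
proof -
  have e: "?S = (n + 1 - t) * saw d (n - s) + (t - n) * saw d (n - s + 1)"
    unfolding saw_step[OF assms(1)] by (simp add: algebra_simps)
  show "0 \<le> ?S" unfolding e using assms saw_bounds[OF assms(1)] by (intro add_nonneg_nonneg mult_nonneg_nonneg) auto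
  have "?S \<le> (n + 1 - t) * 1 + (t - n) * 1"
    unfolding e using assms saw_bounds[OF assms(1)] by (intro add_mono mult_left_mono) auto
  then show "?S \<le> 1" by simp
qed

text \<open>At an integer value of \<open>y ^ l\<close> the interpolations on the two neighbouring
  pieces agree, so the increments of \<open>cong_cmp\<close> over successive pieces
  telescope.\<close>

lemma cong_cmp_step:
  assumes "d \<ge> 1" "y ^ l = real_of_int (n + 1)"
  shows "cong_cmp l d s (n + 1) y = cong_cmp l d s n y"
proof -
  have "saw d (n + 1 - s) = saw d (n - s) + of_bool (d dvd n - s) - 1 / d"
    using saw_step[OF assms(1), of "n - s"] by (simp add: algebra_simps)
  then show ?thesis using assms(2) by (simp add: cong_cmp_def)
qed

lemma floor_cong_set_measurable [measurable]: "floor_cong_set l d s a b \<in> sets borel"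
  unfolding floor_cong_set_def by measurable

lemma floor_cong_set_finite: "emeasure lborel (floor_cong_set l d s a b) < \<infinity>"
proof -
  have "emeasure lborel (floor_cong_set l d s a b) \<le> emeasure lborel {a..b}"
    by (intro emeasure_mono) (auto simp: floor_cong_set_def)
  also have "\<dots> < \<infinity>" by (cases "a \<le> b") auto
  finally show ?thesis .
qed

text \<open>On one piece the set is empty or the whole interval, so it is enough that
  \<open>cong_cmp\<close> grows at least at the rate \<open>of_bool (d dvd n - s)\<close>.\<close>

lemma measure_floor_cong_piece:
  assumes d: "d \<ge> 1" and l: "l \<ge> 1" and a: "0 < a" "a \<le> b"
    and n: "real_of_int n \<le> a ^ l" "b ^ l \<le> real_of_int n + 1"
  shows "measure lborel (floor_cong_set l d s a b) \<le> cong_cmp l d s n b - cong_cmp l d s n a"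
proof -
  define c where "c = (of_bool (d dvd n - s) :: real)"
  have fl: "\<lfloor>y ^ l\<rfloor> = n" if "a \<le> y" "y < b" for y
  proof -
    have "a ^ l \<le> y ^ l" using that a by (intro power_mono) auto
    moreover have "y ^ l < b ^ l" using that a l by (intro power_strict_mono) auto
    ultimately show ?thesis using n by (intro floor_unique) auto
  qed
  have "floor_cong_set l d s a b = (if d dvd n - s then {a..<b} else {})"
    using fl by (auto simp: floor_cong_set_def)
  then have "measure lborel (floor_cong_set l d s a b) = c * (b - a)"
    using a by (auto simp: c_def)
  also have "\<dots> \<le> cong_cmp l d s n b - cong_cmp l d s n a"
  proof -
    \<comment> \<open>The derivative of \<open>cong_cmp\<close> is
      \<open>c + (1 - T) * (l - 1) / (l * y ^ l)\<close>: the power of \<open>y\<close> in the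
      numerator turns the slope \<open>1 / d\<close> into exactly \<open>c\<close>, and the rest
      comes from the denominator and is nonnegative since \<open>T \<le> 1\<close>.\<close>
    have "cong_cmp l d s n a - c * a \<le> cong_cmp l d s n b - c * b"
    proof (rule DERIV_nonneg_imp_nondecreasing[of a b "\<lambda>y. cong_cmp l d s n y - c * y"])
      fix y assume y: "a \<le> y" "y \<le> b"
      define T where "T = saw d (n - s) + (y ^ l - n) * (c - 1 / d)"
      have y0: "y > 0" using y a by simp
      have "a ^ l \<le> y ^ l" "y ^ l \<le> b ^ l" using y a by (auto intro: power_mono)
      then have T: "T \<le> 1" unfolding T_def c_def using n by (intro saw_interp d) auto
      obtain m where m: "l = Suc m" using l by (cases l) auto
      define N where "N = (\<lambda>y::real. saw d (n - s) + (y ^ l - n) * (c - 1 / d) - 1)"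
      define D where "D = (\<lambda>y::real. real l * y ^ m)"
      define D' where "D' = real l * (real m * y ^ (m - 1))"
      have pw: "((\<lambda>y::real. y ^ l) has_real_derivative real l * y ^ m) (at y)"
        using DERIV_pow[of l y] by (simp add: m)
      have N: "(N has_real_derivative real l * y ^ m * (c - 1 / d)) (at y)"
        using DERIV_diff[OF DERIV_add[OF DERIV_const[of "saw d (n - s)"]
          DERIV_cmult_right[OF DERIV_diff[OF pw DERIV_const[of "real_of_int n"]], of "c - 1 / d"]] DERIV_const[of 1]]
        by (simp add: N_def)
      have D: "(D has_real_derivative D') (at y)"
        unfolding D_def D'_def by (auto intro!: derivative_eq_intros)
      have D0: "D y \<noteq> 0" using y0 l by (auto simp: D_def)
      have Dy: "y * D' = m * D y"
        unfolding D_def D'_def by (cases m) auto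
      have "((\<lambda>y. y / d + N y / D y - c * y) has_real_derivative
          (1 / d + ((real l * y ^ m * (c - 1 / d)) * D y - N y * D') / (D y * D y) - c)) (at y)"
        using DERIV_diff[OF DERIV_add[OF DERIV_cdivide[OF DERIV_ident] DERIV_divide[OF N D D0]]
          DERIV_cmult_Id[of c]] by simp
      also have "(real l * y ^ m * (c - 1 / d)) = (c - 1 / d) * D y" by (simp add: D_def)
      also have "1 / d + ((c - 1 / d) * D y * D y - N y * D') / (D y * D y) - c = (- N y) * D' / (D y * D y)"
        using D0 by (simp add: diff_divide_distrib)
      also have "\<dots> = (1 - T) * (y * D') / (y * (D y * D y))"
        using y0 by (simp add: N_def T_def)
      also have "\<dots> = (1 - T) * m / (l * y ^ l)"
        using D0 y0 unfolding Dy by (simp add: D_def m)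
      also have "(\<lambda>y. y / d + N y / D y - c * y) = (\<lambda>y. cong_cmp l d s n y - c * y)"
        by (simp add: cong_cmp_def N_def D_def c_def m)
      finally have "((\<lambda>y. cong_cmp l d s n y - c * y) has_real_derivative ((1 - T) * m / (l * y ^ l))) (at y)" .
      moreover have "(1 - T) * m / (l * y ^ l) \<ge> 0" using T y0 by auto
      ultimately show "\<exists>z. ((\<lambda>y. cong_cmp l d s n y - c * y) has_real_derivative z) (at y) \<and> 0 \<le> z" by blast
    qed (use a in auto)
    then show ?thesis by (simp add: algebra_simps)
  qed
  finally show ?thesis .
qed

lemma measure_floor_cong_split:
  assumes "a \<le> c" "c \<le> b"
  shows "measure lborel (floor_cong_set l d s a b) \<le>
    measure lborel (floor_cong_set l d s a c) + measure lborel (floor_cong_set l d s c b)"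
proof -
  have "floor_cong_set l d s a b = floor_cong_set l d s a c \<union> floor_cong_set l d s c b"
    using assms by (auto simp: floor_cong_set_def)
  then show ?thesis
    using floor_cong_set_finite by (auto intro!: measure_Un_le)
qed

text \<open>Induction on the number of integers that \<open>y ^ l\<close> crosses, cutting at the
  root of the last one.\<close>

lemma measure_floor_cong_comp:
  assumes d: "d \<ge> 1" and l: "l \<ge> 1" and a: "0 < a" "a \<le> b"
    and n: "real_of_int n \<le> a ^ l" "a ^ l \<le> real_of_int n + 1"
    and m: "real_of_int n + int m \<le> b ^ l" "b ^ l \<le> real_of_int n + int m + 1"
  shows "measure lborel (floor_cong_set l d s a b) \<le> cong_cmp l d s (n + int m) b - cong_cmp l d s n a"
  using a m
proof (induction m arbitrary: b)
  case 0
  then show ?case using measure_floor_cong_piece[OF d l, of a b n s] n by auto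
next
  case (Suc m)
  define c where "c = root l (of_int (n + int m + 1))"
  have pos: "0 \<le> n + int m + 1"
  proof -
    have "0 < a ^ l" using a by simp
    then have "0 < real_of_int n + 1" using n by linarith
    then show ?thesis by linarith
  qed
  have cl: "c ^ l = of_int (n + int m + 1)" unfolding c_def using l pos by (intro real_root_pow_pos2) auto
  have c0: "c \<ge> 0" unfolding c_def using pos l by simp
  have "a ^ l \<le> c ^ l" using n cl by simp
  then have ac: "a \<le> c" using c0 l a(1) power_mono_iff[of a c l] by auto
  have "c ^ l \<le> b ^ l" using Suc.prems cl by simp
  then have cb: "c \<le> b" using c0 l Suc.prems power_mono_iff[of c b l] by auto
  have "measure lborel (floor_cong_set l d s a b) \<le>
    measure lborel (floor_cong_set l d s a c) + measure lborel (floor_cong_set l d s c b)"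
    by (rule measure_floor_cong_split) (use ac cb in auto)
  also have "measure lborel (floor_cong_set l d s a c) \<le> cong_cmp l d s (n + int m) c - cong_cmp l d s n a"
    using Suc.IH[of c] ac a cl by auto
  also have "measure lborel (floor_cong_set l d s c b) \<le> cong_cmp l d s (n + int m + 1) b - cong_cmp l d s (n + int m + 1) c"
    by (rule measure_floor_cong_piece[OF d l]) (use ac a cb cl Suc.prems in auto)
  also have "cong_cmp l d s (n + int m + 1) c = cong_cmp l d s (n + int m) c"
    by (rule cong_cmp_step[OF d]) (use cl in auto)
  finally show ?case by (simp add: algebra_simps)
qed

text \<open>After telescoping only the two end values of \<open>cong_cmp\<close> remain. As the
  interpolated \<open>saw\<close> lies between 0 and 1, the error is a single boundary term, however
  many pieces there are.\<close>

lemma measure_floor_cong_le: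
  assumes d: "d \<ge> 1" and l: "l \<ge> 1" and a: "0 < a" "a \<le> b"
  shows "measure lborel (floor_cong_set l d s a b) \<le> (b - a) / d + 1 / (l * a ^ (l - 1))"
proof -
  define n where "n = \<lfloor>a ^ l\<rfloor>"
  have mono: "a ^ l \<le> b ^ l" using a by (intro power_mono) auto
  define m where "m = nat (\<lfloor>b ^ l\<rfloor> - n)"
  have m: "int m = \<lfloor>b ^ l\<rfloor> - n" unfolding m_def n_def using mono by (simp add: floor_mono)
  have *: "cong_cmp l d s k y = y / d + (Sw - 1) / (l * y ^ (l - 1))" if "Sw = saw d (k - s) + (y ^ l - k) * (of_bool (d dvd k - s) - 1 / real_of_int d)" for k Sw and y :: real
    unfolding that cong_cmp_def by simp
  define Sx where "Sx y k = saw d (k - s) + (y ^ l - k) * (of_bool (d dvd k - s) - 1 / real_of_int d)" for y :: real and k :: int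
  have 1: "measure lborel (floor_cong_set l d s a b) \<le> cong_cmp l d s (n + int m) b - cong_cmp l d s n a"
    unfolding m by (rule measure_floor_cong_comp[OF d l a, where m = m, unfolded m])
      (auto simp: n_def m)
  have "cong_cmp l d s (n + int m) b \<le> b / d"
  proof -
    have "Sx b (n + int m) \<le> 1" unfolding Sx_def m by (intro saw_interp d) (auto)
    then have "(Sx b (n + int m) - 1) / (l * b ^ (l - 1)) \<le> 0" using a by (intro divide_nonpos_nonneg) auto
    then show ?thesis using *[OF Sx_def, where y = b and k = "n + int m"] by simp
  qed
  moreover have "cong_cmp l d s n a \<ge> a / d - 1 / (l * a ^ (l - 1))"
  proof -
    have "Sx a n \<ge> 0" unfolding Sx_def n_def by (intro saw_interp d) (auto)
    then have "(Sx a n - 1) / (l * a ^ (l - 1)) \<ge> (-1) / (l * a ^ (l - 1))" using a by (intro divide_right_mono) auto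
    then show ?thesis using *[OF Sx_def, where y = a and k = n] by simp
  qed
  ultimately show ?thesis using 1 by (simp add: diff_divide_distrib)
qed

section \<open>Congruences between two powers\<close>

definition floor_pair_set :: "nat \<Rightarrow> nat \<Rightarrow> int \<Rightarrow> real \<Rightarrow> real \<Rightarrow> real set" where
  "floor_pair_set k l d a b = {y \<in> {a..<b}. d dvd \<lfloor>y ^ l\<rfloor> - \<lfloor>y ^ k\<rfloor>}"

lemma floor_pair_set_measurable [measurable]: "floor_pair_set k l d a b \<in> sets borel"
  unfolding floor_pair_set_def by measurable

lemma floor_pair_set_finite: "emeasure lborel (floor_pair_set k l d a b) < \<infinity>"
proof -
  have "emeasure lborel (floor_pair_set k l d a b) \<le> emeasure lborel {a..b}"
    by (intro emeasure_mono) (auto simp: floor_pair_set_def)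
  also have "\<dots> < \<infinity>" by (cases "a \<le> b") auto
  finally show ?thesis .
qed

text \<open>While the integer part of \<open>y ^ k\<close> is frozen at \<open>n\<close>, the
  condition is a congruence for the single power \<open>y ^ l\<close> with shift
  \<open>n\<close>.\<close>

lemma measure_floor_pair_piece:
  assumes d: "d \<ge> 1" and k: "k \<ge> 1" "l \<ge> 1" and a: "0 < a" "a \<le> b"
    and n: "real_of_int n \<le> a ^ k" "b ^ k \<le> real_of_int n + 1"
  shows "measure lborel (floor_pair_set k l d a b) \<le> (b - a) / d + 1 / (l * a ^ (l - 1))"
proof -
  have fl: "\<lfloor>y ^ k\<rfloor> = n" if "a \<le> y" "y < b" for y
  proof -
    have "a ^ k \<le> y ^ k" using that a by (intro power_mono) auto
    moreover have "y ^ k < b ^ k" using that a k by (intro power_strict_mono) auto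
    ultimately show ?thesis using n by (intro floor_unique) auto
  qed
  have "floor_pair_set k l d a b = floor_cong_set l d n a b"
    using fl by (auto simp: floor_cong_set_def floor_pair_set_def)
  then show ?thesis using measure_floor_cong_le[OF d k(2) a] by simp
qed

text \<open>Each piece costs one boundary term. A piece starting at \<open>c\<close> with
  \<open>c ^ k = N + 1\<close> costs at most \<open>1 / (N + 1)\<close> divided by
  \<open>l * a ^ (l - 1 - k)\<close>; these harmonic terms add up to the logarithm, and the 1 pays
  for the first piece.\<close>

lemma measure_floor_pair_aux:
  fixes n0 m :: nat
  assumes d: "d \<ge> 1" and k: "k \<ge> 1" "k < l" and a: "1 < a" "a \<le> b"
    and n: "n0 \<ge> 1" "real n0 \<le> a ^ k" "a ^ k \<le> real n0 + 1" and m: "b ^ k \<le> real n0 + real m + 1"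
  shows "measure lborel (floor_pair_set k l d a b) \<le> (b - a) / d +
     (1 + ln ((n0 + m) / n0) / l) / a ^ (l - 1 - k)"
  using a m
proof (induction m arbitrary: b)
  case 0
  then have "measure lborel (floor_pair_set k l d a b) \<le> (b - a) / d + 1 / (l * a ^ (l - 1))"
    using k n by (intro measure_floor_pair_piece[where n = "int n0"] d) auto
  moreover have "a ^ (l - 1 - k) \<le> a ^ (l - 1)" using a by (intro power_increasing) auto
  moreover have "1 * a ^ (l - 1) \<le> l * a ^ (l - 1)" using k a by (intro mult_right_mono) auto
  ultimately have "a ^ (l - 1 - k) \<le> l * a ^ (l - 1)" by linarith
  then have "1 / (l * a ^ (l - 1)) \<le> 1 / a ^ (l - 1 - k)"
    using a k by (intro divide_left_mono) (auto)
  then show ?case using \<open>_ \<le> (b - a) / d + 1 / (l * a ^ (l - 1))\<close> n by simp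
next
  case (Suc m)
  define N where "N = n0 + m"
  define c where "c = root k (real (N + 1))"
  have cl: "c ^ k = real (N + 1)" unfolding c_def using k by (intro real_root_pow_pos2) auto
  have c0: "c \<ge> 0" unfolding c_def using k by simp
  have N: "N \<ge> 1" using n by (simp add: N_def)
  have "a ^ k \<le> c ^ k" using n cl by (simp add: N_def)
  then have ac: "a \<le> c" using c0 k a(1) power_mono_iff[of a c k] by auto
  have mono: "ln (N / n0) \<le> ln ((N + 1) / n0)" using n N by (simp add: divide_right_mono)
  show ?case
  proof (cases "b \<le> c")
    case True
    then have "b ^ k \<le> c ^ k" using Suc.prems by (intro power_mono) auto
    then have "b ^ k \<le> real n0 + real m + 1" using cl by (simp add: N_def)
    from Suc.IH[OF Suc.prems(1,2) this]
    have "measure lborel (floor_pair_set k l d a b) \<le> (b - a) / d + (1 + ln (N / n0) / l) / a ^ (l - 1 - k)"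
      by (simp add: N_def)
    also have "\<dots> \<le> (b - a) / d + (1 + ln ((N + 1) / n0) / l) / a ^ (l - 1 - k)"
      using a d mono by (intro add_mono divide_right_mono) auto
    finally show ?thesis by (simp add: N_def)
  next
    case False
    have "floor_pair_set k l d a b = floor_pair_set k l d a c \<union> floor_pair_set k l d c b"
      using ac False by (auto simp: floor_pair_set_def)
    then have "measure lborel (floor_pair_set k l d a b) \<le>
        measure lborel (floor_pair_set k l d a c) + measure lborel (floor_pair_set k l d c b)"
      using floor_pair_set_finite by (auto intro!: measure_Un_le)
    also have "measure lborel (floor_pair_set k l d a c) \<le> (c - a) / d + (1 + ln (N / n0) / l) / a ^ (l - 1 - k)"
      using Suc.IH[of c] ac a cl unfolding N_def by auto
    also have "measure lborel (floor_pair_set k l d c b) \<le> (b - c) / d + 1 / (l * c ^ (l - 1))"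
      by (rule measure_floor_pair_piece[where n = "int (N + 1)"]) (use d k ac a False cl Suc.prems in \<open>auto simp: N_def\<close>)
    also have "1 / (l * c ^ (l - 1)) \<le> (1 / (N + 1)) / l / a ^ (l - 1 - k)"
    proof -
      have "c ^ (l - 1) = c ^ k * c ^ (l - 1 - k)" using k by (simp flip: power_add)
      also have "\<dots> \<ge> (N + 1) * a ^ (l - 1 - k)"
        unfolding cl using ac a by (intro mult_left_mono power_mono) auto
      finally have "l * c ^ (l - 1) \<ge> l * ((N + 1) * a ^ (l - 1 - k))" using k by (intro mult_left_mono) auto
      then have "1 / (l * c ^ (l - 1)) \<le> 1 / (l * ((N + 1) * a ^ (l - 1 - k)))"
        using a k ac by (intro divide_left_mono) auto
      then show ?thesis by (simp add: mult_ac)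
    qed
    \<comment> \<open>This is \<open>ln x \<le> x - 1\<close> at
      \<open>x = N / (N + 1)\<close>.\<close>
    also have "1 / (N + 1) \<le> ln ((N + 1) / n0) - ln (N / n0)"
    proof -
      have "ln (N / (N + 1)) \<le> N / (N + 1) - 1" using N by (intro ln_le_minus_one) auto
      also have "\<dots> = - (1 / (N + 1))" by (simp add: field_simps)
      finally show ?thesis using N n by (simp add: ln_div)
    qed
    finally have "measure lborel (floor_pair_set k l d a b)
      \<le> (c - a) / d + (1 + ln (N / n0) / l) / a ^ (l - 1 - k)
       + ((b - c) / d + (ln ((N + 1) / n0) - ln (N / n0)) / l / a ^ (l - 1 - k))"
      using a k by (simp add: divide_right_mono)
    also have "\<dots> = (b - a) / d + (1 + ln ((N + 1) / n0) / l) / a ^ (l - 1 - k)"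
      by (simp add: add_divide_distrib diff_divide_distrib)
    finally show ?thesis by (simp add: N_def)
  qed
qed

text \<open>The logarithm is at most \<open>k * ln b\<close>, which the factor \<open>1 / l\<close>
  absorbs. The remaining error is geometric in \<open>l - k\<close> and independent of
  \<open>d\<close>.\<close>

lemma measure_floor_pair_le:
  assumes d: "d \<ge> 1" and k: "k \<ge> 1" "k < l" and a: "1 < a" "a \<le> b"
  shows "measure lborel (floor_pair_set k l d a b) \<le> (b - a) / d + (1 + ln b) / a ^ (l - 1 - k)"
proof -
  define n0 where "n0 = nat \<lfloor>a ^ k\<rfloor>"
  define m where "m = nat \<lfloor>b ^ k\<rfloor> - n0"
  have ak: "a ^ k \<ge> 1" "a ^ k \<le> b ^ k" using a by (auto intro!: power_mono)
  have n0: "n0 \<ge> 1" "real n0 \<le> a ^ k" "a ^ k \<le> real n0 + 1"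
    using ak unfolding n0_def by linarith+
  have nm: "n0 + m = nat \<lfloor>b ^ k\<rfloor>" unfolding m_def n0_def using ak
    by (simp add: floor_mono nat_mono)
  have nm': "real (n0 + m) \<le> b ^ k" "b ^ k \<le> real (n0 + m) + 1"
    unfolding nm using ak by linarith+
  have *: "measure lborel (floor_pair_set k l d a b) \<le> (b - a) / d +
     (1 + ln ((n0 + m) / n0) / l) / a ^ (l - 1 - k)"
    by (rule measure_floor_pair_aux) (use assms n0 nm' in auto)
  have "ln ((n0 + m) / n0) \<le> ln (b ^ k)"
  proof (subst ln_le_cancel_iff)
    have "real (n0 + m) / n0 \<le> real (n0 + m)" using n0 by (simp add: divide_le_eq)
    then show "real (n0 + m) / n0 \<le> b ^ k" using nm' by linarith
  qed (use n0 a in auto)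
  also have "\<dots> = k * ln b" using a by (simp add: ln_realpow)
  also have "\<dots> \<le> l * ln b" using a k by (intro mult_right_mono) auto
  finally have "ln ((n0 + m) / n0) / l \<le> ln b" using k by (simp add: field_simps)
  then have "(1 + ln ((n0 + m) / n0) / l) / a ^ (l - 1 - k) \<le> (1 + ln b) / a ^ (l - 1 - k)"
    using a by (intro divide_right_mono) auto
  then show ?thesis using * by linarith
qed

section \<open>Products over odd primes\<close>

text \<open>Expansion of the product to second order in \<open>u\<close>, with the second elementary
  symmetric polynomial written as \<open>(s1^2 - s2) / 2\<close>. The slack
  \<open>s1 ^ 3 * u ^ 3\<close> is large enough that the defect in the induction step has only
  nonnegative coefficients.\<close>

lemma prod_one_minus_lower_bound:
  fixes t :: "nat \<Rightarrow> real" and u :: real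
  assumes t: "\<And>i. i < n \<Longrightarrow> 0 \<le> t i \<and> t i \<le> 1" and u: "0 \<le> u" "u \<le> 1"
  defines "s1 \<equiv> (\<Sum>i<n. t i)" and "s2 \<equiv> (\<Sum>i<n. (t i)\<^sup>2)"
  shows "(\<Prod>i<n. 1 - u * t i) \<ge> 1 - s1 * u + (s1\<^sup>2 - s2) / 2 * u\<^sup>2 - s1 ^ 3 * u ^ 3"
  using t unfolding s1_def s2_def
proof (induction n)
  case (Suc n)
  define a where "a = (\<Sum>i<n. t i)"
  define b where "b = (\<Sum>i<n. (t i)\<^sup>2)"
  define L where "L = 1 - a * u + (a\<^sup>2 - b) / 2 * u\<^sup>2 - a ^ 3 * u ^ 3"
  have tn: "0 \<le> t n" "t n \<le> 1" using Suc.prems[of n] by auto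
  have a: "a \<ge> 0" unfolding a_def using Suc.prems by (intro sum_nonneg) auto
  have b: "b \<ge> 0" unfolding b_def by (intro sum_nonneg) auto
  have "u * t n \<le> 1" using tn u by (simp add: mult_le_one)
  have IH: "(\<Prod>i<n. 1 - u * t i) \<ge> L" using Suc by (simp add: L_def a_def b_def)
  have "(\<Prod>i<Suc n. 1 - u * t i) = (\<Prod>i<n. 1 - u * t i) * (1 - u * t n)" by simp
  also have "\<dots> \<ge> L * (1 - u * t n)"
    using IH \<open>u * t n \<le> 1\<close> by (intro mult_right_mono) auto
  also have "L * (1 - u * t n) = 1 - (a + t n) * u + ((a + t n)\<^sup>2 - (b + (t n)\<^sup>2)) / 2 * u\<^sup>2 - (a + t n) ^ 3 * u ^ 3
      + ((5/2 * a\<^sup>2 * t n + 3 * a * (t n)\<^sup>2 + (t n) ^ 3 + b * t n / 2) * u ^ 3 + a ^ 3 * t n * u ^ 4)"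
    unfolding L_def by (simp add: field_simps power2_eq_square power3_eq_cube eval_nat_numeral)
  finally have "(\<Prod>i<Suc n. 1 - u * t i) \<ge> 1 - (a + t n) * u + ((a + t n)\<^sup>2 - (b + (t n)\<^sup>2)) / 2 * u\<^sup>2 - (a + t n) ^ 3 * u ^ 3
      + ((5/2 * a\<^sup>2 * t n + 3 * a * (t n)\<^sup>2 + (t n) ^ 3 + b * t n / 2) * u ^ 3 + a ^ 3 * t n * u ^ 4)" .
  moreover have "(5/2 * a\<^sup>2 * t n + 3 * a * (t n)\<^sup>2 + (t n) ^ 3 + b * t n / 2) * u ^ 3 + a ^ 3 * t n * u ^ 4 \<ge> 0"
    using a b tn u by (intro add_nonneg_nonneg mult_nonneg_nonneg divide_nonneg_nonneg zero_le_power) auto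
  ultimately show ?case by (simp add: a_def b_def)
qed auto

lemma summable_inverse_fourth: "summable (\<lambda>n. 1 / (real n + 1) ^ 4)"
proof -
  have "summable (\<lambda>n. inverse (real n ^ 4))" by (rule inverse_power_summable) simp
  then have "summable (\<lambda>n. inverse (real (Suc n) ^ 4))" by (subst summable_Suc_iff)
  then show ?thesis by (simp add: inverse_eq_divide add.commute)
qed

text \<open>The coefficient of \<open>x\<^sup>4\<close> in the product formula for \<open>sin (pi x) / (pi x)\<close>.\<close>

lemma inverse_fourth_powers_ge: "pi ^ 4 / 90 \<le> (\<Sum>n. 1 / (real n + 1) ^ 4)"
proof -
  define z where "z = (\<Sum>n. 1 / (real n + 1) ^ 4)"
  define s where "s = pi\<^sup>2 / 6"
  \<comment> \<open>With \<open>u = x^2\<close>, the product for the sine is bounded below to second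
    order in \<open>u\<close>, and the sine above by its Taylor polynomial. The terms of order 0 and
    1 cancel because \<open>s = pi^2 / 6\<close>, and dividing by \<open>u^2\<close> leaves an error
    of order \<open>u\<close>.\<close>
  have ineq: "(s\<^sup>2 - z) / 2 - pi ^ 4 / 120 \<le> (s ^ 3 + pi ^ 6 / 5040) * u" if u: "0 < u" "u \<le> 1" for u
  proof -
    define x where "x = sqrt u"
    have x: "x > 0" "x \<le> 1" "x\<^sup>2 = u" using u by (auto simp: x_def)
    have x4: "x ^ 4 = u\<^sup>2" "x ^ 6 = u ^ 3" using x(3) by (auto simp flip: power_mult)
    define t where "t = (\<lambda>i::nat. 1 / (real i + 1)\<^sup>2)"
    have t: "0 \<le> t i \<and> t i \<le> 1" for i by (auto simp: t_def divide_simps)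
    have ts: "(\<lambda>n. \<Sum>i<n. t i) \<longlonglongrightarrow> s"
      using inverse_squares_sums by (simp add: sums_def t_def s_def add.commute)
    have "(t i)\<^sup>2 = 1 / (real i + 1) ^ 4" for i
      by (simp add: t_def power_divide power_even_eq[of _ 2, simplified])
    then have ts2: "(\<lambda>n. \<Sum>i<n. (t i)\<^sup>2) \<longlonglongrightarrow> z"
      using summable_sums[OF summable_inverse_fourth]
      by (simp add: sums_def z_def)
    have "(\<lambda>n. \<Prod>k=1..n. 1 - x\<^sup>2 / (real k)\<^sup>2) \<longlonglongrightarrow> sin (pi * x) / (pi * x)"
      using sin_product_formula_real'[of x] x by simp
    moreover have "(\<Prod>k=1..n. 1 - x\<^sup>2 / (real k)\<^sup>2) = (\<Prod>i<n. 1 - u * t i)" for n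
      by (rule prod.reindex_bij_witness[of _ Suc "\<lambda>k. k - 1"]) (auto simp: t_def x)
    ultimately have lim: "(\<lambda>n. \<Prod>i<n. 1 - u * t i) \<longlonglongrightarrow> sin (pi * x) / (pi * x)" by simp
    have lim2: "(\<lambda>n. 1 - (\<Sum>i<n. t i) * u + ((\<Sum>i<n. t i)\<^sup>2 - (\<Sum>i<n. (t i)\<^sup>2)) / 2 * u\<^sup>2 - (\<Sum>i<n. t i) ^ 3 * u ^ 3)
       \<longlonglongrightarrow> 1 - s * u + (s\<^sup>2 - z) / 2 * u\<^sup>2 - s ^ 3 * u ^ 3"
      by (intro tendsto_intros ts ts2) simp_all
    have "1 - s * u + (s\<^sup>2 - z) / 2 * u\<^sup>2 - s ^ 3 * u ^ 3 \<le> sin (pi * x) / (pi * x)"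
      by (rule LIMSEQ_le[OF lim2 lim]) (intro exI allI impI prod_one_minus_lower_bound, use t u in auto)
    also have "\<dots> \<le> 1 - s * u + pi ^ 4 / 120 * u\<^sup>2 + pi ^ 6 / 5040 * u ^ 3"
    proof -
      define w where "w = pi * x"
      have w: "w > 0" using x by (simp add: w_def)
      have c: "(\<Sum>m<7. sin_coeff m * w ^ m) = w - w ^ 3 / 6 + w ^ 5 / 120"
      proof -
        have e: "{..<7::nat} = {0, 1, 2, 3, 4, 5, 6}" by auto
        show ?thesis unfolding e by (simp add: sin_coeff_def fact_numeral)
      qed
      have "sin w \<le> w - w ^ 3 / 6 + w ^ 5 / 120 + w ^ 7 / 5040"
      proof -
        have "inverse (fact 7) * \<bar>w\<bar> ^ 7 = w ^ 7 / 5040" using w by (simp add: fact_numeral)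
        then show ?thesis using Maclaurin_sin_bound[of w 7] unfolding c by linarith
      qed
      then have "sin w / w \<le> (w - w ^ 3 / 6 + w ^ 5 / 120 + w ^ 7 / 5040) / w"
        using w by (intro divide_right_mono) auto
      also have "\<dots> = 1 - w\<^sup>2 / 6 + w ^ 4 / 120 + w ^ 6 / 5040"
        using w by (simp add: field_simps eval_nat_numeral)
      also have "w\<^sup>2 = pi\<^sup>2 * u" by (simp add: w_def power_mult_distrib x)
      also have "w ^ 4 = pi ^ 4 * u\<^sup>2" by (simp add: w_def power_mult_distrib x4)
      also have "w ^ 6 = pi ^ 6 * u ^ 3" by (simp add: w_def power_mult_distrib x4)
      finally show ?thesis by (simp add: w_def s_def)
    qed
    finally have "((s\<^sup>2 - z) / 2 - pi ^ 4 / 120) * u\<^sup>2 \<le> (s ^ 3 + pi ^ 6 / 5040) * u * u\<^sup>2"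
      by (simp add: algebra_simps power2_eq_square power3_eq_cube)
    then show ?thesis using u by (simp add: mult_le_cancel_right)
  qed
  have "(s\<^sup>2 - z) / 2 - pi ^ 4 / 120 \<le> 0"
  proof (rule tendsto_lowerbound)
    show "((\<lambda>u. (s ^ 3 + pi ^ 6 / 5040) * u) \<longlongrightarrow> 0) (at_right 0)"
      by (auto intro!: tendsto_eq_intros)
    show "\<forall>\<^sub>F u in at_right 0. (s\<^sup>2 - z) / 2 - pi ^ 4 / 120 \<le> (s ^ 3 + pi ^ 6 / 5040) * u"
      using eventually_at_right_less[of 0] eventually_at_right_real[of 0 1]
      by (rule eventually_elim2) (use ineq in auto)
  qed auto
  then have "z \<ge> s\<^sup>2 - pi ^ 4 / 60" by simp
  also have "s\<^sup>2 - pi ^ 4 / 60 = pi ^ 4 / 90" by (simp add: s_def power_divide flip: power_mult)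
  finally show ?thesis by (simp add: z_def)
qed

text \<open>The terms with even denominators are \<open>1 / 2 ^ k\<close> of the whole series;
  grouping the series in consecutive pairs separates them.\<close>

lemma odd_part_sums:
  assumes "(\<lambda>n. 1 / (real n + 1) ^ k) sums s"
  shows "(\<lambda>n. 1 / (2 * real n + 1) ^ k) sums ((1 - 1 / 2 ^ k) * s)"
proof -
  have 1: "(\<lambda>n. \<Sum>i\<in>{n * 2..<n * 2 + 2}. 1 / (real i + 1) ^ k) sums s"
    using sums_group[OF assms, of 2] by simp
  have 2: "(\<lambda>n. 1 / 2 ^ k * (1 / (real n + 1) ^ k)) sums (1 / 2 ^ k * s)"
    by (intro sums_mult assms)
  have "(\<Sum>i\<in>{n * 2..<n * 2 + 2}. 1 / (real i + 1) ^ k) = 1 / (2 * real n + 1) ^ k + 1 / 2 ^ k * (1 / (real n + 1) ^ k)" for n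
  proof -
    have "{n * 2..<n * 2 + 2} = {2 * n, 2 * n + 1}" by auto
    then have "(\<Sum>i\<in>{n * 2..<n * 2 + 2}. 1 / (real i + 1) ^ k) = 1 / (2 * real n + 1) ^ k + 1 / (2 * (real n + 1)) ^ k"
      by (simp add: algebra_simps)
    then show ?thesis by (simp only: power_mult_distrib) simp
  qed
  with sums_diff[OF 1 2] show ?thesis by (simp add: algebra_simps)
qed

text \<open>A product of distinct odd primes times an odd square determines both factors, so the product over primes
  times the sum of \<open>1 / m ^ 4\<close> over odd \<open>m\<close> is at most the sum of \<open>1 / n\<^sup>2\<close> over odd \<open>n\<close>.\<close>

lemma odd_prime_prod_le:
  fixes P :: "int set"
  assumes P: "finite P" "\<And>p. p \<in> P \<Longrightarrow> prime p \<and> odd p"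
  shows "(\<Prod>p\<in>P. 1 + 1 / (real_of_int p)\<^sup>2) \<le> 12 / pi\<^sup>2"
proof -
  define X where "X = (\<Prod>p\<in>P. 1 + 1 / (real_of_int p)\<^sup>2)"
  define z where "z = (\<Sum>n. 1 / (real n + 1) ^ 4)"
  have s2: "(\<lambda>n. 1 / (2 * real n + 1) ^ 2) sums (pi\<^sup>2 / 8)"
    using odd_part_sums[of 2 "pi\<^sup>2 / 6"] inverse_squares_sums by (simp add: add.commute)
  have s4: "(\<lambda>n. 1 / (2 * real n + 1) ^ 4) sums (15 / 16 * z)"
    using odd_part_sums[of 4 z] summable_sums[OF summable_inverse_fourth] by (simp add: z_def)
  have X: "X = (\<Sum>A\<in>Pow P. 1 / (real_of_int (\<Prod>A))\<^sup>2)"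
  proof -
    have "X = (\<Prod>p\<in>P. 1 / (real_of_int p)\<^sup>2 + 1)" by (simp add: X_def add.commute)
    also have "\<dots> = (\<Sum>A\<in>Pow P. (\<Prod>p\<in>A. 1 / (real_of_int p)\<^sup>2))"
      by (subst prod_add) (use P in auto)
    finally show ?thesis by (simp add: prod_dividef prod_power_distrib)
  qed
  have X0: "X \<ge> 0" unfolding X_def by (intro prod_nonneg) auto
  have main: "X * (\<Sum>m<M. 1 / (2 * real m + 1) ^ 4) \<le> pi\<^sup>2 / 8" for M
  proof -
    define g where "g = (\<lambda>(A, m::nat). \<Prod>A * (2 * int m + 1)\<^sup>2)"
    have oddA: "odd (\<Prod>A) \<and> \<Prod>A > 0" if "A \<in> Pow P" for A
    proof -
      have "finite A" using that P finite_subset by auto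
      then show ?thesis using that
      proof (induction A)
        case (insert p A)
        then show ?case using P(2)[of p] prime_gt_0_int[of p] by auto
      qed auto
    qed
    have inj: "inj_on g (Pow P \<times> {..<M})"
    proof (rule inj_onI, clarify)
      fix A m B n
      assume AB: "A \<subseteq> P" "B \<subseteq> P" and eq: "g (A, m) = g (B, n)"
      have mult: "multiplicity p (g (C, k)) = of_bool (p \<in> C) + 2 * multiplicity p (2 * int k + 1)"
        if "C \<subseteq> P" "prime p" for C k p
      proof -
        have fin: "finite C" using that P finite_subset by auto
        have "multiplicity p (\<Prod>C) = multiplicity p (\<Prod>q\<in>C. q ^ 1)" by simp
        also have "\<dots> = of_bool (p \<in> C)"
          by (subst multiplicity_prod_prime_powers) (use that P fin in auto)
        finally have 1: "multiplicity p (\<Prod>C) = of_bool (p \<in> C)" .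
        have nz: "\<Prod>C \<noteq> 0" using oddA[of C] that by auto
        have nz2: "2 * int k + 1 \<noteq> 0" by presburger
        have "multiplicity p (g (C, k)) = multiplicity p (\<Prod>C) + multiplicity p ((2 * int k + 1)\<^sup>2)"
          unfolding g_def prod.case
          by (rule prime_elem_multiplicity_mult_distrib) (use that nz nz2 in auto)
        also have "multiplicity p ((2 * int k + 1)\<^sup>2) = 2 * multiplicity p (2 * int k + 1)"
          using that nz2 by (subst prime_elem_multiplicity_power_distrib) auto
        finally show ?thesis using 1 by simp
      qed
      \<comment> \<open>\<open>p\<close> belongs to the set exactly when its multiplicity in the
        value of \<open>g\<close> is odd.\<close>
      have "p \<in> A \<longleftrightarrow> p \<in> B" if "prime p" for p
      proof -
        have e: "of_bool (p \<in> A) + 2 * multiplicity p (2 * int m + 1) = of_bool (p \<in> B) + 2 * multiplicity p (2 * int n + 1)"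
          using mult[OF AB(1) that, of m] mult[OF AB(2) that, of n] eq by simp
        show ?thesis using arg_cong[OF e, of odd] by simp
      qed
      then have "A = B" using AB P(2) by blast
      moreover have "\<Prod>B \<noteq> 0" using oddA[of B] AB by auto
      ultimately have "(2 * int m + 1)\<^sup>2 = (2 * int n + 1)\<^sup>2" using eq by (simp add: g_def)
      then have "2 * int m + 1 = 2 * int n + 1" by (rule power2_eq_imp_eq) simp_all
      with \<open>A = B\<close> show "A = B \<and> m = n" by simp
    qed
    \<comment> \<open>The index of an odd number in the series over
      \<open>2 * n + 1\<close>.\<close>
    define h where "h = (\<lambda>x::int. nat ((x - 1) div 2))"
    have hg: "2 * real (h (g x)) + 1 = real_of_int (g x)" if x: "x \<in> Pow P \<times> {..<M}" for x
    proof -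
      obtain A m where x': "x = (A, m)" by (cases x)
      then have A: "odd (\<Prod>A)" "\<Prod>A > 0" using oddA[of A] x by auto
      have "odd (g x)" using A x' by (simp add: g_def)
      moreover have "g x > 0" unfolding x' g_def using A by (auto intro!: mult_pos_pos)
      ultimately have "2 * int (h (g x)) + 1 = g x" by (auto simp: h_def elim!: oddE)
      then show ?thesis by linarith
    qed
    have inj2: "inj_on (h \<circ> g) (Pow P \<times> {..<M})"
    proof (rule inj_onI)
      fix x y assume xy: "x \<in> Pow P \<times> {..<M}" "y \<in> Pow P \<times> {..<M}" "(h \<circ> g) x = (h \<circ> g) y"
      then have "real_of_int (g x) = real_of_int (g y)" by (simp flip: hg[OF xy(1)] hg[OF xy(2)])
      then show "x = y" using inj xy by (auto dest: inj_onD)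
    qed
    have fin: "finite (Pow P \<times> {..<M})" using P by auto
    have "X * (\<Sum>m<M. 1 / (2 * real m + 1) ^ 4) = (\<Sum>(A,m)\<in>Pow P \<times> {..<M}. 1 / (real_of_int (g (A, m)))\<^sup>2)"
    proof -
      have "1 / (real_of_int (\<Prod>A))\<^sup>2 * (1 / (2 * real m + 1) ^ 4) = 1 / (real_of_int (g (A, m)))\<^sup>2" for A and m :: nat
        by (simp add: g_def power_mult_distrib power_even_eq[of _ 2, simplified])
      then show ?thesis unfolding X sum_product sum.cartesian_product by simp
    qed
    also have "\<dots> = (\<Sum>x\<in>Pow P \<times> {..<M}. 1 / (2 * real ((h \<circ> g) x) + 1)\<^sup>2)"
      by (intro sum.cong refl) (use hg in \<open>auto simp: split_beta\<close>)
    also have "\<dots> = (\<Sum>n\<in>(h \<circ> g) ` (Pow P \<times> {..<M}). 1 / (2 * real n + 1)\<^sup>2)"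
      by (subst sum.reindex[OF inj2]) simp
    also have "\<dots> \<le> (\<Sum>n. 1 / (2 * real n + 1)\<^sup>2)"
      using s2 fin by (intro sum_le_suminf) (auto simp: sums_iff)
    also have "\<dots> = pi\<^sup>2 / 8" using s2 by (simp add: sums_iff)
    finally show ?thesis .
  qed
  have "(\<lambda>M. X * (\<Sum>m<M. 1 / (2 * real m + 1) ^ 4)) \<longlonglongrightarrow> X * (15 / 16 * z)"
    using s4 by (intro tendsto_mult tendsto_const) (simp add: sums_def)
  then have "X * (15 / 16 * z) \<le> pi\<^sup>2 / 8"
    by (rule LIMSEQ_le_const2) (use main in auto)
  moreover have "X * (15 / 16 * (pi ^ 4 / 90)) \<le> X * (15 / 16 * z)"
    using X0 inverse_fourth_powers_ge by (intro mult_left_mono) (auto simp: z_def)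
  \<comment> \<open>The constant is the quotient of \<open>pi^2 / 8\<close> and
    \<open>15 / 16 * pi^4 / 90 = pi^4 / 96\<close>, that is \<open>12 / pi^2\<close>.\<close>
  ultimately have "X * (15 / 16 * (pi ^ 4 / 90)) \<le> pi\<^sup>2 / 8" by linarith
  then have "X * pi\<^sup>2 * pi\<^sup>2 \<le> 12 * pi\<^sup>2" by (simp add: eval_nat_numeral mult_ac)
  then have "X * pi\<^sup>2 \<le> 12" by (rule mult_right_le_imp_le) simp
  then show ?thesis unfolding X_def[symmetric] by (subst pos_le_divide_eq) auto
qed

text \<open>The primes are replaced by all odd numbers from 3 to \<open>2 * K + 1\<close>, for which
  the square of the product is at most \<open>K + 1\<close> by induction. Any power saving over
  \<open>K\<close> is enough for the averaging, so this can stand in for a bound of Mertens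
  type.\<close>

lemma odd_prime_prod_le_sqrt:
  fixes P :: "int set"
  assumes P: "\<And>p. p \<in> P \<Longrightarrow> prime p \<and> odd p \<and> p \<le> int K"
  shows "(\<Prod>p\<in>P. 1 + 1 / real_of_int p) \<le> sqrt (real K + 1)"
proof -
  have sq: "(\<Prod>i=1..K. 1 + 1 / (2 * real i + 1))\<^sup>2 \<le> real K + 1"
  proof (induction K)
    case (Suc K)
    have "(\<Prod>i=1..Suc K. 1 + 1 / (2 * real i + 1))\<^sup>2 = (\<Prod>i=1..K. 1 + 1 / (2 * real i + 1))\<^sup>2 * (1 + 1 / (2 * real K + 3))\<^sup>2"
      by (simp add: power_mult_distrib)
    also have "\<dots> \<le> (real K + 1) * (1 + 1 / (2 * real K + 3))\<^sup>2"
      using Suc by (intro mult_right_mono) auto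
    also have "\<dots> \<le> real (Suc K) + 1"
    proof -
      have "(1 + 1 / (2 * real K + 3))\<^sup>2 = (2 * real K + 4)\<^sup>2 / (2 * real K + 3)\<^sup>2"
        by (simp add: field_simps flip: power_divide)
      moreover have "(real K + 1) * (2 * real K + 4)\<^sup>2 \<le> (real K + 2) * (2 * real K + 3)\<^sup>2"
        by (simp add: power2_eq_square algebra_simps)
      ultimately show ?thesis by (simp add: pos_divide_le_eq add.commute)
    qed
    finally show ?case .
  qed auto
  define f where "f = (\<lambda>p::int. nat ((p - 1) div 2))"
  have f: "p = 2 * int (f p) + 1 \<and> f p \<in> {1..K}" if "p \<in> P" for p
  proof -
    have "prime p" "odd p" "p \<le> int K" using P that by auto
    moreover from this have "p \<ge> 3" using prime_ge_2_int[of p] by (cases "p = 2") auto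
    ultimately show ?thesis by (auto simp: f_def elim!: oddE)
  qed
  then have inj: "inj_on f P" by (metis inj_onI)
  have fr: "2 * real (f p) + 1 = real_of_int p" if "p \<in> P" for p
    using arg_cong[OF conjunct1[OF f[OF that]], of real_of_int] by simp
  have "(\<Prod>p\<in>P. 1 + 1 / real_of_int p) = (\<Prod>i\<in>f ` P. 1 + 1 / (2 * real i + 1))"
    unfolding prod.reindex[OF inj] by (rule prod.cong) (simp_all add: fr)
  also have "\<dots> \<le> (\<Prod>i=1..K. 1 + 1 / (2 * real i + 1))"
    by (rule prod_mono2) (use f in auto)
  also have "\<dots> \<le> sqrt (real K + 1)"
    by (rule real_le_rsqrt[OF sq])
  finally show ?thesis .
qed

section \<open>Average size of \<open>W\<close> for almost every base\<close>

text \<open>The pairs are counted by the sum of the squared sizes of the residue classes, and the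
  sum of squared deviations from the mean \<open>card A / d\<close> is nonnegative.\<close>

lemma pair_congruence_count_ge:
  fixes f :: "'a \<Rightarrow> int"
  assumes d: "d \<ge> 1"
  shows "(real (card A))\<^sup>2 / real_of_int d \<le> (\<Sum>a\<in>A. \<Sum>b\<in>A. of_bool (d dvd f b - f a))"
proof -
  define R where "R = {0..<d}"
  define c where "c = (\<lambda>r. \<Sum>a\<in>A. of_bool (f a mod d = r) :: real)"
  have R: "finite R" "card R = nat d" by (auto simp: R_def)
  have "f a mod d \<in> R" for a using d by (auto simp: R_def)
  then have 1: "(\<Sum>r\<in>R. of_bool (f a mod d = r)) = (1::real)" for a
    using R by (simp add: of_bool_def sum.delta')
  have 2: "(\<Sum>r\<in>R. of_bool (f a mod d = r) * of_bool (f b mod d = r)) = (of_bool (d dvd f b - f a) :: real)" for a b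
  proof (cases "f a mod d = f b mod d")
    case True
    have "(\<Sum>r\<in>R. of_bool (f a mod d = r) * of_bool (f b mod d = r)) = (\<Sum>r\<in>R. of_bool (f a mod d = r) :: real)"
      unfolding True
      by (intro sum.cong) (simp_all add: of_bool_def)
    also have "\<dots> = 1" by (rule 1)
    finally have "(\<Sum>r\<in>R. of_bool (f a mod d = r) * of_bool (f b mod d = r)) = (1::real)" .
    moreover have "d dvd f b - f a" using True by (metis mod_eq_dvd_iff)
    ultimately show ?thesis by (simp only: of_bool_eq)
  next
    case False
    then have "(\<Sum>r\<in>R. of_bool (f a mod d = r) * of_bool (f b mod d = r)) = (\<Sum>r\<in>R. 0 :: real)"
      by (intro sum.cong) auto
    then show ?thesis using False by (auto simp: mod_eq_dvd_iff dvd_diff_commute)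
  qed
  have sc: "(\<Sum>r\<in>R. c r) = card A"
    unfolding c_def by (subst sum.swap) (simp add: 1)
  have "(\<Sum>r\<in>R. (c r)\<^sup>2) = (\<Sum>r\<in>R. \<Sum>a\<in>A. \<Sum>b\<in>A. of_bool (f a mod d = r) * of_bool (f b mod d = r))"
    unfolding c_def by (simp add: power2_eq_square sum_product)
  also have "\<dots> = (\<Sum>a\<in>A. \<Sum>r\<in>R. \<Sum>b\<in>A. of_bool (f a mod d = r) * of_bool (f b mod d = r))"
    by (rule sum.swap)
  also have "\<dots> = (\<Sum>a\<in>A. \<Sum>b\<in>A. \<Sum>r\<in>R. of_bool (f a mod d = r) * of_bool (f b mod d = r))"
    by (rule sum.cong[OF refl], rule sum.swap)
  finally have sq: "(\<Sum>r\<in>R. (c r)\<^sup>2) = (\<Sum>a\<in>A. \<Sum>b\<in>A. of_bool (d dvd f b - f a))"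
    by (simp add: 2)
  define q where "q = real (card A) / real_of_int d"
  have "(\<Sum>r\<in>R. (c r - q)\<^sup>2) = (\<Sum>r\<in>R. (c r)\<^sup>2) - 2 * q * (\<Sum>r\<in>R. c r) + card R * q\<^sup>2"
    by (simp add: power2_diff sum.distrib sum_subtractf sum_distrib_left sum_distrib_right mult_ac)
  also have "\<dots> = (\<Sum>r\<in>R. (c r)\<^sup>2) - (real (card A))\<^sup>2 / d"
    unfolding sc R using d by (simp add: q_def field_simps power2_eq_square)
  moreover have "(\<Sum>r\<in>R. (c r - q)\<^sup>2) \<ge> 0" by (intro sum_nonneg) auto
  ultimately show ?thesis unfolding sq by simp
qed

section \<open>Weighted pair counts and their mean over the base\<close>

definition odd_primes :: "nat \<Rightarrow> int set" where
  "odd_primes K = {p. prime p \<and> odd p \<and> p \<le> int K}"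

definition pair_count :: "int \<Rightarrow> nat \<Rightarrow> real \<Rightarrow> real" where
  "pair_count d K y = (\<Sum>k=1..K. \<Sum>l=1..K. of_bool (d dvd \<lfloor>y ^ l\<rfloor> - \<lfloor>y ^ k\<rfloor>))"

text \<open>The divisor-sum form of the sum of \<open>W\<close>: the set \<open>A\<close> encodes an
  odd squarefree number, the modulus is doubled because only even differences matter, and
  \<open>3 / 2\<close> is the factor \<open>1 + 1 / 2\<close> of the prime 2.\<close>

definition pair_weight :: "nat \<Rightarrow> real \<Rightarrow> real" where
  "pair_weight K y = (\<Sum>A\<in>Pow (odd_primes K). 3 / (2 * real_of_int (\<Prod>A)) * pair_count (2 * \<Prod>A) K y)"

text \<open>\<open>pair_weight\<close> with the expected value subtracted from each count. By
  \<open>pair_count_ge\<close> every summand is nonnegative.\<close>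

definition pair_excess :: "nat \<Rightarrow> real \<Rightarrow> real" where
  "pair_excess K y = (\<Sum>A\<in>Pow (odd_primes K). 3 / (2 * real_of_int (\<Prod>A)) *
     (pair_count (2 * \<Prod>A) K y - (real K)\<^sup>2 / (2 * real_of_int (\<Prod>A))))"

lemma finite_odd_primes [simp]: "finite (odd_primes K)"
  by (rule finite_subset[of _ "{0..int K}"]) (auto simp: odd_primes_def prime_ge_0_int)

lemma prod_odd_primes_pos: "A \<subseteq> odd_primes K \<Longrightarrow> \<Prod>A \<ge> 1"
proof -
  assume A: "A \<subseteq> odd_primes K"
  have "\<Prod>A > 0" by (rule prod_pos) (use A in \<open>auto simp: odd_primes_def intro: prime_gt_0_int\<close>)
  then show ?thesis by simp
qed

lemma inverse_prod_odd_primes_nonneg: "A \<subseteq> odd_primes K \<Longrightarrow> 0 \<le> 3 / (2 * real_of_int (\<Prod>A))"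
  using prod_odd_primes_pos[of A K] by (simp del: of_int_prod)

lemma pair_count_ge: "d \<ge> 1 \<Longrightarrow> (real K)\<^sup>2 / real_of_int d \<le> pair_count d K y"
  using pair_congruence_count_ge[of d "{1..K}" "\<lambda>k. \<lfloor>y ^ k\<rfloor>"] by (simp add: pair_count_def)

lemma pair_excess_nonneg: "pair_excess K y \<ge> 0"
  unfolding pair_excess_def
proof (intro sum_nonneg mult_nonneg_nonneg)
  fix A assume A': "A \<in> Pow (odd_primes K)"
  then have A: "\<Prod>A \<ge> 1" using prod_odd_primes_pos by blast
  show "3 / (2 * real_of_int (\<Prod>A)) \<ge> 0" using A' by (intro inverse_prod_odd_primes_nonneg) auto
  show "pair_count (2 * \<Prod>A) K y - (real K)\<^sup>2 / (2 * real_of_int (\<Prod>A)) \<ge> 0"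
    using pair_count_ge[of "2 * \<Prod>A" K y] A by simp
qed

lemma sum_geometric_shift_le:
  fixes a :: real
  assumes "a > 1"
  shows "(\<Sum>l\<in>{Suc k..K}. 1 / a ^ (l - 1 - k)) \<le> 1 / (1 - 1 / a)"
proof -
  have "(\<Sum>l\<in>{Suc k..K}. 1 / a ^ (l - 1 - k)) = (\<Sum>i<K - k. (1 / a) ^ i)"
    by (rule sum.reindex_bij_witness[of _ "\<lambda>i. i + Suc k" "\<lambda>l. l - 1 - k"]) (auto simp: power_one_over)
  also have "\<dots> \<le> (\<Sum>i. (1 / a) ^ i)"
    using assms by (intro sum_le_suminf summable_geometric) auto
  also have "\<dots> = 1 / (1 - 1 / a)" using assms by (intro suminf_geometric) auto
  finally show ?thesis .
qed

lemma sum_geometric_shift_le':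
  fixes a :: real
  assumes "a > 1"
  shows "(\<Sum>k\<in>{1..<l}. 1 / a ^ (l - 1 - k)) \<le> 1 / (1 - 1 / a)"
proof -
  have "(\<Sum>k\<in>{1..<l}. 1 / a ^ (l - 1 - k)) = (\<Sum>i<l - 1. (1 / a) ^ i)"
    by (rule sum.reindex_bij_witness[of _ "\<lambda>i. l - 1 - i" "\<lambda>k. l - 1 - k"]) (auto simp: power_one_over)
  also have "\<dots> \<le> (\<Sum>i. (1 / a) ^ i)"
    using assms by (intro sum_le_suminf summable_geometric) auto
  also have "\<dots> = 1 / (1 - 1 / a)" using assms by (intro suminf_geometric) auto
  finally show ?thesis .
qed

lemma integrable_floor_pair_set: "integrable lborel (indicator (floor_pair_set k l d a b) :: real \<Rightarrow> real)"
  using floor_pair_set_finite by (intro integrable_real_indicator) auto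

lemma pair_count_indicator:
  "indicator {a..<b} y * pair_count d K y = (\<Sum>k=1..K. \<Sum>l=1..K. indicator (floor_pair_set k l d a b) y)"
  unfolding pair_count_def sum_distrib_left
  by (intro sum.cong refl) (auto simp: floor_pair_set_def indicator_def)

lemma integrable_pair_count: "integrable lborel (\<lambda>y. indicator {a..<b} y * pair_count d K y)"
  unfolding pair_count_indicator by (intro Bochner_Integration.integrable_sum integrable_floor_pair_set)

text \<open>A diagonal pair costs at most the full length \<open>b - a\<close>. Off the diagonal the
  errors form geometric series in the distance of \<open>k\<close> and \<open>l\<close>, so each
  \<open>k\<close> contributes a bounded error and the total is linear in \<open>K\<close>.\<close>

lemma integral_pair_count_le:
  assumes d: "d \<ge> 1" and a: "1 < a" "a \<le> b"
  shows "(\<integral>y. indicator {a..<b} y * pair_count d K y \<partial>lborel) \<le>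
    (b - a) * (real K)\<^sup>2 / real_of_int d + ((b - a) + 2 * ((1 + ln b) / (1 - 1 / a))) * real K"
proof -
  define q where "q = 1 / (1 - 1 / a)"
  define m where "m = (\<lambda>k l. measure lborel (floor_pair_set k l d a b))"
  have sym: "floor_pair_set k l d a b = floor_pair_set l k d a b" for k l
    by (auto simp: floor_pair_set_def dvd_diff_commute)
  have diag: "m k k \<le> b - a" for k
  proof -
    have "floor_pair_set k k d a b = {a..<b}" by (auto simp: floor_pair_set_def)
    then show ?thesis using a by (simp add: m_def)
  qed
  have off: "m k l \<le> (b - a) / d + (1 + ln b) * (1 / a ^ (l - 1 - k))" if "k \<ge> 1" "k < l" for k l
    using measure_floor_pair_le[OF d that a] by (simp add: m_def)
  have lb: "1 + ln b \<ge> 0" using a by simp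
  have dpos: "(b - a) / d \<ge> 0" using a d by simp
  have inner: "(\<Sum>l=1..K. m k l) \<le> real K * ((b - a) / d) + ((b - a) + 2 * ((1 + ln b) * q))" if k: "k \<in> {1..K}" for k
  proof -
    have split: "{1..K} = insert k ({1..<k} \<union> {Suc k..K})" using k by auto
    have "(\<Sum>l=1..K. m k l) = m k k + ((\<Sum>l\<in>{1..<k}. m k l) + (\<Sum>l\<in>{Suc k..K}. m k l))"
      by (subst split) (subst sum.insert, simp, simp, subst sum.union_disjoint, auto)
    also have "(\<Sum>l\<in>{1..<k}. m k l) \<le> (\<Sum>l\<in>{1..<k}. (b - a) / d + (1 + ln b) * (1 / a ^ (k - 1 - l)))"
    proof (rule sum_mono)
      fix l assume "l \<in> {1..<k}"
      then show "m k l \<le> (b - a) / d + (1 + ln b) * (1 / a ^ (k - 1 - l))"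
        using off[of l k] sym[of k l] by (simp add: m_def)
    qed
    also have "\<dots> = real (k - 1) * ((b - a) / d) + (1 + ln b) * (\<Sum>l\<in>{1..<k}. 1 / a ^ (k - 1 - l))"
      by (simp add: sum.distrib sum_distrib_left)
    also have "\<dots> \<le> real (k - 1) * ((b - a) / d) + (1 + ln b) * q"
      unfolding q_def using sum_geometric_shift_le'[OF a(1)] lb by (intro add_left_mono mult_left_mono) auto
    also have "(\<Sum>l\<in>{Suc k..K}. m k l) \<le> (\<Sum>l\<in>{Suc k..K}. (b - a) / d + (1 + ln b) * (1 / a ^ (l - 1 - k)))"
      by (rule sum_mono, rule off) (use k in auto)
    also have "\<dots> = real (K - k) * ((b - a) / d) + (1 + ln b) * (\<Sum>l\<in>{Suc k..K}. 1 / a ^ (l - 1 - k))"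
      by (simp add: sum.distrib sum_distrib_left)
    also have "\<dots> \<le> real (K - k) * ((b - a) / d) + (1 + ln b) * q"
      unfolding q_def using sum_geometric_shift_le[OF a(1)] lb by (intro add_left_mono mult_left_mono) auto
    finally have "(\<Sum>l=1..K. m k l) \<le> (b - a) + 2 * ((1 + ln b) * q) + (real (k - 1) + real (K - k)) * ((b - a) / d)"
      using diag[of k] by (simp add: algebra_simps)
    also have "(real (k - 1) + real (K - k)) * ((b - a) / d) \<le> real K * ((b - a) / d)"
      using k dpos by (intro mult_right_mono) auto
    finally show ?thesis by simp
  qed
  have "(\<integral>y. indicator {a..<b} y * pair_count d K y \<partial>lborel) = (\<Sum>k=1..K. \<Sum>l=1..K. m k l)"
    unfolding pair_count_indicator m_def
    by (simp add: Bochner_Integration.integral_sum integrable_floor_pair_set)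
  also have "\<dots> \<le> (\<Sum>k=1..K. real K * ((b - a) / d) + ((b - a) + 2 * ((1 + ln b) * q)))"
    by (rule sum_mono, rule inner) auto
  also have "\<dots> = (b - a) * (real K)\<^sup>2 / d + ((b - a) + 2 * ((1 + ln b) / (1 - 1 / a))) * real K"
    by (simp add: q_def power2_eq_square algebra_simps)
  finally show ?thesis .
qed

lemma sum_Pow_inverse_prod:
  assumes "finite P"
  shows "(\<Sum>A\<in>Pow P. 1 / real_of_int (\<Prod>A)) = (\<Prod>p\<in>P. 1 + 1 / real_of_int p)"
  using sum_Pow_prod[OF assms, of "\<lambda>p. 1 / real_of_int p"] by (simp add: prod_dividef)

lemma integrable_indicator_Ico: "integrable lborel (indicator {a..<b::real} :: real \<Rightarrow> real)"
  by (cases "a \<le> b") (auto intro!: integrable_real_indicator)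

lemma integrable_pair_excess: "integrable lborel (\<lambda>y. indicator {a..<b} y * pair_excess K y)"
proof -
  have "integrable lborel (\<lambda>y. \<Sum>A\<in>Pow (odd_primes K). 3 / (2 * real_of_int (\<Prod>A)) *
     (indicator {a..<b} y * pair_count (2 * \<Prod>A) K y - (real K)\<^sup>2 / (2 * real_of_int (\<Prod>A)) * indicator {a..<b} y))"
    by (intro Bochner_Integration.integrable_sum Bochner_Integration.integrable_diff integrable_mult_right
          integrable_pair_count integrable_indicator_Ico)
  then show ?thesis unfolding pair_excess_def sum_distrib_left
    by (simp add: algebra_simps)
qed

text \<open>The error bound does not depend on \<open>A\<close>, so only the sum of the weights
  matters; it is the product of \<open>1 + 1 / p\<close> over the odd primes up to
  \<open>K\<close>.\<close>

lemma integral_pair_excess_le: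
  assumes a: "1 < a" "a \<le> b"
  shows "(\<integral>y. indicator {a..<b} y * pair_excess K y \<partial>lborel) \<le>
    3 / 2 * ((b - a) + 2 * ((1 + ln b) / (1 - 1 / a))) * real K * sqrt (real K + 1)"
proof -
  define G where "G = (b - a) + 2 * ((1 + ln b) / (1 - 1 / a))"
  have G: "G \<ge> 0" unfolding G_def using a by auto
  note ind = integrable_indicator_Ico[of a b]
  have "(\<integral>y. indicator {a..<b} y * pair_excess K y \<partial>lborel) =
    (\<integral>y. (\<Sum>A\<in>Pow (odd_primes K). 3 / (2 * real_of_int (\<Prod>A)) *
     (indicator {a..<b} y * pair_count (2 * \<Prod>A) K y - (real K)\<^sup>2 / (2 * real_of_int (\<Prod>A)) * indicator {a..<b} y)) \<partial>lborel)"
    unfolding pair_excess_def sum_distrib_left by (simp add: algebra_simps)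
  also have "\<dots> = (\<Sum>A\<in>Pow (odd_primes K). 3 / (2 * real_of_int (\<Prod>A)) *
     ((\<integral>y. indicator {a..<b} y * pair_count (2 * \<Prod>A) K y \<partial>lborel) - (real K)\<^sup>2 / (2 * real_of_int (\<Prod>A)) * (b - a)))"
    using integrable_pair_count[of a b] ind a
    by (subst Bochner_Integration.integral_sum) (auto intro!: sum.cong)
  also have "\<dots> \<le> (\<Sum>A\<in>Pow (odd_primes K). 3 / (2 * real_of_int (\<Prod>A)) * (G * real K))"
  proof (rule sum_mono, rule mult_left_mono)
    fix A assume A': "A \<in> Pow (odd_primes K)"
    then have A: "\<Prod>A \<ge> 1" using prod_odd_primes_pos by blast
    show "3 / (2 * real_of_int (\<Prod>A)) \<ge> 0" using A' by (intro inverse_prod_odd_primes_nonneg) auto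
    show "(\<integral>y. indicator {a..<b} y * pair_count (2 * \<Prod>A) K y \<partial>lborel) - (real K)\<^sup>2 / (2 * real_of_int (\<Prod>A)) * (b - a) \<le> G * real K"
      using integral_pair_count_le[of "2 * \<Prod>A" a b K] A a by (simp add: G_def mult.commute)
  qed
  also have "\<dots> = 3 / 2 * G * real K * (\<Sum>A\<in>Pow (odd_primes K). 1 / real_of_int (\<Prod>A))"
    by (simp add: sum_distrib_left mult_ac)
  also have "\<dots> = 3 / 2 * G * real K * (\<Prod>p\<in>odd_primes K. 1 + 1 / real_of_int p)"
    by (subst sum_Pow_inverse_prod) auto
  also have "\<dots> \<le> 3 / 2 * G * real K * sqrt (real K + 1)"
    using G by (intro mult_left_mono odd_prime_prod_le_sqrt) (auto simp: odd_primes_def)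
  finally show ?thesis by (simp add: G_def)
qed

section \<open>Almost sure smallness of the excess\<close>

text \<open>By monotone convergence the series of the \<open>u n\<close> has finite integral, so it
  converges almost everywhere and its terms tend to 0.\<close>

lemma AE_tendsto_zero_of_summable_integral:
  fixes u :: "nat \<Rightarrow> 'a \<Rightarrow> real"
  assumes int: "\<And>n. integrable M (u n)" and nn: "\<And>n x. u n x \<ge> 0"
    and sm: "summable (\<lambda>n. integral\<^sup>L M (u n))"
  shows "AE x in M. (\<lambda>n. u n x) \<longlonglongrightarrow> 0"
proof -
  have [measurable]: "u n \<in> borel_measurable M" for n using int by auto
  have "(\<integral>\<^sup>+x. (\<Sum>n. ennreal (u n x)) \<partial>M) = (\<Sum>n. \<integral>\<^sup>+x. ennreal (u n x) \<partial>M)"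
    by (rule nn_integral_suminf) measurable
  also have "\<dots> = (\<Sum>n. ennreal (integral\<^sup>L M (u n)))"
    using int nn by (subst nn_integral_eq_integral) auto
  also have "\<dots> < \<infinity>"
    using sm nn by (subst suminf_ennreal2) auto
  finally have "(\<integral>\<^sup>+x. (\<Sum>n. ennreal (u n x)) \<partial>M) \<noteq> \<infinity>" by simp
  then have "AE x in M. (\<Sum>n. ennreal (u n x)) \<noteq> \<infinity>"
    by (intro nn_integral_PInf_AE) measurable
  then show ?thesis
  proof eventually_elim
    case (elim x)
    then have "summable (\<lambda>n. u n x)" using nn by (intro summable_suminf_not_top) auto
    then show ?case by (rule summable_LIMSEQ_zero)
  qed
qed

text \<open>The mean of the summand is of order \<open>K powr (- 1 / 2)\<close>, which is summable along the cubes \<open>K\<close>.\<close>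

lemma AE_pair_excess_interval:
  assumes a: "1 < a" "a \<le> b"
  shows "AE y in lborel. y \<in> {a..<b} \<longrightarrow> (\<lambda>j. pair_excess (Suc j ^ 3) y / (real (Suc j ^ 3))\<^sup>2) \<longlonglongrightarrow> 0"
proof -
  define G where "G = 3 / 2 * ((b - a) + 2 * ((1 + ln b) / (1 - 1 / a)))"
  have G: "G \<ge> 0" unfolding G_def using a by auto
  define u where "u = (\<lambda>j y. (1 / (real (Suc j ^ 3))\<^sup>2) * (indicator {a..<b} y * pair_excess (Suc j ^ 3) y))"
  have bound: "integral\<^sup>L lborel (u j) \<le> (2 * G) * real (Suc j) powr (- 3 / 2)" for j
  proof -
    define K where "K = real (Suc j ^ 3)"
    have K: "K \<ge> 1" unfolding K_def by simp
    have "integral\<^sup>L lborel (u j) = (1 / K\<^sup>2) * (\<integral>y. indicator {a..<b} y * pair_excess (Suc j ^ 3) y \<partial>lborel)"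
      unfolding u_def K_def by (rule integral_mult_right_zero)
    also have "\<dots> \<le> (1 / K\<^sup>2) * (G * K * sqrt (K + 1))"
      using integral_pair_excess_le[OF a, of "Suc j ^ 3"] by (intro mult_left_mono) (auto simp: G_def K_def)
    also have "\<dots> \<le> (1 / K\<^sup>2) * (G * K * (2 * sqrt K))"
    proof -
      have "sqrt (K + 1) \<le> sqrt (4 * K)" using K by (intro real_sqrt_le_mono) auto
      then show ?thesis using G K by (intro mult_left_mono) (auto simp: real_sqrt_mult)
    qed
    also have "\<dots> = 2 * G * (sqrt K / K)"
      using K by (simp add: power2_eq_square field_simps)
    also have "sqrt K / K = K powr (- 1 / 2)"
    proof -
      have "sqrt K / K = K powr (1 / 2) / K powr 1" using K by (simp add: powr_half_sqrt)
      also have "\<dots> = K powr (1 / 2 - 1)" by (rule powr_diff[symmetric])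
      also have "1 / 2 - 1 = (- 1 / 2 :: real)" by simp
      finally show ?thesis .
    qed
    also have "K = real (Suc j) powr 3" unfolding K_def by (simp add: powr_realpow)
    also have "\<dots> powr (- 1 / 2) = real (Suc j) powr (- 3 / 2)" by (subst powr_powr) simp
    finally show ?thesis .
  qed
  have nn: "u j y \<ge> 0" for j y unfolding u_def using pair_excess_nonneg by auto
  have "summable (\<lambda>j. real (Suc j) powr (- 3 / 2))"
    by (subst summable_Suc_iff, subst summable_real_powr_iff) simp
  then have "summable (\<lambda>j. (2 * G) * real (Suc j) powr (- 3 / 2))" by (rule summable_mult)
  then have "summable (\<lambda>j. integral\<^sup>L lborel (u j))"
    by (rule summable_comparison_test'[where N = 0]) (use bound nn in \<open>auto intro!: integral_nonneg\<close>)
  moreover have "integrable lborel (u j)" for j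
    unfolding u_def by (intro integrable_mult_right integrable_pair_excess)
  ultimately have "AE y in lborel. (\<lambda>j. u j y) \<longlonglongrightarrow> 0"
    by (intro AE_tendsto_zero_of_summable_integral nn)
  then show ?thesis
    by eventually_elim (auto simp: u_def)
qed

text \<open>The bounds degenerate as the base tends to 1 or to infinity, so the half-line is
  exhausted by countably many bounded intervals away from 1.\<close>

lemma AE_pair_excess:
  "AE y in lborel. 1 < y \<longrightarrow> (\<lambda>j. pair_excess (Suc j ^ 3) y / (real (Suc j ^ 3))\<^sup>2) \<longlonglongrightarrow> 0"
proof -
  have "AE y in lborel. \<forall>n::nat. y \<in> {1 + 1 / (real n + 1)..<real n + 2} \<longrightarrow>
      (\<lambda>j. pair_excess (Suc j ^ 3) y / (real (Suc j ^ 3))\<^sup>2) \<longlonglongrightarrow> 0"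
    by (subst AE_all_countable, intro allI AE_pair_excess_interval) (auto simp: field_simps)
  then show ?thesis
  proof eventually_elim
    case (elim y)
    show ?case
    proof
      assume y: "1 < y"
      obtain n where n: "real n > max y (1 / (y - 1))" using reals_Archimedean2 by blast
      then have "1 / (y - 1) < real n + 1" by simp
      then have "1 < (real n + 1) * (y - 1)" using y by (simp add: pos_divide_less_eq)
      then have "1 / (real n + 1) < y - 1" by (simp add: pos_divide_less_eq mult.commute)
      then have "y \<in> {1 + 1 / (real n + 1)..<real n + 2}" using n by auto
      then show "(\<lambda>j. pair_excess (Suc j ^ 3) y / (real (Suc j ^ 3))\<^sup>2) \<longlonglongrightarrow> 0" using elim by blast
    qed
  qed
qed

text \<open>The subtracted main terms are multiplicative: \<open>3 / 4 = 3 / 2 * 1 / 2\<close> from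
  the prime 2, and a product of \<open>1 + 1 / p^2\<close> over odd primes, at most
  \<open>12 / pi^2\<close>.\<close>

lemma pair_weight_le: "pair_weight K y \<le> pair_excess K y + 9 / pi\<^sup>2 * (real K)\<^sup>2"
proof -
  have "pair_weight K y - pair_excess K y =
    (\<Sum>A\<in>Pow (odd_primes K). 3 / (2 * real_of_int (\<Prod>A)) * ((real K)\<^sup>2 / (2 * real_of_int (\<Prod>A))))"
    unfolding pair_weight_def pair_excess_def by (simp add: sum_subtractf [symmetric] algebra_simps)
  also have "\<dots> = 3 / 4 * (real K)\<^sup>2 * (\<Sum>A\<in>Pow (odd_primes K). \<Prod>p\<in>A. 1 / (real_of_int p)\<^sup>2)"
  proof -
    have "3 / (2 * real_of_int (\<Prod>A)) * ((real K)\<^sup>2 / (2 * real_of_int (\<Prod>A))) =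
      3 / 4 * (real K)\<^sup>2 * (\<Prod>p\<in>A. 1 / (real_of_int p)\<^sup>2)" for A
      by (simp add: prod_dividef prod_power_distrib) (simp add: power2_eq_square prod.distrib)
    then show ?thesis by (simp only: sum_distrib_left)
  qed
  also have "\<dots> = 3 / 4 * (real K)\<^sup>2 * (\<Prod>p\<in>odd_primes K. 1 + 1 / (real_of_int p)\<^sup>2)"
    by (subst sum_Pow_prod) auto
  also have "\<dots> \<le> 3 / 4 * (real K)\<^sup>2 * (12 / pi\<^sup>2)"
    by (intro mult_left_mono odd_prime_prod_le finite_odd_primes) (auto simp: odd_primes_def)
  finally show ?thesis by (simp add: field_simps)
qed

text \<open>More pairs and more moduli, all with nonnegative weight. This carries the estimate from
  the cubes to all \<open>K\<close>.\<close>

lemma pair_weight_mono: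
  assumes "K \<le> L"
  shows "pair_weight K y \<le> pair_weight L y"
proof -
  have "pair_weight K y \<le> (\<Sum>A\<in>Pow (odd_primes K). 3 / (2 * real_of_int (\<Prod>A)) * pair_count (2 * \<Prod>A) L y)"
    unfolding pair_weight_def
  proof (rule sum_mono, rule mult_left_mono)
    fix A assume A': "A \<in> Pow (odd_primes K)"
    then have A: "\<Prod>A \<ge> 1" using prod_odd_primes_pos by blast
    show "3 / (2 * real_of_int (\<Prod>A)) \<ge> 0" using A' by (intro inverse_prod_odd_primes_nonneg) auto
    have "pair_count (2 * \<Prod>A) K y \<le> (\<Sum>k=1..K. \<Sum>l=1..L. of_bool (2 * \<Prod>A dvd \<lfloor>y ^ l\<rfloor> - \<lfloor>y ^ k\<rfloor>))"
      unfolding pair_count_def using assms by (intro sum_mono sum_mono2) auto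
    also have "\<dots> \<le> pair_count (2 * \<Prod>A) L y"
      unfolding pair_count_def using assms by (intro sum_mono2 sum_nonneg) auto
    finally show "pair_count (2 * \<Prod>A) K y \<le> pair_count (2 * \<Prod>A) L y" .
  qed
  also have "\<dots> \<le> pair_weight L y"
    unfolding pair_weight_def
  proof (rule sum_mono2)
    show "Pow (odd_primes K) \<subseteq> Pow (odd_primes L)" using assms by (auto simp: odd_primes_def)
    fix A assume "A \<in> Pow (odd_primes L) - Pow (odd_primes K)"
    then show "0 \<le> 3 / (2 * real_of_int (\<Prod>A)) * pair_count (2 * \<Prod>A) L y"
      using inverse_prod_odd_primes_nonneg[of A L] unfolding pair_count_def
      by (intro mult_nonneg_nonneg sum_nonneg) auto
  qed auto
  finally show ?thesis .
qed

section \<open>From the sum of \<open>W\<close> to weighted pair counts\<close>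

lemma prod_primes_dvd_int:
  fixes A :: "int set"
  assumes "finite A" "\<And>p. p \<in> A \<Longrightarrow> prime p \<and> p dvd h"
  shows "\<Prod>A dvd h"
  using assms
proof (induction A)
  case (insert p A)
  have "coprime p (\<Prod>A)"
    by (rule prod_coprime_right) (use insert in \<open>auto intro!: primes_coprime\<close>)
  then show ?case using insert by (auto intro!: divides_mult)
qed auto

text \<open>Primes \<open>p > K\<close> are harmless: at most \<open>K ln y / ln K\<close> of them divide \<open>h\<close>, each with a factor at most
  \<open>1 + 1 / K\<close>.\<close>

lemma W_le:
  assumes h: "h \<noteq> 0" "even h" "real_of_int \<bar>h\<bar> \<le> y ^ K" and K: "K \<ge> 2" and y: "y > 1"
  shows "W h \<le> exp (ln y / ln K) *
    (\<Sum>A\<in>Pow (odd_primes K). 3 / (2 * real_of_int (\<Prod>A)) * of_bool (2 * \<Prod>A dvd h))"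
proof -
  define D where "D = {p. prime p \<and> p dvd h}"
  define D1 where "D1 = {p\<in>D. odd p \<and> p \<le> int K}"
  define D2 where "D2 = {p\<in>D. p > int K}"
  have fin: "finite D" using h unfolding D_def
    by (intro finite_subset[OF _ finite_divisors_int[of h]]) auto
  have D: "D = insert 2 (D1 \<union> D2)"
  proof -
    have "p = 2" if "p \<in> D" "even p" for p
      using that prime_odd_int[of p] prime_ge_2_int[of p] unfolding D_def by force
    then show ?thesis using h K unfolding D1_def D2_def D_def by auto
  qed
  have fin12: "finite D1" "finite D2" using fin by (auto simp: D1_def D2_def)
  have n2: "2 \<notin> D1 \<union> D2" using K by (auto simp: D1_def D2_def)
  have "W h = (\<Prod>p\<in>D. 1 + 1 / real_of_int p)" unfolding W_def D_def ..
  also have "\<dots> = 3 / 2 * ((\<Prod>p\<in>D1. 1 + 1 / real_of_int p) * (\<Prod>p\<in>D2. 1 + 1 / real_of_int p))"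
    unfolding D using fin12 n2 by (subst prod.insert) (auto intro!: prod.union_disjoint simp: D1_def D2_def)
  finally have Wh: "W h = 3 / 2 * ((\<Prod>p\<in>D1. 1 + 1 / real_of_int p) * (\<Prod>p\<in>D2. 1 + 1 / real_of_int p))" .
  have "(\<Prod>p\<in>D2. 1 + 1 / real_of_int p) \<le> (\<Prod>p\<in>D2. exp (1 / real K))"
  proof (rule prod_mono, safe)
    fix p assume p: "p \<in> D2"
    then have "1 / real_of_int p \<le> 1 / real K" using K by (intro divide_left_mono) (auto simp: D2_def)
    then show "1 + 1 / real_of_int p \<le> exp (1 / real K)" using exp_ge_add_one_self[of "1 / real K"] by linarith
    show "0 \<le> 1 + 1 / real_of_int p" using p K by (auto simp: D2_def)
  qed
  also have "\<dots> = exp (card D2 / real K)" by (simp flip: exp_of_nat_mult)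
  also have "\<dots> \<le> exp (ln y / ln K)"
  proof -
    \<comment> \<open>The primes in \<open>D2\<close> exceed \<open>K\<close> and their product
      divides \<open>h\<close>; taking logarithms bounds their number.\<close>
    have "real K ^ card D2 \<le> (\<Prod>p\<in>D2. real_of_int p)"
      unfolding prod_constant[symmetric] by (intro prod_mono) (auto simp: D2_def)
    also have "\<dots> = real_of_int (\<Prod>D2)" by simp
    also have "\<dots> \<le> real_of_int \<bar>h\<bar>"
    proof -
      have "\<Prod>D2 dvd h" by (rule prod_primes_dvd_int) (use fin12 in \<open>auto simp: D2_def D_def\<close>)
      then show ?thesis using h dvd_imp_le_int[of h "\<Prod>D2"] by linarith
    qed
    also have "\<dots> \<le> y ^ K" by (rule h)
    finally have "ln (real K ^ card D2) \<le> ln (y ^ K)" using K y by (subst ln_le_cancel_iff) auto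
    then have "card D2 * ln K \<le> K * ln y" using K y by (simp add: ln_realpow)
    then have "card D2 / real K \<le> ln y / ln K" using K by (simp add: field_simps)
    then show ?thesis by simp
  qed
  finally have b2: "(\<Prod>p\<in>D2. 1 + 1 / real_of_int p) \<le> exp (ln y / ln K)" .
  have "3 / 2 * (\<Prod>p\<in>D1. 1 + 1 / real_of_int p) = (\<Sum>A\<in>Pow D1. 3 / (2 * real_of_int (\<Prod>A)))"
    using sum_Pow_inverse_prod[OF fin12(1)] by (simp add: sum_distrib_left flip: sum_Pow_inverse_prod[OF fin12(1)])
  also have "\<dots> = (\<Sum>A\<in>Pow D1. 3 / (2 * real_of_int (\<Prod>A)) * of_bool (2 * \<Prod>A dvd h))"
  proof (rule sum.cong[OF refl])
    fix A assume A: "A \<in> Pow D1"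
    have "\<Prod>(insert 2 A) dvd h"
      by (rule prod_primes_dvd_int) (use A fin12 h in \<open>auto simp: D1_def D_def intro: finite_subset\<close>)
    moreover have "2 \<notin> A" "finite A" using A n2 fin12 by (auto intro: finite_subset)
    ultimately have "2 * \<Prod>A dvd h" by simp
    then show "3 / (2 * real_of_int (\<Prod>A)) = 3 / (2 * real_of_int (\<Prod>A)) * of_bool (2 * \<Prod>A dvd h)" by simp
  qed
  also have "\<dots> \<le> (\<Sum>A\<in>Pow (odd_primes K). 3 / (2 * real_of_int (\<Prod>A)) * of_bool (2 * \<Prod>A dvd h))"
  proof (rule sum_mono2)
    show "Pow D1 \<subseteq> Pow (odd_primes K)" by (auto simp: D1_def D_def odd_primes_def)
    fix A assume "A \<in> Pow (odd_primes K) - Pow D1"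
    then show "0 \<le> 3 / (2 * real_of_int (\<Prod>A)) * of_bool (2 * \<Prod>A dvd h)"
      using inverse_prod_odd_primes_nonneg[of A K] by (intro mult_nonneg_nonneg) auto
  qed auto
  finally have b1: "3 / 2 * (\<Prod>p\<in>D1. 1 + 1 / real_of_int p) \<le> (\<Sum>A\<in>Pow (odd_primes K). 3 / (2 * real_of_int (\<Prod>A)) * of_bool (2 * \<Prod>A dvd h))" .
  have nn: "(\<Prod>p\<in>D1. 1 + 1 / real_of_int p) \<ge> 0"
    by (rule prod_nonneg) (auto simp: D1_def D_def prime_ge_0_int)
  have "W h = (\<Prod>p\<in>D2. 1 + 1 / real_of_int p) * (3 / 2 * (\<Prod>p\<in>D1. 1 + 1 / real_of_int p))"
    unfolding Wh by simp
  also have "\<dots> \<le> exp (ln y / ln K) * (\<Sum>A\<in>Pow (odd_primes K). 3 / (2 * real_of_int (\<Prod>A)) * of_bool (2 * \<Prod>A dvd h))"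
    using b1 b2 nn by (intro mult_mono) auto
  finally show ?thesis .
qed

text \<open>Zero and odd differences get the value 0 here because \<open>card_collisions_le\<close>
  bounds their contribution separately.\<close>

definition W_sum :: "nat \<Rightarrow> real \<Rightarrow> real" where
  "W_sum K y = (\<Sum>k=1..K. \<Sum>l=1..K. let h = \<lfloor>y ^ l\<rfloor> - \<lfloor>y ^ k\<rfloor> in if h \<noteq> 0 \<and> even h then W h else 0)"

lemma W_sum_le_pair_weight:
  assumes K: "K \<ge> 2" and y: "y > 1"
  shows "W_sum K y \<le> exp (ln y / ln K) * pair_weight K y"
proof -
  define g where "g = (\<lambda>h. \<Sum>A\<in>Pow (odd_primes K). 3 / (2 * real_of_int (\<Prod>A)) * of_bool (2 * \<Prod>A dvd h))"
  have g0: "g h \<ge> 0" for h unfolding g_def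
  proof (rule sum_nonneg)
    fix A assume "A \<in> Pow (odd_primes K)"
    then show "0 \<le> 3 / (2 * real_of_int (\<Prod>A)) * of_bool (2 * \<Prod>A dvd h)"
      using inverse_prod_odd_primes_nonneg[of A K] by (intro mult_nonneg_nonneg) auto
  qed
  have "W_sum K y \<le> (\<Sum>k=1..K. \<Sum>l=1..K. exp (ln y / ln K) * g (\<lfloor>y ^ l\<rfloor> - \<lfloor>y ^ k\<rfloor>))"
    unfolding W_sum_def
  proof (intro sum_mono)
    fix k l assume kl: "k \<in> {1..K}" "l \<in> {1..K}"
    define h where "h = \<lfloor>y ^ l\<rfloor> - \<lfloor>y ^ k\<rfloor>"
    have "0 \<le> \<lfloor>y ^ k\<rfloor>" "0 \<le> \<lfloor>y ^ l\<rfloor>" using y by auto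
    moreover have "y ^ k \<le> y ^ K" "y ^ l \<le> y ^ K" using y kl by (auto intro!: power_increasing)
    ultimately have "real_of_int \<bar>h\<bar> \<le> y ^ K" unfolding h_def by linarith
    then have "(if h \<noteq> 0 \<and> even h then W h else 0) \<le> exp (ln y / ln K) * g h"
      using W_le[of h y K] K y g0[of h] by (auto simp: g_def)
    then show "(let h = \<lfloor>y ^ l\<rfloor> - \<lfloor>y ^ k\<rfloor> in if h \<noteq> 0 \<and> even h then W h else 0) \<le> exp (ln y / ln K) * g (\<lfloor>y ^ l\<rfloor> - \<lfloor>y ^ k\<rfloor>)"
      unfolding Let_def h_def[symmetric] .
  qed
  also have "\<dots> = exp (ln y / ln K) * (\<Sum>k=1..K. \<Sum>l=1..K. g (\<lfloor>y ^ l\<rfloor> - \<lfloor>y ^ k\<rfloor>))"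
    by (simp add: sum_distrib_left)
  also have "(\<Sum>k=1..K. \<Sum>l=1..K. g (\<lfloor>y ^ l\<rfloor> - \<lfloor>y ^ k\<rfloor>)) = pair_weight K y"
  proof -
    have "(\<Sum>k=1..K. \<Sum>l=1..K. g (\<lfloor>y ^ l\<rfloor> - \<lfloor>y ^ k\<rfloor>)) =
      (\<Sum>k=1..K. \<Sum>A\<in>Pow (odd_primes K). \<Sum>l=1..K. 3 / (2 * real_of_int (\<Prod>A)) * of_bool (2 * \<Prod>A dvd \<lfloor>y ^ l\<rfloor> - \<lfloor>y ^ k\<rfloor>))"
      unfolding g_def by (intro sum.cong refl sum.swap)
    also have "\<dots> = (\<Sum>A\<in>Pow (odd_primes K). \<Sum>k=1..K. \<Sum>l=1..K. 3 / (2 * real_of_int (\<Prod>A)) * of_bool (2 * \<Prod>A dvd \<lfloor>y ^ l\<rfloor> - \<lfloor>y ^ k\<rfloor>))"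
      by (rule sum.swap)
    finally show ?thesis unfolding pair_weight_def pair_count_def by (simp only: sum_distrib_left)
  qed
  finally show ?thesis .
qed

text \<open>Every large \<open>K\<close> lies just below a cube \<open>L\<close> with
  \<open>L / K\<close> close to 1. Monotonicity replaces \<open>K\<close> by \<open>L\<close>, where
  the excess is known to be small.\<close>

lemma W_sum_eventually_le:
  assumes y: "y > 1" and lim: "(\<lambda>j. pair_excess (Suc j ^ 3) y / (real (Suc j ^ 3))\<^sup>2) \<longlonglongrightarrow> 0"
    and eps: "\<epsilon> > 0"
  shows "\<forall>\<^sub>F K in sequentially. W_sum K y \<le> (9 / pi\<^sup>2 + \<epsilon>) * (real K)\<^sup>2"
proof -
  \<comment> \<open>\<open>j K ^ 3 < K \<le> Suc (j K) ^ 3\<close> as soon as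
    \<open>j K \<ge> 1\<close>, so \<open>j K\<close> is the index in the subsequence of
    \<open>lim\<close>.\<close>
  define j where "j = (\<lambda>K. LEAST j. K \<le> Suc j ^ 3)"
  have jle: "K \<le> Suc (j K) ^ 3" for K
    unfolding j_def
  proof (rule LeastI)
    have "K \<le> Suc K ^ 1" by simp
    also have "\<dots> \<le> Suc K ^ 3" by (intro power_increasing) auto
    finally show "K \<le> Suc K ^ 3" .
  qed
  have jgt: "j K ^ 3 < K" if "j K \<ge> 1" for K
  proof (rule ccontr)
    assume "\<not> j K ^ 3 < K"
    then have "K \<le> Suc (j K - 1) ^ 3" using that by simp
    then have "j K \<le> j K - 1" unfolding j_def[of] by (intro Least_le) (simp add: j_def)
    then show False using that by simp
  qed
  have jlim: "filterlim j at_top sequentially"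
    unfolding filterlim_at_top
  proof
    fix M
    show "\<forall>\<^sub>F K in sequentially. M \<le> j K"
      using eventually_gt_at_top[of "M ^ 3"]
    proof eventually_elim
      case (elim K)
      show "M \<le> j K"
      proof (rule ccontr)
        assume "\<not> M \<le> j K"
        then have "Suc (j K) ^ 3 \<le> M ^ 3" by (intro power_mono) auto
        then show False using jle[of K] elim by linarith
      qed
    qed
  qed
  \<comment> \<open>The sixth power is the squared ratio of consecutive cubes, the price of passing
    from \<open>L^2\<close> to \<open>K^2\<close>.\<close>
  define B where "B = (\<lambda>i. (pair_excess (Suc i ^ 3) y / (real (Suc i ^ 3))\<^sup>2 + 9 / pi\<^sup>2) * ((real i + 1) / real i) ^ 6)"
  have "(\<lambda>i::nat. ((real i + 1) / real i) ^ 6) \<longlonglongrightarrow> 1" by real_asymp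
  then have "B \<longlonglongrightarrow> (0 + 9 / pi\<^sup>2) * 1"
    unfolding B_def by (intro tendsto_mult tendsto_add lim tendsto_const)
  then have Bj: "(\<lambda>K. B (j K)) \<longlonglongrightarrow> 9 / pi\<^sup>2" using jlim by (auto intro: filterlim_compose)
  have "(\<lambda>K::nat. exp (ln y / ln K)) \<longlonglongrightarrow> 1" by real_asymp
  then have "(\<lambda>K. exp (ln y / ln K) * B (j K)) \<longlonglongrightarrow> 1 * (9 / pi\<^sup>2)" by (intro tendsto_mult Bj)
  then have ev: "\<forall>\<^sub>F K in sequentially. exp (ln y / ln K) * B (j K) < 9 / pi\<^sup>2 + \<epsilon>"
    using eps by (intro order_tendstoD(2)) auto
  have "\<forall>\<^sub>F K in sequentially. 1 \<le> j K"
    using jlim by (simp add: filterlim_at_top)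
  then show ?thesis using ev eventually_ge_at_top[of 2]
  proof eventually_elim
    case (elim K)
    define i where "i = j K"
    define L where "L = Suc i ^ 3"
    have i: "1 \<le> i" "K \<le> L" "i ^ 3 < K" using elim jle[of K] jgt[of K] by (auto simp: i_def L_def)
    have "W_sum K y \<le> exp (ln y / ln K) * pair_weight K y"
      by (rule W_sum_le_pair_weight) (use elim y in auto)
    also have "pair_weight K y \<le> pair_weight L y" by (rule pair_weight_mono[OF i(2)])
    also have "\<dots> \<le> pair_excess L y + 9 / pi\<^sup>2 * (real L)\<^sup>2" by (rule pair_weight_le)
    also have "\<dots> = (pair_excess L y / (real L)\<^sup>2 + 9 / pi\<^sup>2) * (real L)\<^sup>2"
      by (simp add: L_def field_simps)
    also have "\<dots> \<le> B i * (real K)\<^sup>2"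
    proof -
      have "real L = ((real i + 1) / real i) ^ 3 * real (i ^ 3)"
        using i by (simp add: L_def power_divide add.commute)
      also have "\<dots> \<le> ((real i + 1) / real i) ^ 3 * real K"
        using i by (intro mult_left_mono) (auto simp del: of_nat_power)
      finally have "(real L)\<^sup>2 \<le> (((real i + 1) / real i) ^ 3 * real K)\<^sup>2" by (intro power_mono) auto
      also have "\<dots> = ((real i + 1) / real i) ^ 6 * (real K)\<^sup>2" by (simp add: power_mult_distrib flip: power_mult)
      finally have "(real L)\<^sup>2 \<le> ((real i + 1) / real i) ^ 6 * (real K)\<^sup>2" .
      then have "(pair_excess L y / (real L)\<^sup>2 + 9 / pi\<^sup>2) * (real L)\<^sup>2 \<le>
        (pair_excess L y / (real L)\<^sup>2 + 9 / pi\<^sup>2) * (((real i + 1) / real i) ^ 6 * (real K)\<^sup>2)"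
        using pair_excess_nonneg by (intro mult_left_mono) auto
      then show ?thesis by (simp add: B_def L_def mult_ac)
    qed
    finally have "W_sum K y \<le> (exp (ln y / ln K) * B (j K)) * (real K)\<^sup>2" by (simp add: i_def mult_ac)
    also have "\<dots> \<le> (9 / pi\<^sup>2 + \<epsilon>) * (real K)\<^sup>2"
      using elim by (intro mult_right_mono) auto
    finally show ?case .
  qed
qed

section \<open>The zeta function on the line of real part one\<close>

text \<open>\<open>npow n s\<close> is the \<open>n\<close>-th term of the Dirichlet series, counted from 0.\<close>

definition npow :: "nat \<Rightarrow> complex \<Rightarrow> complex" where
  "npow n s = exp (- s * of_real (ln (real (Suc n))))"

lemma norm_npow: "cmod (npow n s) = real (Suc n) powr (- Re s)"
  by (simp add: npow_def powr_def)

lemma npow_has_derivative [derivative_intros]: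
  "(npow n has_field_derivative (- of_real (ln (real (Suc n))) * npow n s)) (at s)"
proof -
  have "((\<lambda>s. exp (- s * of_real (ln (real (Suc n))))) has_field_derivative (- of_real (ln (real (Suc n))) * npow n s)) (at s)"
    unfolding npow_def by (auto intro!: derivative_eq_intros)
  then show ?thesis unfolding npow_def .
qed

lemma npow_holomorphic: "npow n holomorphic_on A"
  unfolding npow_def by (auto intro!: holomorphic_intros)

text \<open>Index \<open>n\<close> stands for the integer \<open>n + 1\<close>, which explains the
  shift in the index of the product.\<close>

lemma npow_mult: "npow (Suc a * Suc b - 1) s = npow a s * npow b s"
proof -
  have "ln (real (Suc (Suc a * Suc b - 1))) = ln (real (Suc a)) + ln (real (Suc b))"
    by (simp add: ln_mult del: of_nat_Suc mult_Suc mult_Suc_right)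
  then show ?thesis unfolding npow_def by (simp add: exp_add [symmetric] algebra_simps)
qed

lemma summable_Suc_powr: "\<sigma> > 1 \<Longrightarrow> summable (\<lambda>n. real (Suc n) powr (- \<sigma>))"
  by (subst summable_Suc_iff, subst summable_real_powr_iff) simp

definition zeta :: "complex \<Rightarrow> complex" where
  "zeta s = (\<Sum>n. npow n s)"

text \<open>On the ball about \<open>s\<close> of radius half the distance to the line of real part
  one, a convergent series of powers dominates all terms, so the series may be differentiated
  termwise.\<close>

lemma zeta_sums_and_derivative:
  assumes "Re s > 1"
  shows "(\<lambda>n. npow n s) sums zeta s"
    and "\<exists>z'. (\<lambda>n. - of_real (ln (real (Suc n))) * npow n s) sums z' \<and> (zeta has_field_derivative z') (at s)"
proof -
  define H where "H = {s. Re s > 1}"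
  have H: "open H" unfolding H_def by (rule open_halfspace_Re_gt)
  have "\<exists>g g'. \<forall>s \<in> H. ((\<lambda>n. npow n s) sums g s) \<and>
      ((\<lambda>n. - of_real (ln (real (Suc n))) * npow n s) sums g' s) \<and> (g has_field_derivative g' s) (at s)"
  proof (rule series_and_derivative_comparison_local[OF H])
    fix s assume s: "s \<in> H"
    define d where "d = (Re s - 1) / 2"
    have d: "d > 0" using s by (simp add: d_def H_def)
    have "cmod (npow n t) \<le> real (Suc n) powr (- (1 + d))" if "t \<in> ball s d \<inter> H" for n t
    proof -
      have "\<bar>Re (s - t)\<bar> < d" using that abs_Re_le_cmod[of "s - t"] by (auto simp: dist_norm)
      then have "Re s - Re t < d" by (auto simp: abs_less_iff)
      then have "Re t \<ge> 1 + d" by (simp add: d_def field_simps)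
      then show ?thesis unfolding norm_npow by (intro powr_mono) auto
    qed
    then show "\<exists>d h. 0 < d \<and> summable h \<and> (\<forall>\<^sub>F n in sequentially. \<forall>t\<in>ball s d \<inter> H. cmod (npow n t) \<le> h n)"
      using d summable_Suc_powr[of "1 + d"] by (intro exI[of _ d] exI[of _ "\<lambda>n. real (Suc n) powr (- (1 + d))"]) auto
  qed (rule npow_has_derivative)
  then obtain g g' where g: "\<And>s. s \<in> H \<Longrightarrow> ((\<lambda>n. npow n s) sums g s) \<and>
      ((\<lambda>n. - of_real (ln (real (Suc n))) * npow n s) sums g' s) \<and> (g has_field_derivative g' s) (at s)" by blast
  have gz: "g s = zeta s" if "s \<in> H" for s using g[OF that] by (simp add: zeta_def sums_iff)
  have sH: "s \<in> H" using assms by (simp add: H_def)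
  show "(\<lambda>n. npow n s) sums zeta s" using g[OF sH] gz[OF sH] by simp
  have "(zeta has_field_derivative g' s) (at s)"
    by (rule has_field_derivative_transform_within_open[OF _ H sH gz]) (use g[OF sH] in auto)
  then show "\<exists>z'. (\<lambda>n. - of_real (ln (real (Suc n))) * npow n s) sums z' \<and> (zeta has_field_derivative z') (at s)"
    using g[OF sH] by blast
qed

section \<open>The Dirichlet series of the von Mangoldt function\<close>

definition mangoldt_series :: "complex \<Rightarrow> complex" where
  "mangoldt_series s = (\<Sum>n. mangoldt (Suc n) * npow n s)"

lemma summable_mangoldt_powr:
  assumes "\<sigma> > 1"
  shows "summable (\<lambda>n. mangoldt (Suc n) * real (Suc n) powr (- \<sigma>))"
proof -
  define d where "d = (\<sigma> - 1) / 2"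
  have d: "d > 0" using assms by (simp add: d_def)
  have "summable (\<lambda>n. (1 / d) * real (Suc n) powr (- (1 + d)))"
    using d by (intro summable_mult summable_Suc_powr) auto
  then show ?thesis
  proof (rule summable_comparison_test'[where N = 0])
    fix n
    have "mangoldt (Suc n) \<le> ln (real (Suc n))" using mangoldt_le[of "Suc n"] by simp
    also have "\<dots> \<le> real (Suc n) powr d / d" using d by (intro ln_powr_bound) auto
    finally have "mangoldt (Suc n) * real (Suc n) powr (- \<sigma>) \<le> (real (Suc n) powr d / d) * real (Suc n) powr (- \<sigma>)"
      by (intro mult_right_mono) auto
    also have "\<dots> = (1 / d) * (real (Suc n) powr d * real (Suc n) powr (- \<sigma>))" by simp
    also have "real (Suc n) powr d * real (Suc n) powr (- \<sigma>) = real (Suc n) powr (d - \<sigma>)" by (simp flip: powr_add)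
    also have "d - \<sigma> = - (1 + d)" by (simp add: d_def field_simps)
    finally show "norm (mangoldt (Suc n) * real (Suc n) powr (- \<sigma>)) \<le> (1 / d) * real (Suc n) powr (- (1 + d))"
      by (simp add: mangoldt_nonneg)
  qed
qed

lemma norm_mangoldt_npow: "cmod (mangoldt (Suc n) * npow n s) = mangoldt (Suc n) * real (Suc n) powr (- Re s)"
  by (simp add: norm_mult norm_npow)

lemma mangoldt_series_sums: "Re s > 1 \<Longrightarrow> (\<lambda>n. mangoldt (Suc n) * npow n s) sums mangoldt_series s"
  unfolding mangoldt_series_def
  by (rule summable_sums, rule summable_norm_cancel, unfold norm_mangoldt_npow, rule summable_mangoldt_powr)

text \<open>The sum of \<open>mangoldt\<close> over the divisors of \<open>n\<close> is
  \<open>ln n\<close>. The absolutely convergent double series for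
  \<open>mangoldt_series s * zeta s\<close> is regrouped by the product of the two indices and
  compared with the termwise derivative of \<open>zeta\<close>.\<close>

lemma zeta_derivative_eq:
  assumes s: "Re s > 1"
  shows "(zeta has_field_derivative (- mangoldt_series s * zeta s)) (at s)"
proof -
  obtain z' where z': "(\<lambda>n. - of_real (ln (real (Suc n))) * npow n s) sums z'" "(zeta has_field_derivative z') (at s)"
    using zeta_sums_and_derivative(2)[OF s] by blast
  define F where "F = (\<lambda>(a, b). (mangoldt (Suc a) * npow a s) * npow b s)"
  have n1: "summable (\<lambda>n. cmod (mangoldt (Suc n) * npow n s))"
    unfolding norm_mangoldt_npow by (rule summable_mangoldt_powr[OF s])
  have n2: "summable (\<lambda>n. cmod (npow n s))" unfolding norm_npow by (rule summable_Suc_powr[OF s])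
  have h1: "((\<lambda>n. mangoldt (Suc n) * npow n s) has_sum mangoldt_series s) UNIV"
    by (rule norm_summable_imp_has_sum[OF n1 mangoldt_series_sums[OF s]])
  have h2: "((\<lambda>n. npow n s) has_sum zeta s) UNIV"
    by (rule norm_summable_imp_has_sum[OF n2 zeta_sums_and_derivative(1)[OF s]])
  have a1: "(\<lambda>n. cmod (mangoldt (Suc n) * npow n s)) summable_on UNIV"
    by (rule norm_summable_imp_summable_on) (use n1 in \<open>simp only: real_norm_def abs_norm_cancel\<close>)
  have a2: "(\<lambda>n. cmod (npow n s)) summable_on UNIV"
    by (rule norm_summable_imp_summable_on) (use n2 in \<open>simp only: real_norm_def abs_norm_cancel\<close>)
  have A: "\<forall>a\<in>UNIV. (\<lambda>b. cmod (F (a, b))) summable_on UNIV"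
    unfolding F_def prod.case norm_mult by (intro ballI, rule summable_on_cmult_right, rule a2)
  have B: "(\<lambda>a. norm (\<Sum>\<^sub>\<infinity>b. cmod (F (a, b)))) summable_on UNIV"
  proof -
    have "(\<Sum>\<^sub>\<infinity>b. cmod (F (a, b))) = cmod (mangoldt (Suc a) * npow a s) * (\<Sum>\<^sub>\<infinity>b. cmod (npow b s))" for a
      unfolding F_def prod.case norm_mult[of "_ * _" "npow _ s"] by (rule infsum_cmult_right')
    moreover have "(\<Sum>\<^sub>\<infinity>b. cmod (npow b s)) \<ge> 0" by (rule infsum_nonneg) simp
    then have "norm (cmod (mangoldt (Suc a) * npow a s) * (\<Sum>\<^sub>\<infinity>b. cmod (npow b s))) =
        cmod (mangoldt (Suc a) * npow a s) * (\<Sum>\<^sub>\<infinity>b. cmod (npow b s))" for a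
      unfolding real_norm_def by (intro abs_of_nonneg mult_nonneg_nonneg norm_ge_zero)
    moreover have "(\<lambda>a. cmod (mangoldt (Suc a) * npow a s) * (\<Sum>\<^sub>\<infinity>b. cmod (npow b s))) summable_on UNIV"
      by (rule summable_on_cmult_left) (rule a1)
    ultimately show ?thesis by (simp only:)
  qed
  have "(\<lambda>x. cmod (F x)) summable_on (UNIV \<times> UNIV)"
    by (rule Infinite_Sum.abs_summable_on_Sigma_iff[THEN iffD2, OF conjI[OF A B]])
  then have sm: "F summable_on (SIGMA a:UNIV. UNIV)" by (rule Infinite_Sum.abs_summable_summable)
  have "(F has_sum (mangoldt_series s * zeta s)) (SIGMA a:UNIV. UNIV)"
  proof (rule has_sum_SigmaI[OF _ _ sm])
    show "((\<lambda>b. F (a, b)) has_sum (mangoldt (Suc a) * npow a s) * zeta s) UNIV" for a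
      unfolding F_def prod.case by (rule has_sum_cmult_right[OF h2])
    show "((\<lambda>a. (mangoldt (Suc a) * npow a s) * zeta s) has_sum mangoldt_series s * zeta s) UNIV"
      by (rule has_sum_cmult_left[OF h1])
  qed
  \<comment> \<open>A pair of factors corresponds to an integer with one of its divisors; all
    indices are shifted by one.\<close>
  moreover have "bij_betw (\<lambda>(n, d). (d - 1, Suc n div d - 1)) (SIGMA n:UNIV. {d. d dvd Suc n}) (SIGMA a:UNIV. UNIV)"
  proof (rule bij_betw_byWitness[where f' = "\<lambda>(a, b). (Suc a * Suc b - 1, Suc a)"])
    show "\<forall>x\<in>SIGMA n:UNIV. {d. d dvd Suc n}. (\<lambda>(a, b). (Suc a * Suc b - 1, Suc a)) ((\<lambda>(n, d). (d - 1, Suc n div d - 1)) x) = x"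
    proof (rule ballI)
      fix x assume "x \<in> (SIGMA n:UNIV. {d. d dvd Suc n})"
      then obtain n d where x: "x = (n, d)" and "d dvd Suc n" by blast
      then obtain e where e: "Suc n = d * e" by blast
      have "d > 0" "e > 0" using e by (auto intro: Nat.gr0I)
      then have "(Suc (d - 1) * Suc (Suc n div d - 1) - 1, Suc (d - 1)) = (n, d)" by (simp add: e) (simp flip: e)
      then show "(\<lambda>(a, b). (Suc a * Suc b - 1, Suc a)) ((\<lambda>(n, d). (d - 1, Suc n div d - 1)) x) = x"
        unfolding x by (simp only: prod.case)
    qed
    show "\<forall>x\<in>SIGMA a:UNIV. UNIV. (\<lambda>(n, d). (d - 1, Suc n div d - 1)) ((\<lambda>(a, b). (Suc a * Suc b - 1, Suc a)) x) = x"
    proof (rule ballI)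
      fix x :: "nat \<times> nat"
      obtain a b where x: "x = (a, b)" by (cases x)
      have "Suc (Suc a * Suc b - 1) = Suc a * Suc b" by simp
      then have "Suc (Suc a * Suc b - 1) div Suc a = Suc b" by (metis nonzero_mult_div_cancel_left nat.distinct(2))
      then have "(Suc a - 1, Suc (Suc a * Suc b - 1) div Suc a - 1) = (a, b)" by (simp only:) simp
      then show "(\<lambda>(n, d). (d - 1, Suc n div d - 1)) ((\<lambda>(a, b). (Suc a * Suc b - 1, Suc a)) x) = x"
        unfolding x by (simp only: prod.case)
    qed
    show "(\<lambda>(a, b). (Suc a * Suc b - 1, Suc a)) ` (SIGMA a:UNIV. UNIV) \<subseteq> (SIGMA n:UNIV. {d. d dvd Suc n})"
    proof (rule image_subsetI)
      fix x :: "nat \<times> nat"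
      obtain a b where x: "x = (a, b)" by (cases x)
      have "Suc (Suc a * Suc b - 1) = Suc a * Suc b" by simp
      then have "Suc a dvd Suc (Suc a * Suc b - 1)" by (metis dvd_triv_left)
      then show "(\<lambda>(a, b). (Suc a * Suc b - 1, Suc a)) x \<in> (SIGMA n:UNIV. {d. d dvd Suc n})"
        unfolding x prod.case by blast
    qed
  qed auto
  ultimately have "((\<lambda>x. F ((\<lambda>(n, d). (d - 1, Suc n div d - 1)) x)) has_sum (mangoldt_series s * zeta s)) (SIGMA n:UNIV. {d. d dvd Suc n})"
    by (subst has_sum_reindex_bij_betw)
  moreover have "((\<lambda>d. F ((\<lambda>(n, d). (d - 1, Suc n div d - 1)) (n, d))) has_sum (of_real (ln (real (Suc n))) * npow n s)) {d. d dvd Suc n}" for n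
  proof (rule has_sum_finiteI)
    show "finite {d. d dvd Suc n}" by simp
    have "(\<Sum>d | d dvd Suc n. F ((\<lambda>(n, d). (d - 1, Suc n div d - 1)) (n, d))) = (\<Sum>d | d dvd Suc n. mangoldt d * npow n s)"
    proof (rule sum.cong[OF refl])
      fix d assume "d \<in> {d. d dvd Suc n}"
      then obtain e where e: "Suc n = d * e" by blast
      then have de: "d > 0" "e > 0" by (auto intro: Nat.gr0I)
      have "npow n s = npow (Suc (d - 1) * Suc (e - 1) - 1) s" using e de by (simp flip: e)
      also have "\<dots> = npow (d - 1) s * npow (e - 1) s" by (rule npow_mult)
      finally show "F ((\<lambda>(n, d). (d - 1, Suc n div d - 1)) (n, d)) = mangoldt d * npow n s"
        using de by (simp add: F_def e)
    qed
    also have "\<dots> = of_real (ln (real (Suc n))) * npow n s"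
      by (simp only: sum_distrib_right[symmetric]) (subst mangoldt_sum, auto)
    finally show "of_real (ln (real (Suc n))) * npow n s = (\<Sum>d | d dvd Suc n. F ((\<lambda>(n, d). (d - 1, Suc n div d - 1)) (n, d)))" ..
  qed
  ultimately have "((\<lambda>n. of_real (ln (real (Suc n))) * npow n s) has_sum (mangoldt_series s * zeta s)) UNIV"
    by (rule has_sum_SigmaD)
  then have "(\<lambda>n. of_real (ln (real (Suc n))) * npow n s) sums (mangoldt_series s * zeta s)"
    by (rule has_sum_imp_sums)
  then have "(\<lambda>n. - (of_real (ln (real (Suc n))) * npow n s)) sums (- (mangoldt_series s * zeta s))"
    by (rule sums_minus)
  then have "z' = - mangoldt_series s * zeta s"
    using z'(1) by (simp add: sums_iff)
  then show ?thesis using z'(2) by simp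
qed

section \<open>Continuation of \<open>(s - 1) * zeta s\<close>\<close>

lemma exp_ln_has_vector_derivative:
  fixes s :: complex
  assumes "t > 0"
  shows "((\<lambda>t. exp (s * of_real (ln t))) has_vector_derivative (s / of_real t * exp (s * of_real (ln t)))) (at t)"
proof -
  have "((\<lambda>t. s * of_real (ln t)) has_vector_derivative (s * of_real (1 / t))) (at t)"
    using assms by (auto intro!: derivative_eq_intros simp: has_real_derivative_iff_has_vector_derivative [symmetric] divide_inverse)
  from field_vector_diff_chain_at[OF this DERIV_exp]
  show ?thesis by (simp add: o_def mult_ac)
qed

lemma cmod_exp_ln: "t > 0 \<Longrightarrow> cmod (exp (s * of_real (ln t))) = t powr Re s"
  by (simp add: powr_def)

text \<open>The derivative of \<open>t\<close> to the power \<open>- s\<close> has modulus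
  \<open>cmod s * t powr (- Re s - 1)\<close>, which is largest at the left end.\<close>

lemma power_increment_bound:
  fixes a t :: real
  assumes a: "a \<ge> 1" and t: "a \<le> t" "t \<le> a + 1" and s: "Re s > 0"
  shows "cmod (exp (- s * of_real (ln t)) - exp (- s * of_real (ln a))) \<le> cmod s * a powr (- Re s - 1)"
proof (cases "a = t")
  case False
  then have at: "a < t" using t by simp
  have "cmod (exp (- s * of_real (ln t)) - exp (- s * of_real (ln a))) \<le>
    (cmod s * a powr (- Re s - 1)) * t - (cmod s * a powr (- Re s - 1)) * a"
  proof (rule differentiable_bound_general[OF at])
    fix x assume x: "a < x" "x < t"
    show "((\<lambda>t. exp (- s * of_real (ln t))) has_vector_derivative (- s / of_real x * exp (- s * of_real (ln x)))) (at x)"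
      using x a by (intro exp_ln_has_vector_derivative) auto
    show "((\<lambda>x. (cmod s * a powr (- Re s - 1)) * x) has_vector_derivative (cmod s * a powr (- Re s - 1))) (at x)"
      by (auto intro!: derivative_eq_intros simp: has_real_derivative_iff_has_vector_derivative [symmetric])
    have "cmod (- s / of_real x * exp (- s * of_real (ln x))) = cmod s * (x powr (- Re s) / x powr 1)"
      using x a cmod_exp_ln[of x "- s"] by (simp add: norm_mult norm_divide)
    also have "x powr (- Re s) / x powr 1 = x powr (- Re s - 1)" by (rule powr_diff[symmetric])
    also have "\<dots> \<le> a powr (- Re s - 1)" using x a s by (intro powr_mono2') auto
    finally show "cmod (- s / of_real x * exp (- s * of_real (ln x))) \<le> cmod s * a powr (- Re s - 1)"
      by (simp add: mult_left_mono)
  qed (use a in \<open>auto intro!: continuous_intros\<close>)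
  also have "\<dots> = (cmod s * a powr (- Re s - 1)) * (t - a)" by (simp add: algebra_simps)
  also have "\<dots> \<le> (cmod s * a powr (- Re s - 1)) * 1" using t by (intro mult_left_mono) auto
  finally show ?thesis by simp
qed simp

text \<open>Subtracting a telescoping series continues \<open>(s - 1) * zeta s\<close> to the right half-plane.\<close>

definition reg_term :: "nat \<Rightarrow> complex \<Rightarrow> complex" where
  "reg_term n s = (s - 1) * npow n s - (npow n (s - 1) - npow (Suc n) (s - 1))"

text \<open>The subtracted difference is the integral of \<open>s - 1\<close> times \<open>t\<close>
  to the power \<open>- s\<close> over the unit interval starting at \<open>a = n + 1\<close>. So
  the term integrates a difference of values of that power, bounded by
  \<open>power_increment_bound\<close>; the mean value inequality for the primitive \<open>f\<close>
  takes the place of the integral.\<close>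

lemma norm_reg_term:
  assumes s: "Re s > 0"
  shows "cmod (reg_term n s) \<le> cmod (s - 1) * cmod s * real (Suc n) powr (- Re s - 1)"
proof -
  define a where "a = real (Suc n)"
  have a: "a \<ge> 1" by (simp add: a_def)
  define f where "f = (\<lambda>t. (s - 1) * npow n s * of_real t + exp ((1 - s) * of_real (ln t)))"
  define B where "B = cmod (s - 1) * cmod s * a powr (- Re s - 1)"
  have na: "npow n s = exp (- s * of_real (ln a))" by (simp add: npow_def a_def)
  have "cmod (f (a + 1) - f a) \<le> B * (a + 1) - B * a"
  proof (rule differentiable_bound_general)
    fix t assume t: "a < t" "t < a + 1"
    then have t0: "t > 0" using a by simp
    have e: "exp ((1 - s) * of_real (ln t)) = of_real t * exp (- s * of_real (ln t))"
    proof -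
      have "exp ((1 - s) * of_real (ln t)) = exp (of_real (ln t)) * exp (- s * of_real (ln t))"
        by (simp add: exp_add [symmetric] algebra_simps)
      also have "exp (of_real (ln t)) = (of_real t :: complex)" using t0 exp_of_real[of "ln t", where 'a = complex] by simp
      finally show ?thesis .
    qed
    have "((\<lambda>t. (s - 1) * npow n s * of_real t) has_vector_derivative ((s - 1) * npow n s)) (at t)"
      by (auto intro!: derivative_eq_intros)
    then have "(f has_vector_derivative ((s - 1) * npow n s + (1 - s) / of_real t * exp ((1 - s) * of_real (ln t)))) (at t)"
      unfolding f_def by (intro has_vector_derivative_add exp_ln_has_vector_derivative t0)
    also have "(s - 1) * npow n s + (1 - s) / of_real t * exp ((1 - s) * of_real (ln t)) =
      - ((s - 1) * (exp (- s * of_real (ln t)) - exp (- s * of_real (ln a))))"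
    proof -
      have "(1 - s) / of_real t * (of_real t * exp (- s * of_real (ln t))) = (1 - s) * exp (- s * of_real (ln t))"
        using t0 by simp
      then show ?thesis unfolding e na by (simp add: algebra_simps)
    qed
    finally show "(f has_vector_derivative - ((s - 1) * (exp (- s * of_real (ln t)) - exp (- s * of_real (ln a))))) (at t)" .
    show "((*) B has_vector_derivative B) (at t)"
      by (auto intro!: derivative_eq_intros simp: has_real_derivative_iff_has_vector_derivative [symmetric])
    show "cmod (- ((s - 1) * (exp (- s * of_real (ln t)) - exp (- s * of_real (ln a))))) \<le> B"
      unfolding B_def norm_minus_cancel norm_mult mult.assoc
      using power_increment_bound[OF a _ _ s, of t] t by (intro mult_left_mono) auto
  qed (use a in \<open>auto simp: f_def intro!: continuous_intros\<close>)
  also have "f (a + 1) - f a = reg_term n s"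
    by (simp add: f_def reg_term_def npow_def a_def algebra_simps)
  finally show ?thesis by (simp add: B_def a_def algebra_simps)
qed

text \<open>The leading 1 restores the sum of the telescoping series that is subtracted in
  \<open>reg_term\<close>.\<close>

definition zeta_reg :: "complex \<Rightarrow> complex" where
  "zeta_reg s = 1 + (\<Sum>n. reg_term n s)"

lemma reg_term_holomorphic: "reg_term n holomorphic_on A"
  unfolding reg_term_def npow_def by (auto intro!: holomorphic_intros)

lemma zeta_reg_holomorphic: "zeta_reg holomorphic_on {s. Re s > 0}"
proof -
  define H where "H = {s. Re s > 0}"
  have H: "open H" unfolding H_def by (rule open_halfspace_Re_gt)
  have "\<exists>g g'. \<forall>s \<in> H. ((\<lambda>n. reg_term n s) sums g s) \<and>
      ((\<lambda>n. deriv (reg_term n) s) sums g' s) \<and> (g has_field_derivative g' s) (at s)"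
  proof (rule series_and_derivative_comparison_local[OF H])
    fix n s assume "s \<in> H"
    then show "(reg_term n has_field_derivative deriv (reg_term n) s) (at s)"
      using reg_term_holomorphic[of n UNIV] holomorphic_derivI[of "reg_term n" UNIV s] by simp
  next
    fix s assume s: "s \<in> H"
    define d where "d = Re s / 2"
    define M where "M = cmod s + d + 1"
    have d: "d > 0" using s by (simp add: d_def H_def)
    have "cmod (reg_term n t) \<le> M * M * real (Suc n) powr (- (1 + d))" if t: "t \<in> ball s d \<inter> H" for n t
    proof -
      have st: "cmod (s - t) < d" using t by (simp add: dist_norm)
      then have "\<bar>Re (s - t)\<bar> < d" using abs_Re_le_cmod[of "s - t"] by simp
      then have "Re s - Re t < d" by (auto simp: abs_less_iff)
      then have Re: "Re t \<ge> d" by (simp add: d_def field_simps)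
      have "cmod t \<le> cmod s + cmod (s - t)" by (metis norm_triangle_sub norm_minus_commute)
      then have 1: "cmod t \<le> M" using st by (simp add: M_def)
      have "cmod (t - 1) \<le> cmod t + 1" using norm_triangle_ineq4[of t 1] by simp
      then have 2: "cmod (t - 1) \<le> M" using st \<open>cmod t \<le> cmod s + cmod (s - t)\<close> by (simp add: M_def)
      have "cmod (reg_term n t) \<le> cmod (t - 1) * cmod t * real (Suc n) powr (- Re t - 1)"
        using t by (intro norm_reg_term) (auto simp: H_def)
      also have "\<dots> \<le> M * M * real (Suc n) powr (- (1 + d))"
        using 1 2 Re by (intro mult_mono powr_mono) (auto intro: order_trans[OF norm_ge_zero])
      finally show ?thesis .
    qed
    then show "\<exists>d h. 0 < d \<and> summable h \<and> (\<forall>\<^sub>F n in sequentially. \<forall>t\<in>ball s d \<inter> H. cmod (reg_term n t) \<le> h n)"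
      using d summable_mult[OF summable_Suc_powr[of "1 + d"], of "M * M"]
      by (intro exI[of _ d] exI[of _ "\<lambda>n. M * M * real (Suc n) powr (- (1 + d))"]) auto
  qed
  then obtain g g' where g: "\<And>s. s \<in> H \<Longrightarrow> ((\<lambda>n. reg_term n s) sums g s) \<and> (g has_field_derivative g' s) (at s)" by blast
  then have "g holomorphic_on H" using H by (auto simp: holomorphic_on_open)
  then have "(\<lambda>s. 1 + g s) holomorphic_on H" by (intro holomorphic_intros)
  then have "zeta_reg holomorphic_on H"
    by (rule holomorphic_transform) (use g in \<open>auto simp: zeta_reg_def sums_iff\<close>)
  then show ?thesis by (simp add: H_def)
qed

lemma zeta_reg_eq:
  assumes s: "Re s > 1"
  shows "zeta_reg s = (s - 1) * zeta s"
proof -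
  have lim: "(\<lambda>n. npow n (s - 1)) \<longlonglongrightarrow> 0"
  proof (rule tendsto_norm_zero_cancel)
    have "(\<lambda>n. real (Suc n) powr (- (Re s - 1))) \<longlonglongrightarrow> 0" using s by real_asymp
    then show "(\<lambda>n. cmod (npow n (s - 1))) \<longlonglongrightarrow> 0" by (simp add: norm_npow)
  qed
  have "(\<lambda>n. npow n (s - 1) - npow (Suc n) (s - 1)) sums (npow 0 (s - 1) - 0)"
    by (rule telescope_sums'[OF lim])
  then have "(\<lambda>n. (s - 1) * npow n s - (npow n (s - 1) - npow (Suc n) (s - 1))) sums ((s - 1) * zeta s - (npow 0 (s - 1) - 0))"
    by (rule sums_diff[OF sums_mult[OF zeta_sums_and_derivative(1)[OF s]]])
  then have "(\<lambda>n. reg_term n s) sums ((s - 1) * zeta s - 1)"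
    by (simp add: reg_term_def npow_def)
  then show ?thesis by (simp add: zeta_reg_def sums_iff)
qed

lemma zeta_reg_1: "zeta_reg 1 = 1"
proof -
  have "reg_term n 1 = 0" for n by (simp add: reg_term_def npow_def)
  then show ?thesis by (simp add: zeta_reg_def)
qed

lemma deriv_zeta_reg:
  assumes s: "Re s > 1"
  shows "deriv zeta_reg s = zeta s - (s - 1) * (mangoldt_series s * zeta s)"
proof (rule DERIV_imp_deriv)
  have "((\<lambda>s. (s - 1) * zeta s) has_field_derivative (zeta s - (s - 1) * (mangoldt_series s * zeta s))) (at s)"
    by (rule derivative_eq_intros zeta_derivative_eq s refl)+ (simp add: algebra_simps)
  then show "(zeta_reg has_field_derivative (zeta s - (s - 1) * (mangoldt_series s * zeta s))) (at s)"
    by (rule has_field_derivative_transform_within_open[where S = "{s. Re s > 1}"])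
       (use s in \<open>auto simp: zeta_reg_eq open_halfspace_Re_gt\<close>)
qed

lemma log_deriv_zeta_reg:
  assumes s: "Re s > 1" and nz: "zeta_reg s \<noteq> 0"
  shows "deriv zeta_reg s / zeta_reg s = 1 / (s - 1) - mangoldt_series s"
proof -
  have "s \<noteq> 1" "zeta s \<noteq> 0" using s nz zeta_reg_eq[OF s] by auto
  then show ?thesis unfolding deriv_zeta_reg[OF s] zeta_reg_eq[OF s] by (simp add: field_simps)
qed

section \<open>Nonvanishing on the line of real part one\<close>

text \<open>\<open>m\<close> is the multiplicity of \<open>s0\<close> as a zero. Writing the
  function near \<open>s0\<close> as \<open>p w * (w - s0) ^ m\<close>, its logarithmic derivative
  is \<open>m / (w - s0)\<close> plus a term bounded near \<open>s0\<close>. The approach is from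
  the right, where the Dirichlet series can be used.\<close>

lemma zeta_reg_order:
  assumes s0: "Re s0 > 0"
  obtains m :: nat where "m > 0 \<longleftrightarrow> zeta_reg s0 = 0"
    "((\<lambda>x. of_real x * (deriv zeta_reg (s0 + of_real x) / zeta_reg (s0 + of_real x))) \<longlongrightarrow> of_nat m) (at_right 0)"
    "\<forall>\<^sub>F x in at_right 0. zeta_reg (s0 + of_real x) \<noteq> 0"
proof -
  define H where "H = {s. Re s > 0}"
  have H: "open H" "connected H" "s0 \<in> H" unfolding H_def using s0
    by (auto intro: open_halfspace_Re_gt convex_connected convex_halfspace_Re_gt)
  have "\<exists>w\<in>H. zeta_reg w \<noteq> 0" using zeta_reg_1 by (intro bexI[of _ 1]) (auto simp: H_def)
  from zorder_exist_zero[OF zeta_reg_holomorphic[folded H_def] H this]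
  obtain r where zn: "if zeta_reg s0 = 0 then zorder zeta_reg s0 > 0 else zorder zeta_reg s0 = 0"
    and r: "r > 0" "cball s0 r \<subseteq> H" "zor_poly zeta_reg s0 holomorphic_on cball s0 r"
      "\<And>w. w \<in> cball s0 r \<Longrightarrow> zeta_reg w = zor_poly zeta_reg s0 w * (w - s0) ^ nat (zorder zeta_reg s0) \<and> zor_poly zeta_reg s0 w \<noteq> 0"
    by blast
  define m where "m = nat (zorder zeta_reg s0)"
  define p where "p = zor_poly zeta_reg s0"
  have p: "p holomorphic_on ball s0 r" unfolding p_def using r(3) by (rule holomorphic_on_subset) auto
  have fac: "zeta_reg w = p w * (w - s0) ^ m" "p w \<noteq> 0" if "w \<in> ball s0 r" for w
    using r(4)[of w] that by (auto simp: p_def m_def)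
  have ev: "\<forall>\<^sub>F x in at_right 0. x \<in> {0<..<r}" using r(1) by (rule eventually_at_right_real)
  have eq: "of_real x * (deriv zeta_reg (s0 + of_real x) / zeta_reg (s0 + of_real x)) =
      of_nat m + of_real x * (deriv p (s0 + of_real x) / p (s0 + of_real x))" if x: "x \<in> {0<..<r}" for x
  proof -
    define w where "w = s0 + of_real x"
    have w: "w \<in> ball s0 r" using x by (simp add: w_def dist_norm)
    have ws: "w - s0 = of_real x" "(of_real x :: complex) \<noteq> 0" using x by (auto simp: w_def)
    have dp: "(p has_field_derivative deriv p w) (at w)" using p w by (intro holomorphic_derivI) auto
    have "((\<lambda>w. p w * (w - s0) ^ m) has_field_derivative (deriv p w * (w - s0) ^ m + p w * (of_nat m * (w - s0) ^ (m - 1)))) (at w)"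
      by (rule derivative_eq_intros dp refl)+ (simp add: algebra_simps)
    then have "(zeta_reg has_field_derivative (deriv p w * (w - s0) ^ m + p w * (of_nat m * (w - s0) ^ (m - 1)))) (at w)"
      by (rule has_field_derivative_transform_within_open[where S = "ball s0 r"]) (use w fac in auto)
    then have "deriv zeta_reg w = deriv p w * (w - s0) ^ m + p w * (of_nat m * (w - s0) ^ (m - 1))"
      by (rule DERIV_imp_deriv)
    moreover have "of_real x * (of_nat m * (w - s0) ^ (m - 1)) = of_nat m * (w - s0) ^ m"
      unfolding ws by (cases m) auto
    ultimately have "of_real x * deriv zeta_reg w = (of_nat m + of_real x * (deriv p w / p w)) * zeta_reg w"
      using fac[OF w] by (simp add: algebra_simps)
    moreover have "zeta_reg w \<noteq> 0" using fac[OF w] ws by simp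
    ultimately show ?thesis unfolding w_def[symmetric] by (simp add: field_simps)
  qed
  show ?thesis
  proof
    show "m > 0 \<longleftrightarrow> zeta_reg s0 = 0" using zn by (auto simp: m_def split: if_splits)
    have "isCont (\<lambda>w. deriv p w / p w) s0"
      using p fac r(1) by (intro continuous_intros holomorphic_on_imp_continuous_on
         continuous_on_interior[of "ball s0 r"] continuous_on_divide holomorphic_deriv) (auto simp: interior_open intro!: holomorphic_on_imp_continuous_on holomorphic_deriv continuous_on_interior[of "ball s0 r"])
    moreover have "((\<lambda>x. s0 + of_real x) \<longlongrightarrow> s0 + of_real 0) (at_right 0)" by (intro tendsto_intros)
    ultimately have "((\<lambda>x. deriv p (s0 + of_real x) / p (s0 + of_real x)) \<longlongrightarrow> deriv p s0 / p s0) (at_right 0)"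
      using isCont_tendsto_compose[of s0 "\<lambda>w. deriv p w / p w"] by simp
    then have "((\<lambda>x. of_nat m + of_real x * (deriv p (s0 + of_real x) / p (s0 + of_real x))) \<longlongrightarrow> of_nat m + of_real 0 * (deriv p s0 / p s0)) (at_right 0)"
      by (rule tendsto_add[OF tendsto_const tendsto_mult[OF tendsto_of_real[OF tendsto_ident_at]]])
    then have "((\<lambda>x. of_nat m + of_real x * (deriv p (s0 + of_real x) / p (s0 + of_real x))) \<longlongrightarrow> of_nat m) (at_right 0)" by simp
    then show "((\<lambda>x. of_real x * (deriv zeta_reg (s0 + of_real x) / zeta_reg (s0 + of_real x))) \<longlongrightarrow> of_nat m) (at_right 0)"
      by (rule Lim_transform_eventually) (use ev eq in \<open>auto elim!: eventually_mono\<close>)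
    show "\<forall>\<^sub>F x in at_right 0. zeta_reg (s0 + of_real x) \<noteq> 0"
      using ev
    proof eventually_elim
      case (elim x)
      then have "s0 + of_real x \<in> ball s0 r" by (simp add: dist_norm)
      from fac[OF this] show ?case using elim by simp
    qed
  qed
qed

text \<open>For real part above one, \<open>mangoldt_series\<close> is \<open>1 / (s - 1)\<close>
  minus the logarithmic derivative of \<open>zeta_reg\<close>: the pole at 1 counts 1, a zero of
  order \<open>m\<close> counts \<open>- m\<close>.\<close>

lemma mangoldt_series_order:
  assumes "Re s0 \<ge> 1"
  obtains m :: nat where "m > 0 \<longleftrightarrow> zeta_reg s0 = 0"
    "((\<lambda>x. of_real x * mangoldt_series (s0 + of_real x)) \<longlongrightarrow> of_bool (s0 = 1) - of_nat m) (at_right 0)"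
proof -
  have s0: "Re s0 > 0" using assms by simp
  obtain m where m: "m > 0 \<longleftrightarrow> zeta_reg s0 = 0"
    "((\<lambda>x. of_real x * (deriv zeta_reg (s0 + of_real x) / zeta_reg (s0 + of_real x))) \<longlongrightarrow> of_nat m) (at_right 0)"
    "\<forall>\<^sub>F x in at_right 0. zeta_reg (s0 + of_real x) \<noteq> 0"
    using zeta_reg_order[OF s0] by blast
  have "((\<lambda>x. of_real x / (s0 + of_real x - 1)) \<longlongrightarrow> of_bool (s0 = 1)) (at_right 0)"
  proof (cases "s0 = 1")
    case True
    have "\<forall>\<^sub>F x in at_right (0::real). of_real x / (s0 + of_real x - 1) = (1 :: complex)"
      using eventually_at_right_less[of "0::real"] by eventually_elim (simp add: True)
    then show ?thesis using True by (simp add: tendsto_eventually)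
  next
    case False
    then have "((\<lambda>x. of_real x / (s0 + of_real x - 1)) \<longlongrightarrow> of_real 0 / (s0 + of_real 0 - 1)) (at_right 0)"
      by (intro tendsto_intros) auto
    then show ?thesis using False by simp
  qed
  then have "((\<lambda>x. of_real x / (s0 + of_real x - 1) - of_real x * (deriv zeta_reg (s0 + of_real x) / zeta_reg (s0 + of_real x))) \<longlongrightarrow> of_bool (s0 = 1) - of_nat m) (at_right 0)"
    by (intro tendsto_diff m)
  moreover have "\<forall>\<^sub>F x in at_right 0. of_real x / (s0 + of_real x - 1) - of_real x * (deriv zeta_reg (s0 + of_real x) / zeta_reg (s0 + of_real x))
      = of_real x * mangoldt_series (s0 + of_real x)"
    using m(3) eventually_at_right_less[of "0::real"]
  proof eventually_elim
    case (elim x)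
    have "Re (s0 + of_real x) > 1" using assms elim by simp
    from log_deriv_zeta_reg[OF this elim(1)]
    have "mangoldt_series (s0 + of_real x) = 1 / (s0 + of_real x - 1) - deriv zeta_reg (s0 + of_real x) / zeta_reg (s0 + of_real x)"
      by simp
    then show ?case by (simp add: right_diff_distrib)
  qed
  ultimately have "((\<lambda>x. of_real x * mangoldt_series (s0 + of_real x)) \<longlongrightarrow> of_bool (s0 = 1) - of_nat m) (at_right 0)"
    by (rule Lim_transform_eventually)
  then show ?thesis using that m(1) by blast
qed

lemma Re_npow: "Re (npow n (of_real \<sigma> + \<i> * of_real t)) = real (Suc n) powr (- \<sigma>) * cos (t * ln (real (Suc n)))"
  unfolding npow_def by (simp add: Re_exp powr_def algebra_simps)

lemma three_four_one: "3 + 4 * cos \<theta> + cos (2 * \<theta>) \<ge> (0::real)"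
proof -
  have "3 + 4 * cos \<theta> + cos (2 * \<theta>) = 2 * (1 + cos \<theta>)\<^sup>2"
    unfolding cos_double_cos by (simp add: power2_eq_square algebra_simps)
  then show ?thesis by simp
qed

text \<open>Termwise this is \<open>three_four_one\<close> with the nonnegative weights
  \<open>mangoldt (Suc n) * real (Suc n) powr (- \<sigma>)\<close>.\<close>

lemma mangoldt_series_341:
  assumes "\<sigma> > 1"
  shows "3 * Re (mangoldt_series (of_real \<sigma>)) + 4 * Re (mangoldt_series (of_real \<sigma> + \<i> * of_real t)) + Re (mangoldt_series (of_real \<sigma> + \<i> * of_real (2 * t))) \<ge> 0"
proof -
  have s: "(\<lambda>n. mangoldt (Suc n) * (real (Suc n) powr (- \<sigma>) * cos (t * ln (real (Suc n))))) sums Re (mangoldt_series (of_real \<sigma> + \<i> * of_real t))" for t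
  proof -
    have "(\<lambda>n. Re (mangoldt (Suc n) * npow n (of_real \<sigma> + \<i> * of_real t))) sums Re (mangoldt_series (of_real \<sigma> + \<i> * of_real t))"
      using assms by (intro sums_Re mangoldt_series_sums) auto
    then show ?thesis by (simp add: Re_npow)
  qed
  have s0: "(\<lambda>n. mangoldt (Suc n) * real (Suc n) powr (- \<sigma>)) sums Re (mangoldt_series (of_real \<sigma>))"
    using s[of 0] by simp
  have "(\<lambda>n. 3 * (mangoldt (Suc n) * real (Suc n) powr (- \<sigma>)) + 4 * (mangoldt (Suc n) * (real (Suc n) powr (- \<sigma>) * cos (t * ln (real (Suc n)))))
     + mangoldt (Suc n) * (real (Suc n) powr (- \<sigma>) * cos (2 * t * ln (real (Suc n))))) sums
    (3 * Re (mangoldt_series (of_real \<sigma>)) + 4 * Re (mangoldt_series (of_real \<sigma> + \<i> * of_real t)) + Re (mangoldt_series (of_real \<sigma> + \<i> * of_real (2 * t))))"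
    by (intro sums_add sums_mult s0 s)
  then show ?thesis
  proof (rule sums_le[OF _ sums_zero, rotated])
    fix n
    have "0 \<le> (mangoldt (Suc n) * real (Suc n) powr (- \<sigma>)) * (3 + 4 * cos (t * ln (real (Suc n))) + cos (2 * (t * ln (real (Suc n)))))"
      by (intro mult_nonneg_nonneg three_four_one mangoldt_nonneg) auto
    then show "0 \<le> 3 * (mangoldt (Suc n) * real (Suc n) powr (- \<sigma>)) + 4 * (mangoldt (Suc n) * (real (Suc n) powr (- \<sigma>) * cos (t * ln (real (Suc n)))))
     + mangoldt (Suc n) * (real (Suc n) powr (- \<sigma>) * cos (2 * t * ln (real (Suc n))))"
      by (simp add: algebra_simps)
  qed
qed

text \<open>To the right of the line \<open>mangoldt_series\<close> stays bounded, which forces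
  order 0. On the line, multiply \<open>mangoldt_series_341\<close> by \<open>x\<close> and let
  \<open>x\<close> tend to 0: with orders \<open>m1\<close>, \<open>m\<close>, \<open>m2\<close> at
  \<open>1\<close>, \<open>1 + i t\<close>, \<open>1 + 2 i t\<close> this gives
  \<open>3 - 3 * m1 - 4 * m - m2 \<ge> 0\<close>, so \<open>m = 0\<close>.\<close>

lemma zeta_reg_nonzero:
  assumes "Re s \<ge> 1"
  shows "zeta_reg s \<noteq> 0"
proof (cases "s = 1")
  case True
  then show ?thesis by (simp add: zeta_reg_1)
next
  case s1: False
  obtain m where m: "m > 0 \<longleftrightarrow> zeta_reg s = 0"
    "((\<lambda>x. of_real x * mangoldt_series (s + of_real x)) \<longlongrightarrow> of_bool (s = 1) - of_nat m) (at_right 0)"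
    using mangoldt_series_order[OF assms] by blast
  then have ms: "((\<lambda>x. of_real x * mangoldt_series (s + of_real x)) \<longlongrightarrow> - of_nat m) (at_right 0)" using s1 by simp
  have "m = 0"
  proof (cases "Re s > 1")
    case True
    define B where "B = (\<Sum>n. mangoldt (Suc n) * real (Suc n) powr (- Re s))"
    have bd: "cmod (mangoldt_series (s + of_real x)) \<le> B" if "x > 0" for x
    proof -
      have sm: "summable (\<lambda>n. cmod (mangoldt (Suc n) * npow n (s + of_real x)))"
        unfolding norm_mangoldt_npow by (rule summable_mangoldt_powr) (use that True in simp)
      have "cmod (mangoldt_series (s + of_real x)) \<le> (\<Sum>n. cmod (mangoldt (Suc n) * npow n (s + of_real x)))"
        unfolding mangoldt_series_def by (rule summable_norm[OF sm])
      also have "\<dots> \<le> B" unfolding B_def norm_mangoldt_npow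
        using that True by (intro suminf_le mult_left_mono powr_mono summable_mangoldt_powr mangoldt_nonneg) auto
      finally show ?thesis .
    qed
    have ev: "\<forall>\<^sub>F x in at_right 0. cmod (of_real x * mangoldt_series (s + of_real x)) \<le> x * B"
      using eventually_at_right_less[of "0::real"]
    proof eventually_elim
      case (elim x)
      have "cmod (of_real x) * cmod (mangoldt_series (s + of_real x)) \<le> x * B"
        using elim bd[OF elim] by (intro mult_mono) auto
      then show ?case by (simp only: norm_mult)
    qed
    have "((\<lambda>x. x * B) \<longlongrightarrow> 0 * B) (at_right 0)" by (intro tendsto_intros)
    then have "((\<lambda>x. of_real x * mangoldt_series (s + of_real x)) \<longlongrightarrow> 0) (at_right 0)"
      by (intro Lim_null_comparison[OF ev]) simp
    from tendsto_unique[OF _ ms this] show ?thesis by simp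
  next
    case False
    define t where "t = Im s"
    have s: "s = 1 + \<i> * of_real t" using False assms by (simp add: complex_eq_iff t_def)
    have t0: "t \<noteq> 0" using s1 s by auto
    obtain m1 where m1: "((\<lambda>x. of_real x * mangoldt_series (1 + of_real x)) \<longlongrightarrow> of_bool (1 = (1::complex)) - of_nat m1) (at_right 0)"
      using mangoldt_series_order[of 1] by auto
    obtain m2 where m2: "((\<lambda>x. of_real x * mangoldt_series ((1 + \<i> * of_real (2 * t)) + of_real x)) \<longlongrightarrow> of_bool (1 + \<i> * of_real (2 * t) = 1) - of_nat m2) (at_right 0)"
      using mangoldt_series_order[of "1 + \<i> * of_real (2 * t)"] by auto
    have "((\<lambda>x. 3 * Re (of_real x * mangoldt_series (1 + of_real x)) + 4 * Re (of_real x * mangoldt_series (s + of_real x)) +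
       Re (of_real x * mangoldt_series ((1 + \<i> * of_real (2 * t)) + of_real x))) \<longlongrightarrow>
       3 * Re (of_bool (1 = (1::complex)) - of_nat m1) + 4 * Re (- of_nat m) + Re (of_bool (1 + \<i> * of_real (2 * t) = 1) - of_nat m2)) (at_right 0)"
      by (intro tendsto_intros m1 ms m2)
    moreover have "\<forall>\<^sub>F x in at_right 0. 3 * Re (of_real x * mangoldt_series (1 + of_real x)) + 4 * Re (of_real x * mangoldt_series (s + of_real x)) +
       Re (of_real x * mangoldt_series ((1 + \<i> * of_real (2 * t)) + of_real x)) \<ge> 0"
      using eventually_at_right_less[of "0::real"]
    proof eventually_elim
      case (elim x)
      have "0 \<le> x * (3 * Re (mangoldt_series (of_real (1 + x))) + 4 * Re (mangoldt_series (of_real (1 + x) + \<i> * of_real t)) + Re (mangoldt_series (of_real (1 + x) + \<i> * of_real (2 * t))))"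
        using elim by (intro mult_nonneg_nonneg mangoldt_series_341) auto
      moreover have "of_real (1 + x) + \<i> * of_real t = s + of_real x" "of_real (1 + x) + \<i> * of_real (2 * t) = (1 + \<i> * of_real (2 * t)) + of_real x"
        "of_real (1 + x) = 1 + (of_real x :: complex)"
        unfolding s by simp_all
      ultimately have "0 \<le> x * (3 * Re (mangoldt_series (1 + of_real x)) + 4 * Re (mangoldt_series (s + of_real x)) + Re (mangoldt_series ((1 + \<i> * of_real (2 * t)) + of_real x)))"
        by metis
      moreover have "Re (of_real x * w) = x * Re w" for w by simp
      ultimately show ?case by (simp only: distrib_left mult.left_commute[of x])
    qed
    ultimately have "0 \<le> 3 * Re (of_bool (1 = (1::complex)) - of_nat m1) + 4 * Re (- of_nat m) + Re (of_bool (1 + \<i> * of_real (2 * t) = 1) - of_nat m2)"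
      by (intro tendsto_lowerbound[of _ _ "at_right (0::real)"]) auto
    then have "0 \<le> 3 - 3 * real m1 - 4 * real m - real m2" using t0 by simp
    then have "4 * m \<le> 3" by linarith
    then show ?thesis by simp
  qed
  then show ?thesis using m(1) by simp
qed

section \<open>Newman's Tauberian theorem\<close>

lemma path_image_right_half_circle:
  assumes "z \<in> path_image (part_circlepath 0 R (- pi / 2) (pi / 2))" "R > 0"
  shows "cmod z = R" "Re z \<ge> 0"
proof -
  show "cmod z = R" using in_path_image_part_circlepath[of z 0 R "- pi / 2" "pi / 2"] assms by simp
  obtain \<theta> where "z = of_real R * exp (\<i> * of_real \<theta>)" "- pi / 2 \<le> \<theta>" "\<theta> \<le> pi / 2"
    using assms by (auto simp: path_image_part_circlepath)
  then show "Re z \<ge> 0" using assms(2) by (auto simp: Re_exp intro!: mult_nonneg_nonneg cos_ge_zero)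
qed

lemma path_image_left_half_circle:
  assumes "z \<in> path_image (part_circlepath 0 R (pi / 2) (3 * pi / 2))" "R > 0"
  shows "cmod z = R" "Re z \<le> 0"
proof -
  show "cmod z = R" using in_path_image_part_circlepath[of z 0 R "pi / 2" "3 * pi / 2"] assms by simp
  obtain \<theta> where \<theta>: "z = of_real R * exp (\<i> * of_real \<theta>)" "pi / 2 \<le> \<theta>" "\<theta> \<le> 3 * pi / 2"
    using assms by (auto simp: path_image_part_circlepath)
  have "cos \<theta> = - cos (\<theta> - pi)" by (simp add: cos_diff)
  moreover have "cos (\<theta> - pi) \<ge> 0" using \<theta> by (intro cos_ge_zero) auto
  ultimately have "cos \<theta> \<le> 0" by simp
  then show "Re z \<le> 0" using assms(2) \<theta>(1) by (simp add: Re_exp mult_nonneg_nonpos)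
qed

lemma exp_half_pi: "exp (\<i> * of_real (pi / 2)) = \<i>" "exp (\<i> * of_real (- pi / 2)) = - \<i>" "exp (\<i> * of_real (3 * pi / 2)) = - \<i>"
proof -
  have c: "cos (3 * pi / 2) = 0" "sin (3 * pi / 2) = -1"
    using cos_pi_minus[of "- (pi / 2)"] sin_pi_minus[of "- (pi / 2)"] by (simp_all add: algebra_simps)
  show "exp (\<i> * of_real (pi / 2)) = \<i>" "exp (\<i> * of_real (- pi / 2)) = - \<i>" "exp (\<i> * of_real (3 * pi / 2)) = - \<i>"
    using c by (simp_all add: complex_eq_iff Re_exp Im_exp)
qed

text \<open>Cauchy's formula at 0 for a contour closed by an arbitrary left path \<open>L\<close>.
  Instead of a winding number, \<open>f z / z\<close> is split into a holomorphic part, whose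
  integral vanishes, and \<open>f 0 / z\<close>, which has a logarithm as primitive on each
  half.\<close>

lemma Cauchy_half_contours:
  fixes f :: "complex \<Rightarrow> complex"
  assumes R: "R > 0" and V: "convex V" "open V" "f holomorphic_on V" "0 \<in> V"
    and A: "path_image (part_circlepath 0 R (- pi / 2) (pi / 2)) \<subseteq> V"
    and L: "valid_path L" "pathstart L = \<i> * R" "pathfinish L = - \<i> * R"
      "path_image L \<subseteq> V" "\<And>z. z \<in> path_image L \<Longrightarrow> \<not> (Im z = 0 \<and> Re z \<ge> 0)"
  shows "contour_integral (part_circlepath 0 R (- pi / 2) (pi / 2)) (\<lambda>z. f z / z) + contour_integral L (\<lambda>z. f z / z) = 2 * pi * \<i> * f 0"
proof -
  define A where "A = part_circlepath 0 R (- pi / 2) (pi / 2)"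
  have Ase: "pathstart A = - \<i> * R" "pathfinish A = \<i> * R" "valid_path A"
    unfolding A_def pathstart_part_circlepath pathfinish_part_circlepath exp_half_pi by auto
  have AV: "path_image A \<subseteq> V" unfolding A_def by (rule A)
  \<comment> \<open>The difference quotient with its removable singularity filled in.\<close>
  define q where "q = (\<lambda>z. if z = 0 then deriv f 0 else (f z - f 0) / (z - 0))"
  have q: "q holomorphic_on V" unfolding q_def by (rule pole_lemma_open) (use V in auto)
  have qA: "q contour_integrable_on A" and qL: "q contour_integrable_on L"
    using q V A L Ase unfolding A_def by (auto intro: contour_integrable_holomorphic_simple)
  have "(q has_contour_integral 0) (A +++ L)"
    by (rule Cauchy_theorem_convex_simple[OF q V(1)]) (use Ase L AV in \<open>auto simp: path_image_join\<close>)
  then have 0: "contour_integral A q + contour_integral L q = 0"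
    using contour_integral_join[OF qA qL Ase(3) L(1)] contour_integral_unique by metis
  \<comment> \<open>The right arc avoids the cut of \<open>Ln\<close>, and \<open>L\<close> avoids
    that of \<open>Ln (- z)\<close>; each half contributes \<open>\<i> * pi\<close>.\<close>
  have A1: "((\<lambda>z. 1 / z) has_contour_integral (Ln (pathfinish A) - Ln (pathstart A))) A"
  proof (rule contour_integral_primitive)
    fix z assume z: "z \<in> path_image A"
    then have "z \<notin> \<real>\<^sub>\<le>\<^sub>0" using path_image_right_half_circle[of z R] R
      by (auto simp: A_def complex_nonpos_Reals_iff complex_eq_iff cmod_def)
    then show "(Ln has_field_derivative 1 / z) (at z within path_image A)"
      using has_field_derivative_Ln[of z] by (auto simp: inverse_eq_divide intro: has_field_derivative_at_within)
  qed (use Ase in auto)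
  have L1: "((\<lambda>z. 1 / z) has_contour_integral (Ln (- pathfinish L) - Ln (- pathstart L))) L"
  proof (rule contour_integral_primitive[where f = "\<lambda>z. Ln (- z)"])
    fix z assume z: "z \<in> path_image L"
    then have "- z \<notin> \<real>\<^sub>\<le>\<^sub>0" using L(5)[OF z] by (auto simp: complex_nonpos_Reals_iff)
    then have "((\<lambda>z. Ln (- z)) has_field_derivative inverse (- z) * (- 1)) (at z within path_image L)"
      by (intro DERIV_chain2[where f = Ln] has_field_derivative_Ln) (auto intro!: derivative_eq_intros)
    then show "((\<lambda>z. Ln (- z)) has_field_derivative 1 / z) (at z within path_image L)"
      by (simp add: inverse_eq_divide)
  qed (use L in auto)
  have ln: "Ln (\<i> * of_real R) = Ln R + \<i> * (pi / 2)" "Ln (- (\<i> * of_real R)) = Ln R - \<i> * (pi / 2)"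
  proof -
    have "Ln (of_real R * \<i>) = Ln R + Ln \<i>" using R by (intro Ln_times_of_real) auto
    then show "Ln (\<i> * of_real R) = Ln R + \<i> * (pi / 2)" using R by (simp add: mult.commute Ln_of_real)
    have "Ln (of_real R * (- \<i>)) = Ln R + Ln (- \<i>)" using R by (intro Ln_times_of_real) auto
    then show "Ln (- (\<i> * of_real R)) = Ln R - \<i> * (pi / 2)" using R by (simp add: mult.commute Ln_of_real)
  qed
  have A2: "((\<lambda>z. 1 / z) has_contour_integral (\<i> * pi)) A"
    using A1 unfolding Ase by (simp add: ln)
  have L2: "((\<lambda>z. 1 / z) has_contour_integral (\<i> * pi)) L"
    using L1 unfolding L by (simp add: ln)
  have nz: "z \<noteq> 0" if "z \<in> path_image A \<union> path_image L" for z
    using that path_image_right_half_circle[of z R] R L(5)[of z] by (auto simp: A_def)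
  have cA: "((\<lambda>z. f z / z) has_contour_integral (contour_integral A q + f 0 * (\<i> * pi))) A"
  proof (rule has_contour_integral_eq[OF has_contour_integral_add[OF has_contour_integral_integral[OF qA] has_contour_integral_lmul[OF A2, of "f 0"]]])
    fix z assume "z \<in> path_image A"
    then show "q z + f 0 * (1 / z) = f z / z" using nz by (simp add: q_def diff_divide_distrib)
  qed
  have cL: "((\<lambda>z. f z / z) has_contour_integral (contour_integral L q + f 0 * (\<i> * pi))) L"
  proof (rule has_contour_integral_eq[OF has_contour_integral_add[OF has_contour_integral_integral[OF qL] has_contour_integral_lmul[OF L2, of "f 0"]]])
    fix z assume "z \<in> path_image L"
    then show "q z + f 0 * (1 / z) = f z / z" using nz by (simp add: q_def diff_divide_distrib)
  qed
  show ?thesis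
    unfolding A_def[symmetric] contour_integral_unique[OF cA] contour_integral_unique[OF cL]
    using 0 by (simp add: algebra_simps)
qed

text \<open>Newman's kernel. It is 1 at 0, its exponential factor balances the powers of
  \<open>M\<close> in the tail bounds, and its second factor vanishes at \<open>z = \<i> * R\<close>
  and \<open>z = - \<i> * R\<close>, which tames their \<open>1 / Re z\<close>.\<close>

definition newman_kernel :: "real \<Rightarrow> real \<Rightarrow> complex \<Rightarrow> complex" where
  "newman_kernel R M z = exp (z * of_real (ln M)) * (1 + z\<^sup>2 / (of_real R)\<^sup>2)"

lemma newman_kernel_holomorphic: "newman_kernel R M holomorphic_on A"
  unfolding newman_kernel_def by (auto intro!: holomorphic_intros)

text \<open>On the circle \<open>R^2 = z * cnj z\<close>, so \<open>(1 + z^2 / R^2) / z\<close> is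
  the real number \<open>2 * Re z / R^2\<close>.\<close>

lemma norm_newman_kernel_circle:
  assumes "cmod z = R" "R > 0" "M > 0"
  shows "cmod (newman_kernel R M z / z) = M powr Re z * (2 * \<bar>Re z\<bar> / R\<^sup>2)"
proof -
  have nz: "z \<noteq> 0" "(of_real R :: complex) \<noteq> 0" using assms by auto
  have zz: "(of_real R)\<^sup>2 = z * cnj z" using complex_norm_square[of z] assms by simp
  have "(1 + z\<^sup>2 / (of_real R)\<^sup>2) / z = ((of_real R)\<^sup>2 + z\<^sup>2) / ((of_real R)\<^sup>2 * z)"
    using nz by (simp add: field_simps)
  also have "(of_real R)\<^sup>2 + z\<^sup>2 = (z + cnj z) * z" unfolding zz by (simp add: power2_eq_square algebra_simps)
  also have "\<dots> / ((of_real R)\<^sup>2 * z) = (z + cnj z) / (of_real R)\<^sup>2" using nz by simp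
  also have "z + cnj z = of_real (2 * Re z)" by (simp add: complex_add_cnj)
  finally have "cmod ((1 + z\<^sup>2 / (of_real R)\<^sup>2) / z) = 2 * \<bar>Re z\<bar> / R\<^sup>2"
    by (simp add: norm_divide norm_power norm_mult)
  moreover have "cmod (exp (z * of_real (ln M))) = M powr Re z"
    using assms by (simp add: powr_def)
  moreover have "newman_kernel R M z / z = exp (z * of_real (ln M)) * ((1 + z\<^sup>2 / (of_real R)\<^sup>2) / z)"
    by (simp add: newman_kernel_def)
  ultimately show ?thesis by (simp only: norm_mult)
qed

text \<open>On the right arc the kernel balances the bound on \<open>g - G N\<close>, on the left
  arc that on \<open>G N\<close>; both arcs contribute \<open>O(C / R)\<close> uniformly in
  \<open>N\<close>. The integral of \<open>g\<close> along the left path tends to 0 up to a small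
  error. The point \<open>- 1\<close> is exempt in \<open>left\<close> because in the application it
  corresponds to \<open>s = 0\<close>.\<close>

theorem newman_tauberian:
  fixes g :: "complex \<Rightarrow> complex" and G :: "nat \<Rightarrow> complex \<Rightarrow> complex"
  assumes U: "open U" "{z. Re z \<ge> 0} \<subseteq> U" "g holomorphic_on U"
    and G: "\<And>N. G N holomorphic_on UNIV"
    and right: "\<And>N z. Re z > 0 \<Longrightarrow> cmod (g z - G N z) \<le> C * (real N + 1) powr (- Re z) / Re z"
    and left: "\<And>N z. Re z < 0 \<Longrightarrow> z \<noteq> - 1 \<Longrightarrow> cmod (G N z) \<le> C * (real N + 1) powr (- Re z) / (- Re z)"
  shows "(\<lambda>N. G N 0) \<longlonglongrightarrow> g 0"
proof (rule metric_LIMSEQ_I)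
  fix \<epsilon> :: real assume eps: "\<epsilon> > 0"
  have C0: "C \<ge> 0"
  proof -
    have "0 \<le> C * (real 0 + 1) powr (- Re 1) / Re 1" using right[of 1 0] by (metis norm_ge_zero order_trans one_complex.sel(1) zero_less_one)
    then show ?thesis by simp
  qed
  \<comment> \<open>The lower bound 2 keeps the circle away from \<open>- 1\<close>; the other one
    makes each arc contribute at most \<open>pi * \<epsilon> / 4\<close>.\<close>
  define R where "R = max 2 (8 * C / \<epsilon>)"
  have R: "R \<ge> 2" "2 * C / R \<le> \<epsilon> / 4" "R > 0"
  proof -
    show "R \<ge> 2" by (simp add: R_def)
    then show "R > 0" by simp
    have "8 * C / \<epsilon> \<le> R" by (simp add: R_def)
    then show "2 * C / R \<le> \<epsilon> / 4" using eps \<open>R > 0\<close> by (simp add: field_simps)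
  qed
  \<comment> \<open>By compactness \<open>U\<close> extends a uniform distance
    \<open>\<delta>\<close> to the left of this piece of the imaginary axis.\<close>
  have "compact (closed_segment (- \<i> * (R + 1)) (\<i> * (R + 1)))" by simp
  moreover have "closed_segment (- \<i> * (R + 1)) (\<i> * (R + 1)) \<subseteq> U"
    using U(2) by (auto simp: closed_segment_def)
  ultimately obtain \<delta> where \<delta>: "\<delta> > 0" "(\<Union>x\<in>closed_segment (- \<i> * (R + 1)) (\<i> * (R + 1)). cball x \<delta>) \<subseteq> U"
    using U(1) compact_subset_open_imp_cball_epsilon_subset by metis
  define V where "V = {z. Re z > - \<delta>} \<inter> {z. Im z < R + 1} \<inter> {z. Im z > - (R + 1)}"
  have V: "convex V" "open V" "0 \<in> V"
    unfolding V_def using \<delta> R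
    by (auto intro!: convex_Int open_Int convex_halfspace_Re_gt convex_halfspace_Im_lt convex_halfspace_Im_gt
        open_halfspace_Re_gt open_halfspace_Im_lt open_halfspace_Im_gt)
  have VU: "V \<subseteq> U"
  proof
    fix z assume z: "z \<in> V"
    show "z \<in> U"
    proof (cases "Re z \<ge> 0")
      case False
      define t where "t = (Im z / (R + 1) + 1) / 2"
      have t: "0 \<le> t" "t \<le> 1" using z R by (auto simp: t_def V_def field_simps)
      have "(2 * t - 1) * (R + 1) = Im z" using R unfolding t_def by (simp add: field_simps)
      then have "\<i> * Im z = (1 - t) *\<^sub>R (- \<i> * (R + 1)) + t *\<^sub>R (\<i> * (R + 1))"
        by (simp add: complex_eq_iff algebra_simps)
      then have "\<i> * Im z \<in> closed_segment (- \<i> * (R + 1)) (\<i> * (R + 1))"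
        using t unfolding closed_segment_def by blast
      moreover have "dist (\<i> * Im z) z = \<bar>Re z\<bar>"
        by (simp add: dist_norm cmod_def)
      then have "z \<in> cball (\<i> * Im z) \<delta>" using z False by (simp add: V_def)
      ultimately show ?thesis using \<delta>(2) by blast
    qed (use U in auto)
  qed
  define Q where "Q = cbox (Complex (- \<delta> / 2) (- R)) (Complex 0 R)"
  have Q: "z \<in> Q \<longleftrightarrow> - \<delta> / 2 \<le> Re z \<and> Re z \<le> 0 \<and> - R \<le> Im z \<and> Im z \<le> R" for z
    by (auto simp: Q_def in_cbox_complex_iff)
  have "Q \<subseteq> V" using \<delta> R by (auto simp: Q V_def)
  then have "compact (g ` Q)"
    using U VU by (intro compact_continuous_image holomorphic_on_imp_continuous_on[OF holomorphic_on_subset[OF U(3)]])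
      (auto simp: Q_def)
  then obtain B where B: "B > 0" "\<And>z. z \<in> Q \<Longrightarrow> cmod (g z) \<le> B"
    using compact_imp_bounded[of "g ` Q"] unfolding bounded_pos by auto
  define \<kappa> where "\<kappa> = 1 + (R + \<delta>)\<^sup>2 / R\<^sup>2"
  have \<kappa>: "\<kappa> > 0" unfolding \<kappa>_def by (intro add_pos_nonneg) auto
  \<comment> \<open>The width of the left rectangle, fixed before \<open>N\<close>: its horizontal
    edges have length \<open>\<eta>\<close> and contribute little for every
    \<open>N\<close>.\<close>
  define \<eta> where "\<eta> = min (\<delta> / 2) (\<epsilon> / (4 * (B * \<kappa>)))"
  have \<eta>: "\<eta> > 0" "\<eta> \<le> \<delta> / 2" "B * \<kappa> * \<eta> \<le> \<epsilon> / 4"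
  proof -
    show "\<eta> > 0" "\<eta> \<le> \<delta> / 2" using \<delta> eps B \<kappa> by (auto simp: \<eta>_def)
    have "\<eta> \<le> \<epsilon> / (4 * (B * \<kappa>))" by (simp add: \<eta>_def)
    then show "B * \<kappa> * \<eta> \<le> \<epsilon> / 4" using B \<kappa> by (simp add: pos_le_divide_eq mult_ac)
  qed
  \<comment> \<open>The vertical edge has length \<open>2 * R\<close>, and on it
    \<open>cmod z \<ge> \<eta>\<close>; the remaining factor \<open>M powr (- \<eta>)\<close> tends
    to 0.\<close>
  define Bv where "Bv = B * \<kappa> / \<eta> * (2 * R)"
  have Bv: "Bv > 0" using B \<kappa> \<eta> R by (simp add: Bv_def)
  have "((\<lambda>N. Bv * (real N + 1) powr (- \<eta>)) \<longlongrightarrow> 0) sequentially" using \<eta> by real_asymp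
  then have "\<forall>\<^sub>F N in sequentially. Bv * (real N + 1) powr (- \<eta>) < \<epsilon> / 4"
    using eps by (intro order_tendstoD(2)) auto
  then obtain N0 where N0: "\<And>N. N \<ge> N0 \<Longrightarrow> Bv * (real N + 1) powr (- \<eta>) < \<epsilon> / 4"
    unfolding eventually_sequentially by blast
  show "\<exists>no. \<forall>n\<ge>no. dist (G n 0) (g 0) < \<epsilon>"
  proof (intro exI allI impI)
    fix N assume "N \<ge> N0"
    define M where "M = real N + 1"
    have M: "M \<ge> 1" by (simp add: M_def)
    define k where "k = newman_kernel R M"
    define A where "A = part_circlepath 0 R (- pi / 2) (pi / 2)"
    define A' where "A' = part_circlepath 0 R (pi / 2) (3 * pi / 2)"
    \<comment> \<open>Three sides of a rectangle close the contour of \<open>g\<close> just to the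
      left of the imaginary axis.\<close>
    define p1 where "p1 = linepath (\<i> * R) (\<i> * R - \<eta>)"
    define p2 where "p2 = linepath (\<i> * R - \<eta>) (- \<i> * R - \<eta>)"
    define p3 where "p3 = linepath (- \<i> * R - \<eta>) (- \<i> * R)"
    define L where "L = p1 +++ p2 +++ p3"
    have AV: "path_image A \<subseteq> V"
    proof
      fix z assume "z \<in> path_image A"
      then have "cmod z = R" "Re z \<ge> 0" using path_image_right_half_circle R by (auto simp: A_def)
      then show "z \<in> V" using abs_Im_le_cmod[of z] \<delta> by (auto simp: V_def)
    qed
    have A'se: "pathstart A' = \<i> * R" "pathfinish A' = - \<i> * R" "valid_path A'"
      unfolding A'_def pathstart_part_circlepath pathfinish_part_circlepath exp_half_pi by auto
    have pi1: "Im z = R \<and> - \<eta> \<le> Re z \<and> Re z \<le> 0" if z: "z \<in> path_image p1" for z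
    proof -
      obtain u where u: "z = (1 - u) *\<^sub>R (\<i> * R) + u *\<^sub>R (\<i> * R - \<eta>)" "0 \<le> u" "u \<le> 1"
        using z unfolding p1_def path_image_linepath closed_segment_def by blast
      have "Im z = R" "Re z = - (u * \<eta>)" using arg_cong[OF u(1), of Im] arg_cong[OF u(1), of Re] by (simp_all add: algebra_simps)
      moreover have "0 \<le> u * \<eta>" "u * \<eta> \<le> 1 * \<eta>" using u \<eta> by (auto intro!: mult_right_mono)
      ultimately show ?thesis by auto
    qed
    have pi2: "Re z = - \<eta> \<and> - R \<le> Im z \<and> Im z \<le> R" if z: "z \<in> path_image p2" for z
    proof -
      obtain u where u: "z = (1 - u) *\<^sub>R (\<i> * R - \<eta>) + u *\<^sub>R (- \<i> * R - \<eta>)" "0 \<le> u" "u \<le> 1"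
        using z unfolding p2_def path_image_linepath closed_segment_def by blast
      have "Im z = R - 2 * u * R" "Re z = - \<eta>" using arg_cong[OF u(1), of Im] arg_cong[OF u(1), of Re] by (simp_all add: algebra_simps)
      moreover have "0 \<le> u * R" "u * R \<le> 1 * R" using u R by (auto intro!: mult_right_mono)
      ultimately show ?thesis by (intro conjI; linarith)
    qed
    have pi3: "Im z = - R \<and> - \<eta> \<le> Re z \<and> Re z \<le> 0" if z: "z \<in> path_image p3" for z
    proof -
      obtain u where u: "z = (1 - u) *\<^sub>R (- \<i> * R - \<eta>) + u *\<^sub>R (- \<i> * R)" "0 \<le> u" "u \<le> 1"
        using z unfolding p3_def path_image_linepath closed_segment_def by blast
      have "Im z = - R" "Re z = - \<eta> + u * \<eta>" using arg_cong[OF u(1), of Im] arg_cong[OF u(1), of Re] by (simp_all add: algebra_simps)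
      moreover have "0 \<le> u * \<eta>" "u * \<eta> \<le> 1 * \<eta>" using u \<eta> by (auto intro!: mult_right_mono)
      ultimately show ?thesis by auto
    qed
    have vp: "valid_path p1" "valid_path p2" "valid_path p3" "valid_path L"
      "pathstart L = \<i> * R" "pathfinish L = - \<i> * R"
      unfolding L_def p1_def p2_def p3_def by (auto intro!: valid_path_join)
    have piL: "path_image L \<subseteq> path_image p1 \<union> path_image p2 \<union> path_image p3"
      unfolding L_def using path_image_join_subset[of p1 "p2 +++ p3"] path_image_join_subset[of p2 p3] by blast
    have LQ: "path_image L \<subseteq> Q"
    proof
      fix z assume "z \<in> path_image L"
      then have "z \<in> path_image p1 \<or> z \<in> path_image p2 \<or> z \<in> path_image p3" using piL by blast
      then show "z \<in> Q" unfolding Q using pi1[of z] pi2[of z] pi3[of z] \<eta> R by auto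
    qed
    have fg: "(\<lambda>z. g z * k z) holomorphic_on V"
      unfolding k_def using U VU by (intro holomorphic_intros newman_kernel_holomorphic) (auto intro: holomorphic_on_subset)
    have fG: "(\<lambda>z. G N z * k z) holomorphic_on UNIV"
      unfolding k_def by (intro holomorphic_intros newman_kernel_holomorphic G)
    have k0: "k 0 = 1" by (simp add: k_def newman_kernel_def)
    have 1: "contour_integral A (\<lambda>z. g z * k z / z) + contour_integral L (\<lambda>z. g z * k z / z) = 2 * pi * \<i> * g 0"
    proof -
      have "\<not> (Im z = 0 \<and> Re z \<ge> 0)" if "z \<in> path_image L" for z
      proof -
        have "z \<in> path_image p1 \<or> z \<in> path_image p2 \<or> z \<in> path_image p3" using that piL by blast
        then show ?thesis using pi1[of z] pi2[of z] pi3[of z] \<eta> R by auto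
      qed
      then show ?thesis
        using Cauchy_half_contours[OF R(3) V(1,2) fg V(3) AV[unfolded A_def] vp(4,5,6)] LQ \<open>Q \<subseteq> V\<close> k0
        unfolding A_def by auto
    qed
    \<comment> \<open>\<open>G N\<close> is entire, so its contour is closed by the left half of the
      circle itself, where the bound \<open>left\<close> applies.\<close>
    have 2: "contour_integral A (\<lambda>z. G N z * k z / z) + contour_integral A' (\<lambda>z. G N z * k z / z) = 2 * pi * \<i> * G N 0"
    proof -
      have "\<not> (Im z = 0 \<and> Re z \<ge> 0)" if "z \<in> path_image A'" for z
      proof
        assume z: "Im z = 0 \<and> Re z \<ge> 0"
        then have "Re z = 0" "cmod z = R" using path_image_left_half_circle[of z R] that R by (auto simp: A'_def)
        then show False using z R by (simp add: cmod_def)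
      qed
      then show ?thesis
        using Cauchy_half_contours[OF R(3) convex_UNIV open_UNIV fG UNIV_I _ A'se(3,1,2)] k0
        unfolding A_def by auto
    qed
    have nz: "0 \<notin> path_image A" "0 \<notin> path_image A'"
      using path_image_right_half_circle[of 0 R] path_image_left_half_circle[of 0 R] R by (auto simp: A_def A'_def)
    have nzL: "0 \<notin> path_image p1" "0 \<notin> path_image p2" "0 \<notin> path_image p3"
      using pi1[of 0] pi2[of 0] pi3[of 0] R \<eta> by auto
    have gcont: "continuous_on X (\<lambda>z. g z * k z / z)" if "X \<subseteq> V" "0 \<notin> X" for X
      using that by (intro continuous_on_divide continuous_on_subset[OF holomorphic_on_imp_continuous_on[OF fg]] continuous_intros) auto
    have Gcont: "continuous_on X (\<lambda>z. G N z * k z / z)" if "0 \<notin> X" for X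
      using that by (intro continuous_on_divide continuous_on_subset[OF holomorphic_on_imp_continuous_on[OF fG]] continuous_intros) auto
    have pQ: "path_image p1 \<subseteq> Q" "path_image p2 \<subseteq> Q" "path_image p3 \<subseteq> Q"
    proof -
      have "z \<in> Q" if "z \<in> path_image p1" for z using pi1[OF that] \<eta> R unfolding Q by auto
      then show "path_image p1 \<subseteq> Q" by blast
      have "z \<in> Q" if "z \<in> path_image p2" for z using pi2[OF that] \<eta> R unfolding Q by auto
      then show "path_image p2 \<subseteq> Q" by blast
      have "z \<in> Q" if "z \<in> path_image p3" for z using pi3[OF that] \<eta> R unfolding Q by auto
      then show "path_image p3 \<subseteq> Q" by blast
    qed
    have int: "(\<lambda>z. g z * k z / z) contour_integrable_on p1" "(\<lambda>z. g z * k z / z) contour_integrable_on p2"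
      "(\<lambda>z. g z * k z / z) contour_integrable_on p3"
      unfolding p1_def p2_def p3_def
      by (rule contour_integrable_continuous_linepath gcont; use pQ \<open>Q \<subseteq> V\<close> nzL in \<open>auto simp: p1_def p2_def p3_def\<close>)+
    have intA: "(\<lambda>z. g z * k z / z) contour_integrable_on A" "(\<lambda>z. G N z * k z / z) contour_integrable_on A"
      "(\<lambda>z. G N z * k z / z) contour_integrable_on A'"
      unfolding A_def A'_def
      by (rule contour_integrable_continuous_part_circlepath gcont Gcont; use AV nz in \<open>simp add: A_def A'_def\<close>)+
    have bA: "cmod (contour_integral A (\<lambda>z. g z * k z / z) - contour_integral A (\<lambda>z. G N z * k z / z)) \<le> (2 * C / R\<^sup>2) * R * \<bar>pi / 2 - (- pi / 2)\<bar>"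
    proof -
      have "contour_integral A (\<lambda>z. g z * k z / z) - contour_integral A (\<lambda>z. G N z * k z / z) =
         contour_integral A (\<lambda>z. g z * k z / z - G N z * k z / z)"
        using intA by (simp add: contour_integral_diff)
      also have "cmod \<dots> \<le> (2 * C / R\<^sup>2) * R * \<bar>pi / 2 - (- pi / 2)\<bar>"
        unfolding A_def
      proof (rule contour_integral_bound_part_circlepath)
        show "(\<lambda>z. g z * k z / z - G N z * k z / z) contour_integrable_on part_circlepath 0 R (- pi / 2) (pi / 2)"
          using intA unfolding A_def by (intro contour_integrable_diff)
        fix z assume "z \<in> path_image (part_circlepath 0 R (- pi / 2) (pi / 2))"
        then have z: "cmod z = R" "Re z \<ge> 0" using path_image_right_half_circle R by auto
        have kz: "cmod (k z / z) = M powr Re z * (2 * \<bar>Re z\<bar> / R\<^sup>2)"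
          unfolding k_def using z R M by (intro norm_newman_kernel_circle) auto
        have "g z * k z / z - G N z * k z / z = (g z - G N z) * (k z / z)" by (simp add: diff_divide_distrib algebra_simps)
        then have e: "cmod (g z * k z / z - G N z * k z / z) = cmod (g z - G N z) * (M powr Re z * (2 * \<bar>Re z\<bar> / R\<^sup>2))"
          using kz by (simp only: norm_mult)
        show "cmod (g z * k z / z - G N z * k z / z) \<le> 2 * C / R\<^sup>2"
        proof (cases "Re z = 0")
          case True
          then show ?thesis unfolding e using C0 by simp
        next
          case False
          then have x: "Re z > 0" using z by simp
          have "cmod (g z - G N z) * (M powr Re z * (2 * \<bar>Re z\<bar> / R\<^sup>2)) \<le> (C * M powr (- Re z) / Re z) * (M powr Re z * (2 * \<bar>Re z\<bar> / R\<^sup>2))"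
            using right[OF x, of N] unfolding M_def by (intro mult_right_mono) auto
          also have "\<dots> = (M powr (- Re z) * M powr Re z) * (2 * C / R\<^sup>2)" using x by simp
          also have "\<dots> = 2 * C / R\<^sup>2" using M by (simp flip: powr_add)
          finally show ?thesis unfolding e .
        qed
      qed (use C0 R in auto)
      finally show ?thesis .
    qed
    have bA': "cmod (contour_integral A' (\<lambda>z. G N z * k z / z)) \<le> (2 * C / R\<^sup>2) * R * \<bar>3 * pi / 2 - pi / 2\<bar>"
      unfolding A'_def
    proof (rule contour_integral_bound_part_circlepath)
      fix z assume "z \<in> path_image (part_circlepath 0 R (pi / 2) (3 * pi / 2))"
      then have z: "cmod z = R" "Re z \<le> 0" using path_image_left_half_circle R by auto
      have kz: "cmod (k z / z) = M powr Re z * (2 * \<bar>Re z\<bar> / R\<^sup>2)"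
        unfolding k_def using z R M by (intro norm_newman_kernel_circle) auto
      have "G N z * k z / z = G N z * (k z / z)" by simp
      then have e: "cmod (G N z * k z / z) = cmod (G N z) * (M powr Re z * (2 * \<bar>Re z\<bar> / R\<^sup>2))"
        using kz by (simp only: norm_mult)
      show "cmod (G N z * k z / z) \<le> 2 * C / R\<^sup>2"
      proof (cases "Re z = 0")
        case True
        then show ?thesis unfolding e using C0 by simp
      next
        case False
        then have x: "Re z < 0" using z by simp
        have "z \<noteq> -1" using z R by auto
        then have "cmod (G N z) * (M powr Re z * (2 * \<bar>Re z\<bar> / R\<^sup>2)) \<le> (C * M powr (- Re z) / (- Re z)) * (M powr Re z * (2 * \<bar>Re z\<bar> / R\<^sup>2))"
          using left[OF x, of N] unfolding M_def by (intro mult_right_mono) auto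
        also have "\<dots> = (M powr (- Re z) * M powr Re z) * (2 * C / R\<^sup>2)" using x by simp
        also have "\<dots> = 2 * C / R\<^sup>2" using M by (simp flip: powr_add)
        finally show ?thesis unfolding e .
      qed
    qed (use intA C0 R in \<open>auto simp: A'_def\<close>)
    have kbound: "cmod (1 + z\<^sup>2 / (of_real R)\<^sup>2) \<le> \<kappa>" if "z \<in> Q" for z
    proof -
      have "cmod z \<le> \<bar>Re z\<bar> + \<bar>Im z\<bar>" by (rule cmod_le)
      also have "\<dots> \<le> R + \<delta>" using that \<delta> by (auto simp: Q)
      finally have "(cmod z)\<^sup>2 \<le> (R + \<delta>)\<^sup>2" by (intro power_mono) auto
      then have "(cmod z)\<^sup>2 / R\<^sup>2 \<le> (R + \<delta>)\<^sup>2 / R\<^sup>2" by (intro divide_right_mono) auto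
      then show ?thesis unfolding \<kappa>_def
        by (intro norm_triangle_le) (simp add: norm_divide norm_power)
    qed
    have gk: "cmod (g z * k z / z) \<le> B * (M powr Re z * \<kappa>) / cmod z" if "z \<in> Q" for z
    proof -
      have "cmod (exp (z * of_real (ln M))) = M powr Re z" using M by (simp add: powr_def)
      then have "cmod (k z) \<le> M powr Re z * \<kappa>"
        unfolding k_def newman_kernel_def norm_mult using kbound[OF that] by (simp add: mult_left_mono)
      then have "cmod (g z) * cmod (k z) \<le> B * (M powr Re z * \<kappa>)"
        using B(2)[OF that] B(1) by (intro mult_mono) auto
      then show ?thesis by (simp add: norm_mult norm_divide divide_right_mono)
    qed
    have hor: "cmod (g z * k z / z) \<le> B * \<kappa>" if "z \<in> Q" "\<bar>Im z\<bar> = R" for z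
    proof -
      have z: "cmod z \<ge> 1" using abs_Im_le_cmod[of z] that R by simp
      have "M powr Re z \<le> M powr 0" using M that by (intro powr_mono) (auto simp: Q)
      then have "B * (M powr Re z * \<kappa>) \<le> B * (1 * \<kappa>)" using B \<kappa> M by (intro mult_left_mono mult_right_mono) auto
      then have "B * (M powr Re z * \<kappa>) / cmod z \<le> B * \<kappa> / 1" using z B \<kappa> by (intro frac_le) auto
      then show ?thesis using gk[OF that(1)] by simp
    qed
    have b1: "cmod (contour_integral p1 (\<lambda>z. g z * k z / z)) \<le> B * \<kappa> * cmod ((\<i> * R - \<eta>) - \<i> * R)"
      unfolding p1_def
      by (rule contour_integral_bound_linepath) (use int pQ pi1 hor B \<kappa> R in \<open>auto simp: p1_def\<close>)
    have b3: "cmod (contour_integral p3 (\<lambda>z. g z * k z / z)) \<le> B * \<kappa> * cmod ((- \<i> * R) - (- \<i> * R - \<eta>))"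
      unfolding p3_def
      by (rule contour_integral_bound_linepath) (use int pQ pi3 hor B \<kappa> R in \<open>auto simp: p3_def\<close>)
    have b2: "cmod (contour_integral p2 (\<lambda>z. g z * k z / z)) \<le> (B * (M powr (- \<eta>) * \<kappa>) / \<eta>) * cmod ((- \<i> * R - \<eta>) - (\<i> * R - \<eta>))"
      unfolding p2_def
    proof (rule contour_integral_bound_linepath)
      fix z assume "z \<in> closed_segment (\<i> * complex_of_real R - complex_of_real \<eta>) (- \<i> * complex_of_real R - complex_of_real \<eta>)"
      then have z: "z \<in> path_image p2" by (simp add: p2_def)
      have "\<eta> \<le> cmod z" using abs_Re_le_cmod[of z] pi2[OF z] \<eta> by simp
      have "cmod (g z * k z / z) \<le> B * (M powr (- \<eta>) * \<kappa>) / cmod z"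
        using gk[of z] pQ z pi2[OF z] by auto
      also have "\<dots> \<le> B * (M powr (- \<eta>) * \<kappa>) / \<eta>"
        using \<open>\<eta> \<le> cmod z\<close> \<eta>(1) B(1) \<kappa> by (intro divide_left_mono mult_pos_pos mult_nonneg_nonneg) auto
      finally show "cmod (g z * k z / z) \<le> B * (M powr (- \<eta>) * \<kappa>) / \<eta>" .
    qed (use int B \<kappa> \<eta> in \<open>auto simp: p2_def\<close>)
    have n13: "cmod ((\<i> * R - \<eta>) - \<i> * R) = \<eta>" "cmod ((- \<i> * R) - (- \<i> * R - \<eta>)) = \<eta>"
      using \<eta> by auto
    have "(- \<i> * R - \<eta>) - (\<i> * R - \<eta>) = - 2 * \<i> * R" by simp
    then have n2: "cmod ((- \<i> * R - \<eta>) - (\<i> * R - \<eta>)) = 2 * R" using R by (simp add: norm_mult)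
    have splitL: "contour_integral L (\<lambda>z. g z * k z / z) = contour_integral p1 (\<lambda>z. g z * k z / z) +
        (contour_integral p2 (\<lambda>z. g z * k z / z) + contour_integral p3 (\<lambda>z. g z * k z / z))"
    proof -
      have "valid_path (p2 +++ p3)" using vp by (intro valid_path_join) (auto simp: p2_def p3_def)
      moreover have "(\<lambda>z. g z * k z / z) contour_integrable_on (p2 +++ p3)"
        using int vp by (intro contour_integrable_joinI) auto
      ultimately show ?thesis unfolding L_def using int vp by simp
    qed
    have "cmod (2 * pi * \<i> * g 0 - 2 * pi * \<i> * G N 0) =
      cmod ((contour_integral A (\<lambda>z. g z * k z / z) - contour_integral A (\<lambda>z. G N z * k z / z)) +
        (contour_integral L (\<lambda>z. g z * k z / z) - contour_integral A' (\<lambda>z. G N z * k z / z)))"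
      unfolding 1[symmetric] 2[symmetric] by (simp add: algebra_simps)
    also have "\<dots> \<le> (2 * C / R\<^sup>2) * R * pi + ((B * \<kappa> * \<eta> + (Bv * M powr (- \<eta>) + B * \<kappa> * \<eta>)) + (2 * C / R\<^sup>2) * R * pi)"
    proof -
      have 1: "cmod (contour_integral A (\<lambda>z. g z * k z / z) - contour_integral A (\<lambda>z. G N z * k z / z)) \<le> (2 * C / R\<^sup>2) * R * pi"
        using bA by simp
      have 2: "cmod (contour_integral A' (\<lambda>z. G N z * k z / z)) \<le> (2 * C / R\<^sup>2) * R * pi" using bA' by simp
      have "cmod (contour_integral p1 (\<lambda>z. g z * k z / z)) \<le> B * \<kappa> * \<eta>" using b1 unfolding n13 .
      moreover have "cmod (contour_integral p3 (\<lambda>z. g z * k z / z)) \<le> B * \<kappa> * \<eta>" using b3 unfolding n13 .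
      moreover have "cmod (contour_integral p2 (\<lambda>z. g z * k z / z)) \<le> Bv * M powr (- \<eta>)"
        using b2 unfolding n2 by (simp add: Bv_def mult_ac)
      ultimately have 3: "cmod (contour_integral L (\<lambda>z. g z * k z / z)) \<le> B * \<kappa> * \<eta> + (Bv * M powr (- \<eta>) + B * \<kappa> * \<eta>)"
        unfolding splitL by (intro norm_triangle_mono)
      have 4: "cmod (contour_integral L (\<lambda>z. g z * k z / z) - contour_integral A' (\<lambda>z. G N z * k z / z)) \<le>
          (B * \<kappa> * \<eta> + (Bv * M powr (- \<eta>) + B * \<kappa> * \<eta>)) + (2 * C / R\<^sup>2) * R * pi"
        by (rule order_trans[OF norm_triangle_ineq4 add_mono[OF 3 2]])
      show ?thesis by (rule norm_triangle_mono[OF 1 4])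
    qed
    also have "\<dots> = 2 * pi * (2 * C / R) + 2 * (B * \<kappa> * \<eta>) + Bv * M powr (- \<eta>)"
      using R by (simp add: power2_eq_square)
    also have "\<dots> < 2 * pi * (\<epsilon> / 4) + 2 * (\<epsilon> / 4) + \<epsilon> / 4"
      using N0[OF \<open>N \<ge> N0\<close>] \<eta> R by (intro add_le_less_mono add_mono mult_left_mono) (auto simp: M_def)
    also have "\<dots> \<le> 2 * pi * \<epsilon>"
    proof -
      have "2 * \<epsilon> \<le> pi * \<epsilon>" using pi_ge_two eps by (intro mult_right_mono) auto
      moreover have "2 * pi * (\<epsilon> / 4) = pi * \<epsilon> / 2" "2 * pi * \<epsilon> = 2 * (pi * \<epsilon>)" by simp_all
      ultimately show ?thesis using eps by linarith
    qed
    finally have "cmod (2 * pi * \<i> * g 0 - 2 * pi * \<i> * G N 0) < 2 * pi * \<epsilon>" .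
    moreover have "2 * pi * \<i> * g 0 - 2 * pi * \<i> * G N 0 = 2 * pi * \<i> * (g 0 - G N 0)" by (simp add: algebra_simps)
    then have "cmod (2 * pi * \<i> * g 0 - 2 * pi * \<i> * G N 0) = 2 * pi * cmod (g 0 - G N 0)" by (simp add: norm_mult)
    ultimately have "cmod (g 0 - G N 0) < \<epsilon>" by simp
    then show "dist (G N 0) (g 0) < \<epsilon>" by (simp add: dist_norm norm_minus_commute)
  qed
qed

section \<open>The prime number theorem\<close>

definition psi :: "nat \<Rightarrow> real" where
  "psi n = (\<Sum>k=1..n. mangoldt k)"

lemma psi_Suc: "psi (Suc n) = psi n + mangoldt (Suc n)"
  by (simp_all add: psi_def)

lemma psi_mono: "m \<le> n \<Longrightarrow> psi m \<le> psi n"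
  unfolding psi_def by (intro sum_mono2) (auto simp: mangoldt_nonneg)

lemma psi_nonneg: "psi n \<ge> 0"
  unfolding psi_def by (intro sum_nonneg mangoldt_nonneg)

section \<open>Chebyshev's upper bound\<close>

text \<open>Summing \<open>ln k\<close>, the sum of \<open>mangoldt\<close> over the divisors of
  \<open>k\<close>, counts each \<open>d\<close> once per multiple up to \<open>n\<close>.\<close>

lemma ln_fact_eq: "ln (fact n :: real) = (\<Sum>d=1..n. mangoldt d * real (n div d))"
proof (induction n)
  case (Suc n)
  have "ln (fact (Suc n) :: real) = ln (real (Suc n)) + ln (fact n)"
    by (simp add: ln_mult del: of_nat_Suc)
  also have "ln (real (Suc n)) = (\<Sum>d | d dvd Suc n. mangoldt d)"
    using mangoldt_sum[of "Suc n", where 'a = real] by simp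
  also have "\<dots> = (\<Sum>d=1..Suc n. mangoldt d * of_bool (d dvd Suc n))"
  proof (rule sum.mono_neutral_cong_left)
    show "{d. d dvd Suc n} \<subseteq> {1..Suc n}"
      using dvd_imp_le[of _ "Suc n"] dvd_pos_nat[of "Suc n"] by (auto simp: Suc_le_eq)
  qed auto
  also have "ln (fact n :: real) = (\<Sum>d=1..Suc n. mangoldt d * real (n div d))"
    unfolding Suc by simp
  also have "(\<Sum>d=1..Suc n. mangoldt d * of_bool (d dvd Suc n)) + (\<Sum>d=1..Suc n. mangoldt d * real (n div d)) =
      (\<Sum>d=1..Suc n. mangoldt d * real (Suc n div d))"
    unfolding sum.distrib[symmetric]
    by (intro sum.cong refl) (auto simp: div_Suc algebra_simps dvd_eq_mod_eq_0)
  finally show ?case .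
qed simp

text \<open>In the logarithm of the central binomial coefficient \<open>mangoldt d\<close> has
  coefficient \<open>2 * n div d - 2 * (n div d)\<close>. It is nonnegative, and 1 for
  \<open>n < d \<le> 2 * n\<close>; the coefficient itself is at most
  \<open>2 ^ (2 * n)\<close>.\<close>

lemma psi_double: "psi (2 * n) - psi n \<le> 2 * real n"
proof -
  have "psi (2 * n) - psi n = (\<Sum>d\<in>{Suc n..2 * n}. mangoldt d)"
  proof -
    have "{1..2 * n} = {1..n} \<union> {Suc n..2 * n}" by auto
    then show ?thesis unfolding psi_def by (simp add: sum.union_disjoint)
  qed
  also have "\<dots> \<le> (\<Sum>d\<in>{Suc n..2 * n}. mangoldt d * (real (2 * n div d) - 2 * real (n div d)))"
  proof (rule sum_mono)
    fix d assume d: "d \<in> {Suc n..2 * n}"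
    then have "2 * n div d \<ge> 1" by (simp add: Suc_le_eq div_greater_zero_iff)
    then have "mangoldt d * 1 \<le> mangoldt d * (real (2 * n div d) - 2 * real (n div d))"
      using d by (intro mult_left_mono mangoldt_nonneg) auto
    then show "mangoldt d \<le> mangoldt d * (real (2 * n div d) - 2 * real (n div d))" by simp
  qed
  also have "\<dots> \<le> (\<Sum>d=1..2 * n. mangoldt d * (real (2 * n div d) - 2 * real (n div d)))"
  proof (rule sum_mono2)
    fix d :: nat
    have "2 * (n div d) \<le> 2 * n div d"
    proof (cases "d = 0")
      case False
      have "2 * (n div d) * d \<le> 2 * n" by simp
      then show ?thesis using False by (simp add: less_eq_div_iff_mult_less_eq)
    qed simp
    then have "2 * real (n div d) \<le> real (2 * n div d)" by linarith
    then show "0 \<le> mangoldt d * (real (2 * n div d) - 2 * real (n div d))"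
      by (intro mult_nonneg_nonneg mangoldt_nonneg) auto
  qed auto
  also have "\<dots> = ln (fact (2 * n)) - 2 * ln (fact n)"
  proof -
    have "ln (fact n :: real) = (\<Sum>d=1..2 * n. mangoldt d * real (n div d))"
      unfolding ln_fact_eq by (rule sum.mono_neutral_left) auto
    then show ?thesis unfolding ln_fact_eq[of "2 * n"]
      by (simp add: right_diff_distrib sum_subtractf sum_distrib_left mult_ac)
  qed
  also have "\<dots> = ln (real (2 * n choose n))"
  proof -
    have "fact n * fact (2 * n - n) * real (2 * n choose n) = fact (2 * n)"
      using binomial_fact_lemma[of n "2 * n"] by (metis le_add2 mult_2 of_nat_fact of_nat_mult)
    then have "fact (2 * n) = fact n * fact n * real (2 * n choose n)" by simp
    then show ?thesis by (simp add: ln_mult)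
  qed
  also have "\<dots> \<le> ln (2 ^ (2 * n))"
  proof -
    have "2 * n choose n \<le> 2 ^ (2 * n)" by (rule binomial_le_pow2)
    then have "real (2 * n choose n) \<le> 2 ^ (2 * n)" by (metis of_nat_le_iff of_nat_numeral of_nat_power)
    then show ?thesis by (subst ln_le_cancel_iff) auto
  qed
  also have "\<dots> = 2 * real n * ln 2" by (simp add: ln_realpow)
  also have "\<dots> \<le> 2 * real n * 1" using ln_le_minus_one[of 2] by (intro mult_left_mono) auto
  finally show ?thesis by simp
qed

text \<open>Doubling gives the bound \<open>2 * 2 ^ k\<close> at powers of two, and the least power
  of two above \<open>n\<close> is at most \<open>2 * n\<close>.\<close>

lemma psi_le: "psi n \<le> 4 * real n"
proof (cases "n = 0")
  case False
  have pow: "psi (2 ^ k) \<le> 2 * 2 ^ k" for k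
  proof (induction k)
    case (Suc k)
    have "psi (2 * 2 ^ k) \<le> psi (2 ^ k) + 2 * 2 ^ k" using psi_double[of "2 ^ k"] by simp
    then show ?case using Suc by simp
  qed (simp add: psi_def)
  define k where "k = (LEAST k. n \<le> 2 ^ k)"
  have ex: "n \<le> 2 ^ n" by (simp add: less_imp_le)
  have k: "n \<le> 2 ^ k" unfolding k_def by (rule LeastI[of "\<lambda>k. n \<le> 2 ^ k", OF ex])
  have "2 ^ k \<le> 2 * n"
  proof (cases k)
    case (Suc j)
    then have "\<not> n \<le> 2 ^ j" using not_less_Least[of j "\<lambda>k. n \<le> 2 ^ k"] by (simp add: k_def)
    then show ?thesis using Suc by simp
  qed (use False in simp)
  then have "real (2 ^ k) \<le> real (2 * n)" by (simp only: of_nat_le_iff)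
  then show ?thesis using psi_mono[OF k] pow[of k] by simp
qed (simp add: psi_def)

section \<open>The series attached to the error in \<open>psi\<close>\<close>

definition psi_err :: "nat \<Rightarrow> real" where
  "psi_err n = psi n - real n"

lemma abs_psi_err_le: "\<bar>psi_err n\<bar> \<le> 4 * real n"
  using psi_le[of n] psi_nonneg[of n] unfolding psi_err_def by linarith

lemma psi_err_summation:
  "(\<Sum>n<N. (mangoldt (Suc n) - 1) * npow n s) =
     (\<Sum>n<N. of_real (psi_err (Suc n)) * (npow n s - npow (Suc n) s)) + of_real (psi_err N) * npow N s"
proof (induction N)
  case 0
  then show ?case by (simp add: psi_err_def psi_def)
next
  case (Suc N)
  have "(mangoldt (Suc N) - 1 :: complex) = of_real (psi_err (Suc N)) - of_real (psi_err N)"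
    by (simp add: psi_err_def psi_Suc)
  then have "(mangoldt (Suc N) - 1) * npow N s = of_real (psi_err (Suc N)) * npow N s - of_real (psi_err N) * npow N s"
    by (simp only: left_diff_distrib)
  then show ?case using Suc by (simp add: right_diff_distrib)
qed

lemma psi_err_series:
  assumes s: "Re s > 1"
  shows "(\<lambda>n. of_real (psi_err (Suc n)) * (npow n s - npow (Suc n) s)) sums (mangoldt_series s - zeta s)"
proof -
  have "(\<lambda>N. of_real (psi_err N) * npow N s) \<longlonglongrightarrow> 0"
  proof (rule tendsto_norm_zero_cancel, rule tendsto_sandwich[of "\<lambda>_. 0"])
    show "\<forall>\<^sub>F N in sequentially. norm (of_real (psi_err N) * npow N s) \<le> 4 * real N * real (Suc N) powr (- Re s)"
      unfolding norm_mult norm_npow using abs_psi_err_le by (intro always_eventually allI mult_right_mono) auto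
    show "(\<lambda>N. 4 * real N * real (Suc N) powr (- Re s)) \<longlonglongrightarrow> 0" using s by real_asymp
  qed auto
  moreover have "(\<lambda>N. \<Sum>n<N. mangoldt (Suc n) * npow n s - npow n s) \<longlonglongrightarrow> mangoldt_series s - zeta s"
    using sums_diff[OF mangoldt_series_sums[OF s] zeta_sums_and_derivative(1)[OF s]] by (simp add: sums_def)
  ultimately have "(\<lambda>N. (\<Sum>n<N. mangoldt (Suc n) * npow n s - npow n s) - of_real (psi_err N) * npow N s) \<longlonglongrightarrow> mangoldt_series s - zeta s - 0"
    by (rule tendsto_diff[rotated])
  moreover have "(\<Sum>n<N. mangoldt (Suc n) * npow n s - npow n s) - of_real (psi_err N) * npow N s =
     (\<Sum>n<N. of_real (psi_err (Suc n)) * (npow n s - npow (Suc n) s))" for N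
    using psi_err_summation[of s N] by (simp add: left_diff_distrib)
  ultimately show ?thesis by (simp add: sums_def)
qed

text \<open>The integral of \<open>t\<close> to the power \<open>- s - 1\<close> from
  \<open>n + 1\<close> to \<open>n + 2\<close>. At \<open>s = 0\<close> the value is the derivative
  of the numerator, which makes the quotient entire.\<close>

definition npow_quot :: "nat \<Rightarrow> complex \<Rightarrow> complex" where
  "npow_quot n s = (if s = 0 then deriv (\<lambda>s. npow n s - npow (Suc n) s) 0
     else ((npow n s - npow (Suc n) s) - (npow n 0 - npow (Suc n) 0)) / (s - 0))"

lemma npow_quot_eq: "s \<noteq> 0 \<Longrightarrow> npow_quot n s = (npow n s - npow (Suc n) s) / s"
  by (simp add: npow_quot_def npow_def)

lemma npow_quot_holomorphic: "npow_quot n holomorphic_on UNIV"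
  unfolding npow_quot_def[abs_def]
  by (rule pole_lemma_open) (auto intro!: holomorphic_intros npow_holomorphic)

text \<open>Inside the integral \<open>Suc n \<le> t\<close>, so the integrand is at most
  \<open>t powr (- x - 1)\<close>, whose primitive telescopes over \<open>n\<close>. The estimate
  holds for both signs of \<open>x\<close>.\<close>

lemma norm_npow_quot:
  assumes s: "s \<noteq> 0" and x: "Re s = 1 + x" "x \<noteq> 0"
  shows "real (Suc n) * cmod (npow_quot n s) \<le> (real (Suc n) powr (- x) - real (Suc (Suc n)) powr (- x)) / x"
proof -
  define a where "a = real (Suc n)"
  have a: "a \<ge> 1" by (simp add: a_def)
  define f where "f = (\<lambda>t. - (of_real a / s) * exp (- s * of_real (ln t)))"
  have "cmod (f (a + 1) - f a) \<le> - ((a + 1) powr (- x)) / x - - (a powr (- x)) / x"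
  proof (rule differentiable_bound_general)
    fix t assume t: "a < t" "t < a + 1"
    then have t0: "t > 0" using a by simp
    have "(f has_vector_derivative (- (of_real a / s) * (- s / of_real t * exp (- s * of_real (ln t))))) (at t)"
      unfolding f_def by (rule has_vector_derivative_mult_right exp_ln_has_vector_derivative t0)+
    also have "- (of_real a / s) * (- s / of_real t * exp (- s * of_real (ln t))) = of_real (a / t) * exp (- s * of_real (ln t))"
      using s by simp
    finally show "(f has_vector_derivative (of_real (a / t) * exp (- s * of_real (ln t)))) (at t)" .
    have "((\<lambda>t. - (t powr (- x)) / x) has_real_derivative (t powr (- x - 1))) (at t)"
      using t0 x by (auto intro!: derivative_eq_intros)
    then show "((\<lambda>t. - (t powr (- x)) / x) has_vector_derivative (t powr (- x - 1))) (at t)"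
      by (simp add: has_real_derivative_iff_has_vector_derivative)
    have "cmod (of_real (a / t) * exp (- s * of_real (ln t))) = a / t * t powr (- Re s)"
      using t0 a cmod_exp_ln[OF t0, of "- s"] by (simp add: norm_mult norm_divide)
    also have "\<dots> \<le> 1 * t powr (- Re s)" using t t0 by (intro mult_right_mono) auto
    also have "\<dots> = t powr (- x - 1)"
    proof -
      have "- Re s = - x - 1" using x by simp
      then show ?thesis by (simp only: mult_1)
    qed
    finally show "cmod (of_real (a / t) * exp (- s * of_real (ln t))) \<le> t powr (- x - 1)" .
  qed (use a s x in \<open>auto simp: f_def intro!: continuous_intros\<close>)
  also have "f (a + 1) - f a = of_real a * npow_quot n s"
  proof -
    have "npow n s = exp (- s * of_real (ln a))" "npow (Suc n) s = exp (- s * of_real (ln (a + 1)))"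
      by (simp_all add: npow_def a_def add.commute)
    then show ?thesis using s unfolding npow_quot_eq[OF s] f_def by (simp add: field_simps)
  qed
  finally have "\<bar>a\<bar> * cmod (npow_quot n s) \<le> - ((a + 1) powr (- x)) / x - - (a powr (- x)) / x"
    by (simp only: norm_mult norm_of_real)
  moreover have "real (Suc (Suc n)) = a + 1" by (simp add: a_def)
  ultimately show ?thesis using a unfolding a_def[symmetric] by (simp add: diff_divide_distrib add.commute)
qed

text \<open>Partial sums of the series for \<open>(mangoldt_series s - zeta s) / s\<close> after
  summation by parts, at \<open>s = 1 + z\<close>. They play the part of the truncated transforms in
  Newman's theorem.\<close>

definition psi_partial :: "nat \<Rightarrow> complex \<Rightarrow> complex" where
  "psi_partial N z = (\<Sum>n<N. of_real (psi_err (Suc n)) * npow_quot n (1 + z))"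

text \<open>With the Chebyshev bound the terms telescope. For \<open>Re z > 0\<close> this controls
  the tail of the series, for \<open>Re z < 0\<close> the growth of the partial sums.\<close>

lemma psi_partial_diff_bound:
  assumes z: "z \<noteq> -1" "Re z \<noteq> 0" and NM: "N \<le> M"
  shows "cmod (psi_partial M z - psi_partial N z) \<le> 4 * (((real N + 1) powr (- Re z) - (real M + 1) powr (- Re z)) / Re z)"
proof -
  define x where "x = Re z"
  define q where "q = (\<lambda>n. real (Suc n) powr (- x))"
  have s: "1 + z \<noteq> 0" using z by (metis add_eq_0_iff)
  have "psi_partial M z - psi_partial N z = (\<Sum>n\<in>{N..<M}. of_real (psi_err (Suc n)) * npow_quot n (1 + z))"
    unfolding psi_partial_def using NM by (simp add: sum_diff_nat_ivl lessThan_atLeast0)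
  also have "cmod \<dots> \<le> (\<Sum>n\<in>{N..<M}. 4 * ((q n - q (Suc n)) / x))"
  proof (rule sum_norm_le)
    fix n
    have "cmod (of_real (psi_err (Suc n)) * npow_quot n (1 + z)) = \<bar>psi_err (Suc n)\<bar> * cmod (npow_quot n (1 + z))"
      by (simp add: norm_mult)
    also have "\<dots> \<le> 4 * real (Suc n) * cmod (npow_quot n (1 + z))"
      by (intro mult_right_mono abs_psi_err_le) auto
    also have "\<dots> = 4 * (real (Suc n) * cmod (npow_quot n (1 + z)))" by simp
    also have "\<dots> \<le> 4 * ((q n - q (Suc n)) / x)"
      unfolding q_def using s z by (intro mult_left_mono norm_npow_quot) (auto simp: x_def)
    finally show "cmod (of_real (psi_err (Suc n)) * npow_quot n (1 + z)) \<le> 4 * ((q n - q (Suc n)) / x)" .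
  qed
  also have "\<dots> = 4 * ((\<Sum>n\<in>{N..<M}. q n - q (Suc n)) / x)"
    by (simp add: sum_distrib_left sum_divide_distrib)
  also have "(\<Sum>n\<in>{N..<M}. q n - q (Suc n)) = q N - q M" using NM by (rule sum_Suc_diff'[of N M "\<lambda>n. - q n", simplified])
  finally show ?thesis by (simp add: q_def x_def add.commute)
qed

text \<open>The two simple poles at 1 cancel.\<close>

definition psi_limit :: "complex \<Rightarrow> complex" where
  "psi_limit s = (- deriv zeta_reg s / zeta_reg s - (if s = 1 then deriv zeta_reg 1 else (zeta_reg s - zeta_reg 1) / (s - 1))) / s"

lemma psi_limit_eq:
  assumes s: "Re s > 1"
  shows "psi_limit s = (mangoldt_series s - zeta s) / s"
proof -
  have nz: "zeta_reg s \<noteq> 0" using s by (intro zeta_reg_nonzero) auto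
  have s1: "s \<noteq> 1" using s by auto
  then have "zeta s = zeta_reg s / (s - 1)" using zeta_reg_eq[OF s] by simp
  moreover have "mangoldt_series s = 1 / (s - 1) - deriv zeta_reg s / zeta_reg s"
    using log_deriv_zeta_reg[OF s nz] by simp
  ultimately show ?thesis unfolding psi_limit_def using s1 by (simp add: zeta_reg_1 diff_divide_distrib)
qed

text \<open>Newman's theorem on the shifted region where \<open>zeta_reg\<close> is nonzero; it
  contains the closed half-plane by \<open>zeta_reg_nonzero\<close>. Both bounds come from
  \<open>psi_partial_diff_bound\<close>.\<close>

lemma psi_partial_0_convergent: "convergent (\<lambda>N. psi_partial N 0)"
proof -
  define H where "H = {s. Re s > 0}"
  have H: "open H" unfolding H_def by (rule open_halfspace_Re_gt)
  define U' where "U' = {s\<in>H. zeta_reg s \<noteq> 0}"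
  have holZ: "zeta_reg holomorphic_on H" unfolding H_def by (rule zeta_reg_holomorphic)
  have "open (H \<inter> zeta_reg -` (- {0}))"
    by (rule continuous_open_preimage[OF holomorphic_on_imp_continuous_on[OF holZ] H]) auto
  moreover have "H \<inter> zeta_reg -` (- {0}) = U'" by (auto simp: U'_def)
  ultimately have U': "open U'" by simp
  have sub: "U' \<subseteq> H" by (auto simp: U'_def)
  have hq: "(\<lambda>s. if s = 1 then deriv zeta_reg 1 else (zeta_reg s - zeta_reg 1) / (s - 1)) holomorphic_on H"
    by (rule pole_lemma_open[OF holZ H])
  have "psi_limit holomorphic_on U'"
    unfolding psi_limit_def[abs_def]
    by (intro holomorphic_on_divide holomorphic_on_diff holomorphic_on_minus holomorphic_on_ident
          holomorphic_on_subset[OF hq sub] holomorphic_on_subset[OF holZ sub]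
          holomorphic_on_subset[OF holomorphic_deriv[OF holZ H] sub])
       (auto simp: U'_def H_def)
  define U where "U = (\<lambda>z. 1 + z) -` U'"
  have U: "open U" unfolding U_def by (intro open_vimage U' continuous_intros)
  have Usub: "{z. Re z \<ge> 0} \<subseteq> U"
    using zeta_reg_nonzero by (auto simp: U_def U'_def H_def)
  have "(psi_limit \<circ> (\<lambda>z. 1 + z)) holomorphic_on U"
    using \<open>psi_limit holomorphic_on U'\<close>
    by (intro holomorphic_on_compose_gen[of _ U _ U'] holomorphic_intros) (auto simp: U_def)
  then have hol: "(\<lambda>z. psi_limit (1 + z)) holomorphic_on U" by (simp add: o_def)
  have "(\<lambda>N. psi_partial N 0) \<longlonglongrightarrow> psi_limit (1 + 0)"
  proof (rule newman_tauberian[OF U Usub hol, where C = 4])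
    fix N
    have "(npow_quot n \<circ> (\<lambda>z. 1 + z)) holomorphic_on UNIV" for n
      by (intro holomorphic_on_compose_gen[of _ UNIV _ UNIV] holomorphic_intros npow_quot_holomorphic) auto
    then have "(\<lambda>z. npow_quot n (1 + z)) holomorphic_on UNIV" for n by (simp add: o_def)
    then show "psi_partial N holomorphic_on UNIV"
      unfolding psi_partial_def[abs_def] by (intro holomorphic_intros)
  next
    fix N z assume z: "Re z > 0"
    have "z \<noteq> -1" using z by auto
    have s: "1 + z \<noteq> 0" using z by (metis add_eq_0_iff \<open>z \<noteq> -1\<close>)
    have "(\<lambda>n. of_real (psi_err (Suc n)) * (npow n (1 + z) - npow (Suc n) (1 + z)) / (1 + z)) sums ((mangoldt_series (1 + z) - zeta (1 + z)) / (1 + z))"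
      by (intro sums_divide psi_err_series) (use z in simp)
    then have "(\<lambda>n. of_real (psi_err (Suc n)) * npow_quot n (1 + z)) sums psi_limit (1 + z)"
      using psi_limit_eq[of "1 + z"] z by (simp add: npow_quot_eq[OF s])
    then have lim: "(\<lambda>M. psi_partial M z) \<longlonglongrightarrow> psi_limit (1 + z)"
      unfolding sums_def psi_partial_def .
    have "(\<lambda>M. cmod (psi_partial M z - psi_partial N z)) \<longlonglongrightarrow> cmod (psi_limit (1 + z) - psi_partial N z)"
      by (intro tendsto_intros lim)
    then show "cmod (psi_limit (1 + z) - psi_partial N z) \<le> 4 * (real N + 1) powr (- Re z) / Re z"
    proof (rule LIMSEQ_le_const2, intro exI[of _ N] allI impI)
      fix M assume "N \<le> M"
      then have "cmod (psi_partial M z - psi_partial N z) \<le> 4 * (((real N + 1) powr (- Re z) - (real M + 1) powr (- Re z)) / Re z)"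
        using z \<open>z \<noteq> -1\<close> by (intro psi_partial_diff_bound) auto
      also have "\<dots> \<le> 4 * ((real N + 1) powr (- Re z) / Re z)"
        using z by (intro mult_left_mono divide_right_mono) auto
      finally show "cmod (psi_partial M z - psi_partial N z) \<le> 4 * (real N + 1) powr (- Re z) / Re z" by simp
    qed
  next
    fix N z assume z: "Re z < 0" "z \<noteq> -1"
    have "cmod (psi_partial N z - psi_partial 0 z) \<le> 4 * (((real 0 + 1) powr (- Re z) - (real N + 1) powr (- Re z)) / Re z)"
      using z by (intro psi_partial_diff_bound) auto
    also have "\<dots> = 4 * (((real N + 1) powr (- Re z) - 1) / (- Re z))"
      using z by (simp add: field_simps)
    also have "\<dots> \<le> 4 * ((real N + 1) powr (- Re z) / (- Re z))"
      using z by (intro mult_left_mono divide_right_mono) auto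
    finally show "cmod (psi_partial N z) \<le> 4 * (real N + 1) powr (- Re z) / (- Re z)"
      by (simp add: psi_partial_def)
  qed
  then show ?thesis by (rule convergentI)
qed

text \<open>At \<open>z = 0\<close> the term with index \<open>n\<close> is
  \<open>psi_err (Suc n)\<close> times the difference of the reciprocals of \<open>n + 1\<close> and
  \<open>n + 2\<close>.\<close>

lemma psi_err_sum_Cauchy:
  assumes "e > 0"
  obtains N0 where "\<And>M N. N0 \<le> M \<Longrightarrow> M \<le> N \<Longrightarrow> \<bar>\<Sum>k\<in>{M..<N}. psi_err (Suc k) / (real (Suc k) * real (Suc (Suc k)))\<bar> < e"
proof -
  define b where "b = (\<lambda>k. psi_err (Suc k) / (real (Suc k) * real (Suc (Suc k))))"
  have npow1: "npow n 1 = of_real (1 / real (Suc n))" for n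
  proof -
    have "npow n 1 = of_real (exp (- ln (real (Suc n))))" 
      unfolding npow_def using exp_of_real[of "- ln (real (Suc n))", where 'a = complex] by simp
    also have "exp (- ln (real (Suc n))) = 1 / real (Suc n)" by (simp add: exp_minus inverse_eq_divide)
    finally show ?thesis .
  qed
  have q1: "npow_quot n 1 = of_real (1 / (real (Suc n) * real (Suc (Suc n))))" for n
  proof -
    have "npow_quot n 1 = of_real (1 / real (Suc n) - 1 / real (Suc (Suc n)))"
      by (simp add: npow_quot_eq npow1)
    also have "1 / real (Suc n) - 1 / real (Suc (Suc n)) = 1 / (real (Suc n) * real (Suc (Suc n)))"
      by (simp add: field_simps)
    finally show ?thesis .
  qed
  have "psi_partial N 0 = of_real (\<Sum>k<N. b k)" for N
    unfolding psi_partial_def b_def by (simp add: q1)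
  then have "convergent (\<lambda>N. complex_of_real (\<Sum>k<N. b k))" using psi_partial_0_convergent by simp
  then obtain L where "(\<lambda>N. complex_of_real (\<Sum>k<N. b k)) \<longlonglongrightarrow> L"
    unfolding convergent_def by blast
  then have "(\<lambda>N. Re (complex_of_real (\<Sum>k<N. b k))) \<longlonglongrightarrow> Re L"
    by (rule tendsto_Re)
  then have "convergent (\<lambda>N. \<Sum>k<N. b k)" by (auto simp: convergent_def)
  then have "Cauchy (\<lambda>N. \<Sum>k<N. b k)" by (simp add: Cauchy_convergent_iff)
  then obtain N0 where N0: "\<And>m n. m \<ge> N0 \<Longrightarrow> n \<ge> N0 \<Longrightarrow> \<bar>(\<Sum>k<m. b k) - (\<Sum>k<n. b k)\<bar> < e"
    using assms unfolding Cauchy_def dist_real_def by meson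
  show ?thesis
  proof (rule that)
    fix M N assume MN: "N0 \<le> M" "M \<le> N"
    have "(\<Sum>k<N. b k) - (\<Sum>k<M. b k) = (\<Sum>k\<in>{M..<N}. b k)"
      using MN by (simp add: sum_diff_nat_ivl lessThan_atLeast0)
    then show "\<bar>\<Sum>k\<in>{M..<N}. psi_err (Suc k) / (real (Suc k) * real (Suc (Suc k)))\<bar> < e"
      using N0[of N M] MN by (simp add: b_def)
  qed
qed

text \<open>If \<open>\<bar>psi_err N\<bar> \<ge> \<epsilon> * N\<close>, then monotonicity of \<open>psi\<close> keeps \<open>psi_err\<close> large on a whole block next to \<open>N\<close>,
  which contributes a fixed amount to a convergent series.\<close>

lemma psi_err_eventually_small:
  assumes e: "0 < \<epsilon>" "\<epsilon> < 1"
  shows "\<forall>\<^sub>F N in sequentially. \<bar>psi_err N\<bar> < \<epsilon> * real N"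
proof -
  define b where "b = (\<lambda>k. psi_err (Suc k) / (real (Suc k) * real (Suc (Suc k))))"
  \<comment> \<open>The threshold is \<open>\<epsilon> * N / 4\<close>, a lower bound for the length
    of the block, times \<open>\<epsilon> / (8 * N)\<close>, a lower bound for each of its
    terms.\<close>
  obtain N0 where N0: "\<And>M N. N0 \<le> M \<Longrightarrow> M \<le> N \<Longrightarrow> \<bar>\<Sum>k\<in>{M..<N}. b k\<bar> < \<epsilon>\<^sup>2 / 32"
    using psi_err_sum_Cauchy[of "\<epsilon>\<^sup>2 / 32"] e unfolding b_def by auto
  show ?thesis
    using eventually_gt_at_top[of "2 * N0 + 1"] eventually_gt_at_top[of "nat \<lceil>4 / \<epsilon>\<rceil>"]
  proof eventually_elim
    case (elim N)
    have N: "real N > 4 / \<epsilon>" "real N > 0" "N > 2 * N0 + 1" using elim by linarith+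
    \<comment> \<open>Over \<open>m\<close> steps the subtracted identity in \<open>psi_err\<close>
      moves by at most \<open>\<epsilon> * N / 2\<close>, so at least half of the deviation
      survives.\<close>
    define m where "m = nat \<lfloor>\<epsilon> * real N / 2\<rfloor>"
    have eN: "\<epsilon> * real N > 4" using N e by (simp add: pos_divide_less_eq mult.commute)
    have m: "real m \<le> \<epsilon> * real N / 2" "real m \<ge> \<epsilon> * real N / 4"
      using eN unfolding m_def by linarith+
    have "\<epsilon> * real N \<le> 1 * real N" using e by (intro mult_right_mono) auto
    then have m2: "2 * m \<le> N" using m by linarith
    have low: "\<epsilon>\<^sup>2 / 32 \<le> real m * (\<epsilon> / (8 * real N))"
    proof -
      have "\<epsilon>\<^sup>2 / 32 = (\<epsilon> * real N / 4) * (\<epsilon> / (8 * real N))" using N by (simp add: power2_eq_square)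
      also have "\<dots> \<le> real m * (\<epsilon> / (8 * real N))" using m e by (intro mult_right_mono) auto
      finally show ?thesis .
    qed
    have frac: "\<epsilon> / (8 * real N) \<le> X / (real (Suc k) * real (Suc (Suc k)))"
      if "X \<ge> \<epsilon> * real N / 2" "Suc (Suc k) \<le> 2 * N" for X k
    proof -
      have "real (Suc k) * real (Suc (Suc k)) \<le> (2 * real N) * (2 * real N)"
        using that(2) by (intro mult_mono) linarith+
      moreover have "X \<ge> 0" using that(1) eN by linarith
      ultimately have "(\<epsilon> * real N / 2) / ((2 * real N) * (2 * real N)) \<le> X / (real (Suc k) * real (Suc (Suc k)))"
        using that e N by (intro frac_le) auto
      moreover have "(\<epsilon> * real N / 2) / ((2 * real N) * (2 * real N)) = \<epsilon> / (8 * real N)" using N by simp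
      ultimately show ?thesis by simp
    qed
    show ?case
    proof (rule ccontr)
      assume "\<not> \<bar>psi_err N\<bar> < \<epsilon> * real N"
      then consider "psi_err N \<ge> \<epsilon> * real N" | "psi_err N \<le> - (\<epsilon> * real N)" by linarith
      then show False
      proof cases
        case 1
        \<comment> \<open>A positive deviation persists to the right of \<open>N\<close>, a negative
          one to the left. The index \<open>k\<close> stands for \<open>Suc k\<close>, so this block
          starts at \<open>N - 1\<close>.\<close>
        have "real m * (\<epsilon> / (8 * real N)) = (\<Sum>k\<in>{N - 1..<N - 1 + m}. \<epsilon> / (8 * real N))" by simp
        also have "\<dots> \<le> (\<Sum>k\<in>{N - 1..<N - 1 + m}. b k)"
        proof (rule sum_mono)
          fix k assume k: "k \<in> {N - 1..<N - 1 + m}"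
          have "psi N \<le> psi (Suc k)" using k by (intro psi_mono) auto
          moreover have "real (Suc k) \<le> real N + real m" using k by auto
          ultimately have "psi_err (Suc k) \<ge> \<epsilon> * real N / 2" using 1 m unfolding psi_err_def by linarith
          then show "\<epsilon> / (8 * real N) \<le> b k" unfolding b_def using k m2 N by (intro frac) auto
        qed
        also have "\<dots> < \<epsilon>\<^sup>2 / 32" 
        proof -
          have "N0 \<le> N - 1" using N by linarith
          then have "\<bar>\<Sum>k\<in>{N - 1..<N - 1 + m}. b k\<bar> < \<epsilon>\<^sup>2 / 32" by (rule N0) simp
          then show ?thesis by linarith
        qed
        finally show False using low by simp
      next
        case 2
        have "real m * (\<epsilon> / (8 * real N)) = (\<Sum>k\<in>{N - m..<N}. \<epsilon> / (8 * real N))" using m2 by simp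
        also have "\<dots> \<le> (\<Sum>k\<in>{N - m..<N}. - b k)"
        proof (rule sum_mono)
          fix k assume k: "k \<in> {N - m..<N}"
          have "psi (Suc k) \<le> psi N" using k by (intro psi_mono) auto
          moreover have "real (Suc k) \<ge> real N - real m" using k m2 by auto
          ultimately have "- psi_err (Suc k) \<ge> \<epsilon> * real N / 2" using 2 m unfolding psi_err_def by linarith
          then have "\<epsilon> / (8 * real N) \<le> (- psi_err (Suc k)) / (real (Suc k) * real (Suc (Suc k)))"
            using k by (intro frac) auto
          then show "\<epsilon> / (8 * real N) \<le> - b k" unfolding b_def by simp
        qed
        also have "\<dots> = - (\<Sum>k\<in>{N - m..<N}. b k)" by (rule sum_negf)
        also have "\<dots> < \<epsilon>\<^sup>2 / 32" 
        proof -
          have "N0 \<le> N - m" using N m2 by linarith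
          then have "\<bar>\<Sum>k\<in>{N - m..<N}. b k\<bar> < \<epsilon>\<^sup>2 / 32" by (rule N0) simp
          then show ?thesis by linarith
        qed
        finally show False using low by simp
      qed
    qed
  qed
qed

lemma psi_asymptotic: "(\<lambda>n. psi n / real n) \<longlonglongrightarrow> 1"
proof (rule LIMSEQ_I)
  fix r :: real assume r: "r > 0"
  define \<epsilon> where "\<epsilon> = min r (1 / 2)"
  have e: "0 < \<epsilon>" "\<epsilon> < 1" "\<epsilon> \<le> r" using r by (auto simp: \<epsilon>_def)
  obtain N0 where N0: "\<And>n. n \<ge> N0 \<Longrightarrow> \<bar>psi_err n\<bar> < \<epsilon> * real n"
    using psi_err_eventually_small[OF e(1,2)] unfolding eventually_sequentially by blast
  show "\<exists>no. \<forall>n\<ge>no. norm (psi n / real n - 1) < r"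
  proof (intro exI[of _ "max N0 1"] allI impI)
    fix n assume n: "n \<ge> max N0 1"
    have "psi n / real n - 1 = psi_err n / real n" using n by (simp add: psi_err_def field_simps)
    then have "norm (psi n / real n - 1) = \<bar>psi_err n\<bar> / real n" by simp
    also have "\<dots> < \<epsilon>" using N0[of n] n by (simp add: pos_divide_less_eq)
    finally show "norm (psi n / real n - 1) < r" using e by simp
  qed
qed

section \<open>From \<open>psi\<close> to the number of primes\<close>

definition prime_count_nat :: "nat \<Rightarrow> nat" where
  "prime_count_nat n = card {p. prime p \<and> p \<le> n}"

lemma finite_primes_le_nat [simp]: "finite {p :: nat. prime p \<and> p \<le> n}"
  by (rule finite_subset[of _ "{..n}"]) auto

text \<open>A prime \<open>p\<close> has at most \<open>ln n / ln p\<close> powers up to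
  \<open>n\<close>, each of weight \<open>ln p\<close>, so it contributes at most
  \<open>ln n\<close>.\<close>

lemma psi_le_prime_count: "psi n \<le> real (prime_count_nat n) * ln (real n)"
proof -
  define P where "P = {p :: nat. prime p \<and> p \<le> n}"
  define A where "A = {k\<in>{1..n}. primepow k}"
  have fin: "finite P" "finite A" by (auto simp: P_def A_def)
  have pp: "\<exists>p j. prime p \<and> j > 0 \<and> k = p ^ j \<and> aprimedivisor k = p \<and> p \<le> n" if k: "k \<in> A" for k
  proof -
    obtain p j where pj: "prime p" "j > 0" "k = p ^ j" using k by (auto simp: A_def primepow_def)
    have "p \<le> p ^ j" using pj prime_gt_0_nat[of p] by (simp add: self_le_power)
    then have "p \<le> n" using k pj by (auto simp: A_def)
    then show ?thesis using pj aprimedivisor_prime_power[of p j] by auto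
  qed
  have "psi n = (\<Sum>k\<in>A. ln (real (aprimedivisor k)))"
    unfolding psi_def by (rule sum.mono_neutral_cong_right) (auto simp: A_def mangoldt_def)
  also have "\<dots> = (\<Sum>p\<in>P. \<Sum>k\<in>{k\<in>A. aprimedivisor k = p}. ln (real (aprimedivisor k)))"
    by (rule sum.group[symmetric]) (use fin pp in \<open>force simp: P_def\<close>)+
  also have "\<dots> \<le> (\<Sum>p\<in>P. ln (real n))"
  proof (rule sum_mono)
    fix p assume p: "p \<in> P"
    then have pr: "prime p" "p \<le> n" by (auto simp: P_def)
    have p2: "real p \<ge> 2" using prime_ge_2_nat[OF pr(1)] by simp
    then have lp: "ln (real p) > 0" by simp
    have n: "real n \<ge> 2" using p2 pr by linarith
    define J where "J = nat \<lfloor>ln (real n) / ln (real p)\<rfloor>"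
    have "{k\<in>A. aprimedivisor k = p} \<subseteq> (\<lambda>j. p ^ j) ` {1..J}"
    proof
      fix k assume k: "k \<in> {k\<in>A. aprimedivisor k = p}"
      then obtain j where j: "j > 0" "k = p ^ j" using pp[of k] by auto
      have "k \<le> n" using k by (auto simp: A_def)
      then have "real p ^ j \<le> real n" using j by (metis of_nat_le_iff of_nat_power)
      then have "ln (real p ^ j) \<le> ln (real n)" using p2 n by (subst ln_le_cancel_iff) auto
      then have "real j * ln (real p) \<le> ln (real n)" using p2 by (simp add: ln_realpow)
      then have "real j \<le> ln (real n) / ln (real p)" using lp by (simp add: pos_le_divide_eq)
      then have "j \<le> J" unfolding J_def by linarith
      then show "k \<in> (\<lambda>j. p ^ j) ` {1..J}" using j by auto
    qed
    then have "card {k\<in>A. aprimedivisor k = p} \<le> card ((\<lambda>j. p ^ j) ` {1..J})" by (intro card_mono) auto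
    also have "\<dots> \<le> J" using card_image_le[of "{1..J}" "\<lambda>j. p ^ j"] by simp
    finally have c: "real (card {k\<in>A. aprimedivisor k = p}) \<le> real J" by simp
    have "(\<Sum>k\<in>{k\<in>A. aprimedivisor k = p}. ln (real (aprimedivisor k))) = real (card {k\<in>A. aprimedivisor k = p}) * ln (real p)"
      by simp
    also have "\<dots> \<le> real J * ln (real p)" using c lp by (intro mult_right_mono) auto
    also have "real J \<le> ln (real n) / ln (real p)" unfolding J_def using lp n by simp
    then have "real J * ln (real p) \<le> ln (real n)" using lp by (simp add: pos_le_divide_eq)
    finally show "(\<Sum>k\<in>{k\<in>A. aprimedivisor k = p}. ln (real (aprimedivisor k))) \<le> ln (real n)" .
  qed
  also have "\<dots> = real (prime_count_nat n) * ln (real n)" by (simp add: prime_count_nat_def P_def)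
  finally show ?thesis .
qed

text \<open>At most \<open>n powr \<alpha>\<close> primes are small, and every other one contributes
  at least \<open>\<alpha> * ln n\<close> to \<open>psi n\<close>.\<close>

lemma prime_count_le_psi:
  assumes \<alpha>: "0 < \<alpha>" and n: "n \<ge> 2"
  shows "\<alpha> * ln (real n) * (real (prime_count_nat n) - real n powr \<alpha>) \<le> psi n"
proof -
  define P where "P = {p :: nat. prime p \<and> p \<le> n}"
  define Q where "Q = {p\<in>P. real p \<le> real n powr \<alpha>}"
  have fin: "finite P" "finite Q" by (auto simp: P_def Q_def)
  have "Q \<subseteq> {1..nat \<lfloor>real n powr \<alpha>\<rfloor>}"
    by (auto simp: Q_def P_def le_nat_floor prime_gt_0_nat Suc_le_eq)
  then have "card Q \<le> card {1..nat \<lfloor>real n powr \<alpha>\<rfloor>}" by (intro card_mono) auto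
  then have cQ: "real (card Q) \<le> real n powr \<alpha>" by (simp add: le_nat_iff) linarith
  have "card P = card Q + card (P - Q)" using fin by (simp add: card_Diff_subset Q_def card_mono)
  then have "real (prime_count_nat n) - real n powr \<alpha> \<le> real (card (P - Q))"
    using cQ by (simp add: prime_count_nat_def P_def)
  then have "\<alpha> * ln (real n) * (real (prime_count_nat n) - real n powr \<alpha>) \<le> \<alpha> * ln (real n) * real (card (P - Q))"
    using \<alpha> n by (intro mult_left_mono) auto
  also have "\<dots> = (\<Sum>p\<in>P - Q. \<alpha> * ln (real n))" by simp
  also have "\<dots> \<le> (\<Sum>p\<in>P - Q. mangoldt p)"
  proof (rule sum_mono)
    fix p assume p: "p \<in> P - Q"
    then have "prime p" "real n powr \<alpha> < real p" by (auto simp: P_def Q_def)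
    then have "ln (real n powr \<alpha>) \<le> ln (real p)" using n prime_gt_0_nat[of p] by (subst ln_le_cancel_iff) auto
    then show "\<alpha> * ln (real n) \<le> mangoldt p" using \<open>prime p\<close> n by (simp add: ln_powr)
  qed
  also have "\<dots> \<le> psi n"
    unfolding psi_def by (rule sum_mono2) (auto simp: P_def mangoldt_nonneg prime_gt_0_nat Suc_le_eq)
  finally show ?thesis .
qed

lemma prime_count_nat_asymptotic: "(\<lambda>n. real (prime_count_nat n) * ln (real n) / real n) \<longlonglongrightarrow> 1"
proof (rule order_tendstoI)
  fix l :: real assume "l < 1"
  then have "\<forall>\<^sub>F n in sequentially. l < psi n / real n" using psi_asymptotic by (rule order_tendstoD(1)[rotated])
  then show "\<forall>\<^sub>F n in sequentially. l < real (prime_count_nat n) * ln (real n) / real n"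
  proof eventually_elim
    case (elim n)
    have "psi n / real n \<le> real (prime_count_nat n) * ln (real n) / real n"
      by (intro divide_right_mono psi_le_prime_count) auto
    then show ?case using elim by linarith
  qed
next
  fix u :: real assume u: "1 < u"
  \<comment> \<open>Then \<open>1 / \<alpha> = (1 + u) / 2\<close> lies strictly between 1 and
    \<open>u\<close>.\<close>
  define \<alpha> where "\<alpha> = 2 / (1 + u)"
  have \<alpha>: "0 < \<alpha>" "\<alpha> < 1" "1 / \<alpha> < u" using u by (auto simp: \<alpha>_def field_simps)
  have "(\<lambda>n::nat. ln (real n) * real n powr \<alpha> / real n) \<longlonglongrightarrow> 0" using \<alpha> by real_asymp
  then have "(\<lambda>n. (1 / \<alpha>) * (psi n / real n) + ln (real n) * real n powr \<alpha> / real n) \<longlonglongrightarrow> (1 / \<alpha>) * 1 + 0"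
    by (intro tendsto_intros psi_asymptotic)
  then have "\<forall>\<^sub>F n in sequentially. (1 / \<alpha>) * (psi n / real n) + ln (real n) * real n powr \<alpha> / real n < u"
    using \<alpha> by (intro order_tendstoD(2)) auto
  then show "\<forall>\<^sub>F n in sequentially. real (prime_count_nat n) * ln (real n) / real n < u"
    using eventually_ge_at_top[of 2]
  proof eventually_elim
    case (elim n)
    have "ln (real n) * (real (prime_count_nat n) - real n powr \<alpha>) \<le> psi n / \<alpha>"
      using prime_count_le_psi[OF \<alpha>(1) elim(2)] \<alpha> by (simp add: pos_le_divide_eq mult_ac)
    then have "real (prime_count_nat n) * ln (real n) \<le> psi n / \<alpha> + ln (real n) * real n powr \<alpha>"
      by (simp add: algebra_simps)
    then have "real (prime_count_nat n) * ln (real n) / real n \<le> (psi n / \<alpha> + ln (real n) * real n powr \<alpha>) / real n"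
      by (intro divide_right_mono) auto
    also have "\<dots> = (1 / \<alpha>) * (psi n / real n) + ln (real n) * real n powr \<alpha> / real n"
      by (simp add: add_divide_distrib)
    finally show ?case using elim by linarith
  qed
qed

definition prime_count :: "real \<Rightarrow> nat" where
  "prime_count x = card {p :: int. prime p \<and> real_of_int p \<le> x}"

theorem prime_number_theorem: "((\<lambda>x. real (prime_count x) * ln x / x) \<longlongrightarrow> 1) at_top"
proof -
  have eq: "prime_count x = prime_count_nat (nat \<lfloor>x\<rfloor>)" if "x \<ge> 0" for x
  proof -
    have "{p :: int. prime p \<and> real_of_int p \<le> x} = int ` {p. prime p \<and> p \<le> nat \<lfloor>x\<rfloor>}"
    proof (intro equalityI subsetI)
      fix p assume "p \<in> {p :: int. prime p \<and> real_of_int p \<le> x}"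
      then have p: "prime p" "p \<le> \<lfloor>x\<rfloor>" by (auto simp: le_floor_iff)
      then have "p = int (nat p)" using prime_ge_0_int[of p] by simp
      moreover from this p have "prime (nat p)" "nat p \<le> nat \<lfloor>x\<rfloor>" by (metis prime_int_nat_transfer, simp add: nat_mono)
      ultimately show "p \<in> int ` {p. prime p \<and> p \<le> nat \<lfloor>x\<rfloor>}" by blast
    next
      fix p assume "p \<in> int ` {p. prime p \<and> p \<le> nat \<lfloor>x\<rfloor>}"
      then obtain q where q: "p = int q" "prime q" "q \<le> nat \<lfloor>x\<rfloor>" by blast
      then have "real q \<le> x" using that by linarith
      then show "p \<in> {p :: int. prime p \<and> real_of_int p \<le> x}" using q by simp
    qed
    then show ?thesis unfolding prime_count_def prime_count_nat_def by (simp add: card_image)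
  qed
  have "filterlim (\<lambda>x::real. nat \<lfloor>x\<rfloor>) sequentially at_top"
    by (intro filterlim_compose[OF filterlim_nat_sequentially filterlim_floor_sequentially])
  then have 1: "((\<lambda>x::real. real (prime_count_nat (nat \<lfloor>x\<rfloor>)) * ln (real (nat \<lfloor>x\<rfloor>)) / real (nat \<lfloor>x\<rfloor>)) \<longlongrightarrow> 1) at_top"
    by (rule filterlim_compose[OF prime_count_nat_asymptotic])
  have 2: "((\<lambda>x::real. (ln x / ln (real_of_int \<lfloor>x\<rfloor>)) * (real_of_int \<lfloor>x\<rfloor> / x)) \<longlongrightarrow> 1) at_top"
    by real_asymp
  have "((\<lambda>x::real. real (prime_count_nat (nat \<lfloor>x\<rfloor>)) * ln (real (nat \<lfloor>x\<rfloor>)) / real (nat \<lfloor>x\<rfloor>) *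
      ((ln x / ln (real_of_int \<lfloor>x\<rfloor>)) * (real_of_int \<lfloor>x\<rfloor> / x))) \<longlongrightarrow> 1 * 1) at_top"
    by (intro tendsto_mult 1 2)
  moreover have "\<forall>\<^sub>F x::real in at_top. real (prime_count_nat (nat \<lfloor>x\<rfloor>)) * ln (real (nat \<lfloor>x\<rfloor>)) / real (nat \<lfloor>x\<rfloor>) *
      ((ln x / ln (real_of_int \<lfloor>x\<rfloor>)) * (real_of_int \<lfloor>x\<rfloor> / x)) = real (prime_count x) * ln x / x"
    using eventually_ge_at_top[of 2]
  proof eventually_elim
    case (elim x)
    define n where "n = real_of_int \<lfloor>x\<rfloor>"
    have n: "real (nat \<lfloor>x\<rfloor>) = n" "n \<ge> 2" using elim by (auto simp: n_def le_floor_iff)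
    then have "ln n > 0" by simp
    then show ?case using n elim unfolding n_def[symmetric] eq[OF order_trans[OF _ elim], simplified] by simp
  qed
  ultimately show ?thesis by (auto elim: Lim_transform_eventually)
qed

section \<open>Representations as a prime plus an integer part\<close>

lemma prime_count_mono: "x \<le> z \<Longrightarrow> prime_count x \<le> prime_count z"
  unfolding prime_count_def by (rule card_mono) auto

lemma C0_nonneg: "C0 \<ge> 0"
proof -
  have "\<forall>\<^sub>F x in at_top. 0 \<le> (SUP h \<in> UNIV - {0 :: int}. ereal ((ln x)\<^sup>2 / (x * W h) * real (prime_pair_count h x)))"
    using eventually_gt_at_top[of 0]
  proof eventually_elim
    case (elim x)
    have "0 \<le> ereal ((ln x)\<^sup>2 / (x * W 1) * real (prime_pair_count 1 x))"
      using elim W_pos[of 1] by simp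
    also have "\<dots> \<le> (SUP h \<in> UNIV - {0 :: int}. ereal ((ln x)\<^sup>2 / (x * W h) * real (prime_pair_count h x)))"
      by (rule SUP_upper) auto
    finally show ?case .
  qed
  then have "0 \<le> Liminf at_top (\<lambda>x. SUP h \<in> UNIV - {0 :: int}. ereal ((ln x)\<^sup>2 / (x * W h) * real (prime_pair_count h x)))"
    by (rule Liminf_bounded)
  also have "\<dots> \<le> C0"
    unfolding C0_def by (rule Liminf_le_Limsup) simp
  finally show ?thesis .
qed

text \<open>The supremum over \<open>h\<close> stands inside the limit superior, so one threshold
  for \<open>x\<close> serves all \<open>h\<close>.\<close>

lemma prime_pair_count_eventually_le:
  assumes "C0 = ereal c" "e > 0"
  shows "\<forall>\<^sub>F x in at_top. \<forall>h. h \<noteq> 0 \<longrightarrow> real (prime_pair_count h x) \<le> (c + e) * x * W h / (ln x)\<^sup>2"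
proof -
  have "C0 < ereal (c + e)" unfolding assms(1) using assms(2) by simp
  then have "\<forall>\<^sub>F x in at_top. (SUP h \<in> UNIV - {0 :: int}. ereal ((ln x)\<^sup>2 / (x * W h) * real (prime_pair_count h x))) < ereal (c + e)"
    unfolding C0_def by (rule Limsup_lessD)
  then show ?thesis using eventually_gt_at_top[of 1]
  proof eventually_elim
    case (elim x)
    show ?case
    proof (intro allI impI)
      fix h :: int assume "h \<noteq> 0"
      then have "ereal ((ln x)\<^sup>2 / (x * W h) * real (prime_pair_count h x)) \<le>
          (SUP h \<in> UNIV - {0 :: int}. ereal ((ln x)\<^sup>2 / (x * W h) * real (prime_pair_count h x)))"
        by (intro SUP_upper) auto
      then have "ereal ((ln x)\<^sup>2 / (x * W h) * real (prime_pair_count h x)) < ereal (c + e)"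
        using elim(1) by (rule order_le_less_trans)
      then have "(ln x)\<^sup>2 / (x * W h) * real (prime_pair_count h x) \<le> c + e" by simp
      moreover have "x * W h > 0" "(ln x)\<^sup>2 > 0" using elim W_pos[of h] by auto
      ultimately show "real (prime_pair_count h x) \<le> (c + e) * x * W h / (ln x)\<^sup>2"
        by (simp add: field_simps)
    qed
  qed
qed

text \<open>The fibre sizes sum to \<open>card R\<close>, and their squares sum to the number of
  colliding pairs.\<close>

lemma card_image_Cauchy_Schwarz:
  assumes "finite R"
  shows "(real (card R))\<^sup>2 \<le> real (card (s ` R)) * real (card {(a, b) \<in> R \<times> R. s a = s b})"
proof -
  define T where "T = s ` R"
  define c where "c = (\<lambda>t. \<Sum>a\<in>R. of_bool (s a = t) :: real)"
  have T: "finite T" using assms by (simp add: T_def)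
  have 1: "(\<Sum>t\<in>T. of_bool (s a = t)) = (1::real)" if "a \<in> R" for a
    using T that by (simp add: of_bool_def sum.delta' T_def)
  have "(\<Sum>t\<in>T. c t) = (\<Sum>a\<in>R. \<Sum>t\<in>T. of_bool (s a = t))" unfolding c_def by (rule sum.swap)
  then have sc: "(\<Sum>t\<in>T. c t) = card R" by (simp add: 1)
  have "(\<Sum>t\<in>T. (c t)\<^sup>2) = (\<Sum>t\<in>T. \<Sum>(a, b)\<in>R \<times> R. of_bool (s a = t) * of_bool (s b = t))"
    unfolding c_def by (simp add: power2_eq_square sum_product sum.cartesian_product)
  also have "\<dots> = (\<Sum>(a, b)\<in>R \<times> R. \<Sum>t\<in>T. of_bool (s a = t) * of_bool (s b = t))"
    by (subst sum.swap) (simp add: case_prod_beta)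
  also have "\<dots> = (\<Sum>(a, b)\<in>R \<times> R. of_bool (s a = s b))"
  proof (intro sum.cong refl, clarify)
    fix a b assume ab: "a \<in> R" "b \<in> R"
    have "(\<Sum>t\<in>T. of_bool (s a = t) * of_bool (s b = t)) = (\<Sum>t\<in>T. of_bool (s a = t) * of_bool (s a = s b) :: real)"
      by (intro sum.cong) auto
    also have "\<dots> = of_bool (s a = s b)" using 1[OF ab(1)] by (simp flip: sum_distrib_right)
    finally show "(\<Sum>t\<in>T. of_bool (s a = t) * of_bool (s b = t)) = (of_bool (s a = s b) :: real)" .
  qed
  also have "\<dots> = real (card {(a, b) \<in> R \<times> R. s a = s b})"
    using assms by (simp add: case_prod_beta) (rule arg_cong[where f = card], auto)
  finally have sq: "(\<Sum>t\<in>T. (c t)\<^sup>2) = real (card {(a, b) \<in> R \<times> R. s a = s b})" .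
  have "(\<Sum>t\<in>T. 1 * c t)\<^sup>2 \<le> (\<Sum>t\<in>T. 1\<^sup>2) * (\<Sum>t\<in>T. (c t)\<^sup>2)"
    by (rule Cauchy_Schwarz_ineq_sum)
  then show ?thesis unfolding sq mult_1 sc by (simp add: T_def)
qed

section \<open>Counting representations and collisions\<close>

definition log_floor :: "real \<Rightarrow> nat \<Rightarrow> nat" where
  "log_floor y N = nat \<lfloor>log y (real N)\<rfloor>"

lemma log_floor_tendsto:
  assumes "y > 1"
  shows "(\<lambda>N. real (log_floor y N) / ln (real N)) \<longlonglongrightarrow> 1 / ln y"
proof -
  have "ln y > 0" using assms by simp
  then have "(\<lambda>N::nat. (ln (real N) / ln y - 1) / ln (real N)) \<longlonglongrightarrow> 1 / ln y"
     "(\<lambda>N::nat. (ln (real N) / ln y) / ln (real N)) \<longlonglongrightarrow> 1 / ln y"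
    by (real_asymp simp: field_simps)+
  then show ?thesis
  proof (rule tendsto_sandwich[rotated 2])
    have *: "real (log_floor y N) \<le> ln (real N) / ln y" "ln (real N) / ln y - 1 \<le> real (log_floor y N)" if "N \<ge> 2" for N
    proof -
      have "log y (real N) \<ge> 0" using that assms by simp
      then show "real (log_floor y N) \<le> ln (real N) / ln y" "ln (real N) / ln y - 1 \<le> real (log_floor y N)"
        unfolding log_floor_def log_def by linarith+
    qed
    show "\<forall>\<^sub>F N in sequentially. (ln (real N) / ln y - 1) / ln (real N) \<le> real (log_floor y N) / ln (real N)"
      using eventually_ge_at_top[of 2] by eventually_elim (auto intro!: divide_right_mono *)
    show "\<forall>\<^sub>F N in sequentially. real (log_floor y N) / ln (real N) \<le> (ln (real N) / ln y) / ln (real N)"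
      using eventually_ge_at_top[of 2] by eventually_elim (rule divide_right_mono, auto intro!: *)
  qed
qed

lemma log_floor_power_le:
  assumes "y > 1" "N \<ge> 1"
  shows "y ^ log_floor y N \<le> real N"
proof -
  have "log y (real N) \<ge> 0" using assms by simp
  then have "real (log_floor y N) \<le> log y (real N)" unfolding log_floor_def by linarith
  then have "y powr real (log_floor y N) \<le> y powr log y (real N)" using assms by (intro powr_mono) auto
  then show ?thesis using assms by (simp add: powr_realpow)
qed

lemma log_floor_at_top:
  assumes "y > 1"
  shows "filterlim (log_floor y) at_top sequentially"
proof -
  have "filterlim (\<lambda>N. real (log_floor y N) / ln (real N) * ln (real N)) at_top sequentially"
    using assms by (intro filterlim_tendsto_pos_mult_at_top[OF log_floor_tendsto]) (auto, real_asymp)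
  moreover have "\<forall>\<^sub>F N in sequentially. real (log_floor y N) / ln (real N) * ln (real N) = real (log_floor y N)"
    using eventually_ge_at_top[of 2] by eventually_elim simp
  ultimately have "filterlim (\<lambda>N. real (log_floor y N)) at_top sequentially"
    by (rule filterlim_cong[THEN iffD1, rotated -1, OF _ refl refl])
  then show ?thesis by (simp add: filterlim_sequentially_iff_filterlim_real)
qed

definition reps :: "real \<Rightarrow> nat \<Rightarrow> (int \<times> nat) set" where
  "reps y N = (SIGMA p:{p. prime p}. {k\<in>{1..log_floor y N}. p + \<lfloor>y ^ k\<rfloor> \<le> int N})"

definition rep_val :: "real \<Rightarrow> int \<times> nat \<Rightarrow> int" where
  "rep_val y = (\<lambda>(p, k). p + \<lfloor>y ^ k\<rfloor>)"

lemma floor_power_pos: "y > 1 \<Longrightarrow> \<lfloor>(y::real) ^ k\<rfloor> \<ge> 1"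
  using one_le_power[of y k] by simp

lemma reps_subset:
  assumes "y > 1"
  shows "reps y N \<subseteq> {p. prime p \<and> real_of_int p \<le> real N} \<times> {1..log_floor y N}"
proof -
  have "real_of_int p \<le> real N" if "p + \<lfloor>y ^ k\<rfloor> \<le> int N" for p k
    using floor_power_pos[OF assms, of k] that by linarith
  then show ?thesis by (auto simp: reps_def)
qed

lemma finite_reps: "y > 1 \<Longrightarrow> finite (reps y N)"
  by (rule finite_subset[OF reps_subset]) auto

lemma card_reps: 
  assumes "y > 1"
  shows "card (reps y N) = (\<Sum>k=1..log_floor y N. prime_count (real N - \<lfloor>y ^ k\<rfloor>))"
proof -
  have "card (reps y N) = card (prod.swap ` reps y N)" by (rule card_image[symmetric]) auto
  also have "prod.swap ` reps y N = (SIGMA k:{1..log_floor y N}. {p. prime p \<and> real_of_int p \<le> real N - \<lfloor>y ^ k\<rfloor>})"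
    by (force simp: reps_def image_iff)
  also have "card \<dots> = (\<Sum>k=1..log_floor y N. prime_count (real N - \<lfloor>y ^ k\<rfloor>))"
    by (subst card_SigmaI) (auto simp: prime_count_def)
  finally show ?thesis .
qed

text \<open>For exponents at least \<open>m\<close> below the maximum, the power is at most
  \<open>N / y ^ m\<close>, so nearly all primes up to \<open>N\<close> remain available. Here
  \<open>m\<close> is fixed while \<open>N\<close> grows and is sent to infinity afterwards.\<close>

lemma card_reps_ge:
  assumes y: "y > 1" and N: "N \<ge> 1"
  shows "real (card (reps y N)) \<ge> (real (log_floor y N) - real m) * real (prime_count ((1 - 1 / y ^ m) * real N))"
proof (cases "m \<le> log_floor y N")
  case True
  define K where "K = log_floor y N"
  have "(K - m) * prime_count ((1 - 1 / y ^ m) * real N) = (\<Sum>k=1..K - m. prime_count ((1 - 1 / y ^ m) * real N))"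
    by simp
  also have "\<dots> \<le> (\<Sum>k=1..K - m. prime_count (real N - \<lfloor>y ^ k\<rfloor>))"
  proof (intro sum_mono prime_count_mono)
    fix k assume k: "k \<in> {1..K - m}"
    have "real_of_int \<lfloor>y ^ k\<rfloor> * y ^ m \<le> y ^ k * y ^ m" using y by (intro mult_right_mono) auto
    also have "\<dots> = y ^ (k + m)" by (simp add: power_add)
    also have "\<dots> \<le> y ^ K" using y k True by (intro power_increasing) (auto simp: K_def)
    also have "\<dots> \<le> real N" unfolding K_def by (rule log_floor_power_le[OF y N])
    finally have "real_of_int \<lfloor>y ^ k\<rfloor> \<le> real N / y ^ m" using y by (simp add: pos_le_divide_eq)
    then show "(1 - 1 / y ^ m) * real N \<le> real N - real_of_int \<lfloor>y ^ k\<rfloor>" by (simp add: algebra_simps)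
  qed
  also have "\<dots> \<le> card (reps y N)"
    unfolding card_reps[OF y] K_def by (rule sum_mono2) auto
  finally have "real (K - m) * real (prime_count ((1 - 1 / y ^ m) * real N)) \<le> real (card (reps y N))"
    by (metis of_nat_le_iff of_nat_mult)
  then show ?thesis using True by (simp add: K_def of_nat_diff)
next
  case False
  then have "(real (log_floor y N) - real m) * real (prime_count ((1 - 1 / y ^ m) * real N)) \<le> 0"
    by (intro mult_nonpos_nonneg) auto
  then show ?thesis by (simp add: order_trans[OF _ of_nat_0_le_iff])
qed

text \<open>Consecutive powers differ by \<open>y ^ (l - 1) * (y - 1)\<close>, which exceeds 1 from
  some exponent on. Coincidences do occur for \<open>y\<close> close to 1.\<close>

lemma floor_power_coincidences_finite:
  assumes y: "y > 1"
  shows "finite {(k, l). k \<noteq> l \<and> \<lfloor>(y::real) ^ k\<rfloor> = \<lfloor>y ^ l\<rfloor>}"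
proof -
  obtain m where m: "1 / (y - 1) < y ^ m" using real_arch_pow[OF y] by blast
  have *: "l \<le> m" if "k < l" "\<lfloor>y ^ k\<rfloor> = \<lfloor>y ^ l\<rfloor>" for k l
  proof (rule ccontr)
    assume "\<not> l \<le> m"
    then have l: "m \<le> l - 1" "k \<le> l - 1" "l = Suc (l - 1)" using that by auto
    have "y ^ m * (y - 1) > 1" using m y by (simp add: pos_divide_less_eq)
    also have "y ^ m * (y - 1) \<le> y ^ (l - 1) * (y - 1)"
      using y l by (intro mult_right_mono power_increasing) auto
    also have "\<dots> = y ^ l - y ^ (l - 1)" using power_Suc[of y "l - 1"] l by (simp add: algebra_simps)
    also have "\<dots> \<le> y ^ l - y ^ k" using y l by (intro diff_left_mono power_increasing) auto
    finally show False using that(2) by linarith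
  qed
  have "{(k, l). k \<noteq> l \<and> \<lfloor>y ^ k\<rfloor> = \<lfloor>y ^ l\<rfloor>} \<subseteq> {..m} \<times> {..m}"
  proof clarify
    fix k l assume "k \<noteq> l" "\<lfloor>y ^ k\<rfloor> = \<lfloor>y ^ l\<rfloor>"
    then show "k \<in> {..m} \<and> l \<in> {..m}" using *[of k l] *[of l k] by (cases "k < l") auto
  qed
  then show ?thesis by (rule finite_subset) auto
qed

text \<open>Sorted by the difference of the two integer parts: zero with equal exponents, zero with
  distinct exponents (finitely many pairs), odd (at most two primes each), and nonzero even, where
  the prime pair bound applies.\<close>

lemma card_collisions_le:
  fixes y :: real
  assumes y: "y > 1"
  defines "Z \<equiv> card {(k, l). k \<noteq> l \<and> \<lfloor>y ^ k\<rfloor> = \<lfloor>y ^ l\<rfloor>}"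
  assumes c: "\<And>h. h \<noteq> 0 \<Longrightarrow> real (prime_pair_count h N) \<le> c * W h"
  shows "real (card {(a, b) \<in> reps y N \<times> reps y N. rep_val y a = rep_val y b}) \<le>
    real (log_floor y N) * prime_count N + real Z * prime_count N + 2 * (real (log_floor y N))\<^sup>2 + c * W_sum (log_floor y N) y"
proof -
  define K where "K = log_floor y N"
  define f where "f = (\<lambda>k. \<lfloor>y ^ k\<rfloor>)"
  define X where "X = (\<lambda>(k, l). {p. prime p \<and> real_of_int p \<le> real N \<and> prime (p + (f l - f k))})"
  define b where "b = (\<lambda>(k::nat, l). if k = l then real (prime_count N) else 0)"
  define b' where "b' = (\<lambda>(k::nat, l). if k \<noteq> l \<and> f k = f l then real (prime_count N) else 0)"
  define w where "w = (\<lambda>(k, l). let h = f l - f k in if h \<noteq> 0 \<and> even h then W h else 0)"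
  have finX: "finite (X q)" for q
    by (rule finite_subset[OF _ finite_primes_le[of "real N"]]) (auto simp: X_def)
  \<comment> \<open>\<open>q\<close> is determined by the other three entries. The exponents are
    swapped so that the shift in \<open>X\<close> is \<open>q - p\<close>.\<close>
  define g where "g = (\<lambda>((p, k), (q :: int, l)). ((l :: nat, k :: nat), p :: int))"
  define Q where "Q = {(a, b) \<in> reps y N \<times> reps y N. rep_val y a = rep_val y b}"
  have "inj_on g Q"
    by (rule inj_onI) (auto simp: Q_def g_def rep_val_def)
  moreover have "g ` Q \<subseteq> (SIGMA q:{1..K} \<times> {1..K}. X q)"
  proof
    fix x assume "x \<in> g ` Q"
    then obtain p k q l where x: "x = g ((p, k), (q, l))" and "((p, k), (q, l)) \<in> Q" by force
    then have *: "(p, k) \<in> reps y N" "(q, l) \<in> reps y N" "p + f k = q + f l"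
      by (auto simp: Q_def rep_val_def f_def)
    have "q = p + (f k - f l)" using * by simp
    moreover have "prime p" "prime q" "k \<in> {1..K}" "l \<in> {1..K}" "real_of_int p \<le> real N"
      using * reps_subset[OF y, of N] by (auto simp: K_def reps_def)
    ultimately show "x \<in> (SIGMA q:{1..K} \<times> {1..K}. X q)"
      unfolding x g_def X_def by simp
  qed
  ultimately have "card Q \<le> card (SIGMA q:{1..K} \<times> {1..K}. X q)"
    by (intro card_inj_on_le[of g]) (auto simp: finX)
  also have "\<dots> = (\<Sum>q\<in>{1..K} \<times> {1..K}. card (X q))"
    by (rule card_SigmaI) (auto simp: finX)
  finally have "real (card Q) \<le> (\<Sum>q\<in>{1..K} \<times> {1..K}. real (card (X q)))"
    by (metis of_nat_le_iff of_nat_sum)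
  also have "\<dots> \<le> (\<Sum>q\<in>{1..K} \<times> {1..K}. b q + b' q + 2 + c * w q)"
  proof (rule sum_mono, clarify)
    fix k l assume "k \<in> {1..K}" "l \<in> {1..K}"
    define h where "h = f l - f k"
    have c0: "c \<ge> 0"
      using c[of 1] W_pos[of 1] by (metis of_nat_0_le_iff order_trans zero_le_mult_iff not_less one_neq_zero)
    have cw: "c * w (k, l) \<ge> 0" using c0 W_pos[THEN less_imp_le] by (auto simp: w_def Let_def)
    have Xh: "X (k, l) = {p. prime p \<and> real_of_int p \<le> real N \<and> prime (p + h)}" by (simp add: X_def h_def)
    consider "h = 0" "k = l" | "h = 0" "k \<noteq> l" | "odd h" | "h \<noteq> 0" "even h" by blast
    then show "real (card (X (k, l))) \<le> b (k, l) + b' (k, l) + 2 + c * w (k, l)"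
    proof cases
      case 1
      then have "card (X (k, l)) = prime_count N"
        unfolding Xh prime_count_def by (intro arg_cong[where f = card]) auto
      then show ?thesis using 1 cw by (simp add: b_def b'_def)
    next
      case 2
      then have "card (X (k, l)) = prime_count N"
        unfolding Xh prime_count_def by (intro arg_cong[where f = card]) auto
      moreover have "f k = f l" using 2 by (simp add: h_def)
      ultimately show ?thesis using 2 cw by (simp add: b_def b'_def)
    next
      case 3
      then have "card (X (k, l)) \<le> 2" unfolding Xh by (rule prime_pairs_odd_difference)
      moreover have "b (k, l) \<ge> 0" "b' (k, l) \<ge> 0" by (auto simp: b_def b'_def)
      ultimately show ?thesis using cw by linarith
    next
      case 4
      have "real (card (X (k, l))) \<le> c * W h"
        using c[OF 4(1)] unfolding Xh prime_pair_count_def by simp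
      moreover have "w (k, l) = W h" unfolding w_def prod.case h_def[symmetric] Let_def using 4 by simp
      moreover have "b (k, l) \<ge> 0" "b' (k, l) \<ge> 0" by (auto simp: b_def b'_def)
      ultimately show ?thesis by simp
    qed
  qed
  also have "\<dots> = (\<Sum>q\<in>{1..K} \<times> {1..K}. b q) + (\<Sum>q\<in>{1..K} \<times> {1..K}. b' q) + 2 * (real K)\<^sup>2 + c * (\<Sum>q\<in>{1..K} \<times> {1..K}. w q)"
    by (simp add: sum.distrib sum_distrib_left power2_eq_square)
  also have "(\<Sum>q\<in>{1..K} \<times> {1..K}. b q) = real K * prime_count N"
    unfolding b_def by (simp add: sum.cartesian_product[symmetric])
  also have "(\<Sum>q\<in>{1..K} \<times> {1..K}. b' q) \<le> real Z * prime_count N"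
  proof -
    have Zf: "finite {(k, l). k \<noteq> l \<and> f k = f l}" unfolding f_def by (rule floor_power_coincidences_finite[OF y])
    have "(\<Sum>q\<in>{1..K} \<times> {1..K}. b' q) = (\<Sum>q\<in>{(k, l)\<in>{1..K} \<times> {1..K}. k \<noteq> l \<and> f k = f l}. real (prime_count N))"
      unfolding b'_def by (rule sum.mono_neutral_cong_right) (auto split: if_splits)
    also have "\<dots> = real (card {(k, l)\<in>{1..K} \<times> {1..K}. k \<noteq> l \<and> f k = f l}) * prime_count N" by simp
    also have "\<dots> \<le> real Z * prime_count N"
      unfolding Z_def f_def[symmetric] using Zf
      by (intro mult_right_mono of_nat_mono card_mono) (auto simp: f_def)
    finally show ?thesis .
  qed
  also have "(\<Sum>q\<in>{1..K} \<times> {1..K}. w q) = W_sum K y"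
    unfolding w_def W_sum_def f_def by (simp add: sum.cartesian_product)
  finally show ?thesis by (simp add: Q_def K_def)
qed

lemma rep_val_subset: "y > 1 \<Longrightarrow> rep_val y ` reps y N \<subseteq> S y \<inter> {1..int N}"
proof clarify
  fix p k assume y: "y > 1" and "(p, k) \<in> reps y N"
  then have "prime p" "k \<ge> 1" "p + \<lfloor>y ^ k\<rfloor> \<le> int N" by (auto simp: reps_def)
  moreover have "p + \<lfloor>y ^ k\<rfloor> \<ge> 1" using floor_power_pos[OF y, of k] prime_ge_0_int[OF \<open>prime p\<close>] by linarith
  ultimately show "rep_val y (p, k) \<in> S y \<inter> {1..int N}"
    by (auto simp: rep_val_def S_def)
qed

text \<open>With about \<open>N / L\<close> representations for \<open>L = ln y\<close> and about
  \<open>U N * N\<close> collisions at most, Cauchy--Schwarz bounds the proportion of represented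
  integers by \<open>(V N)^2 / U N\<close> from below.\<close>

lemma S_density_ge:
  assumes y: "y > 1" and C: "C0 = ereal c"
    and W: "\<And>\<epsilon>. \<epsilon> > 0 \<Longrightarrow> \<forall>\<^sub>F K in sequentially. W_sum K y \<le> (9 / pi\<^sup>2 + \<epsilon>) * (real K)\<^sup>2"
  shows "lower_density (S y) \<ge> ereal (1 / (ln y + 9 * c / pi\<^sup>2))"
proof -
  define L where "L = ln y"
  have L: "L > 0" using y by (simp add: L_def)
  have c0: "c \<ge> 0" using C0_nonneg unfolding C by simp
  define K where "K = log_floor y"
  define D where "D = (\<lambda>N::nat. real (card (S y \<inter> {1..int N})) / real N)"
  define Z where "Z = card {(k, l). k \<noteq> l \<and> \<lfloor>y ^ k\<rfloor> = \<lfloor>y ^ l\<rfloor>}"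
  have pnt: "(\<lambda>N. real (prime_count (q * real N)) * ln (real N) / real N) \<longlonglongrightarrow> q" if q: "q > 0" for q
  proof -
    have "filterlim (\<lambda>N. q * real N) at_top sequentially" using q by real_asymp
    from filterlim_compose[OF prime_number_theorem this]
    have "(\<lambda>N. real (prime_count (q * real N)) * ln (q * real N) / (q * real N)) \<longlonglongrightarrow> 1" .
    moreover have "(\<lambda>N::nat. q * (ln (real N) / ln (q * real N))) \<longlonglongrightarrow> q" using q by real_asymp
    ultimately have "(\<lambda>N. real (prime_count (q * real N)) * ln (q * real N) / (q * real N) * (q * (ln (real N) / ln (q * real N)))) \<longlonglongrightarrow> 1 * q"
      by (rule tendsto_mult)
    moreover have "\<forall>\<^sub>F N in sequentially. q * real N > 1" using q by real_asymp
    then have "\<forall>\<^sub>F N in sequentially. real (prime_count (q * real N)) * ln (q * real N) / (q * real N) * (q * (ln (real N) / ln (q * real N)))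
       = real (prime_count (q * real N)) * ln (real N) / real N"
      by eventually_elim (use q in auto)
    ultimately show ?thesis by (auto elim: Lim_transform_eventually)
  qed
  have Klim: "(\<lambda>N. real (K N) / ln (real N)) \<longlonglongrightarrow> 1 / L" unfolding K_def L_def by (rule log_floor_tendsto[OF y])
  have main: "liminf (\<lambda>N. ereal (D N)) \<ge> ereal ((((1 - 1 / y ^ m) / L)\<^sup>2) / (1 / L + (c + e) * (9 / pi\<^sup>2 + e) / L\<^sup>2))"
    if e: "e > 0" and m: "m \<ge> 1" for e m
  proof -
    \<comment> \<open>\<open>V N * N\<close> bounds the number of representations from below and,
      eventually, \<open>U N * N\<close> bounds the collisions from above; both are normalised so
      that each factor converges.\<close>
    define V where "V = (\<lambda>N. ((real (K N) - real m) / ln (real N)) * (real (prime_count ((1 - 1 / y ^ m) * real N)) * ln (real N) / real N))"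
    define U where "U = (\<lambda>N. real (K N) / ln (real N) * (real (prime_count (1 * real N)) * ln (real N) / real N)
        + real Z * ((real (prime_count (1 * real N)) * ln (real N) / real N) * (1 / ln (real N)))
        + 2 * ((real (K N) / ln (real N))\<^sup>2 * ((ln (real N))\<^sup>2 / real N))
        + (c + e) * (9 / pi\<^sup>2 + e) * (real (K N) / ln (real N))\<^sup>2)"
    define v where "v = (1 - 1 / y ^ m) / L"
    define u where "u = 1 / L + (c + e) * (9 / pi\<^sup>2 + e) / L\<^sup>2"
    have ym: "1 - 1 / y ^ m > 0" using y m one_less_power[of y m] by simp
    have "(\<lambda>N. real (K N) / ln (real N) - real m * (1 / ln (real N))) \<longlonglongrightarrow> 1 / L - real m * 0"
      by (intro tendsto_intros Klim) real_asymp
    then have "V \<longlonglongrightarrow> (1 / L) * (1 - 1 / y ^ m)"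
      unfolding V_def by (intro tendsto_mult pnt ym) (simp add: diff_divide_distrib)
    then have V: "V \<longlonglongrightarrow> v" by (simp add: v_def)
    have v: "v > 0" using ym L by (simp add: v_def)
    \<comment> \<open>The coincidences of distinct exponents and the odd differences disappear in
      the limit.\<close>
    have "U \<longlonglongrightarrow> (1 / L) * 1 + real Z * (1 * 0) + 2 * ((1 / L)\<^sup>2 * 0) + (c + e) * (9 / pi\<^sup>2 + e) * (1 / L)\<^sup>2"
      unfolding U_def by (intro tendsto_intros pnt Klim) (simp | real_asymp)+
    then have U: "U \<longlonglongrightarrow> u" by (simp add: u_def power_divide)
    have u: "u > 0" unfolding u_def using L c0 e by (intro add_pos_nonneg) auto
    have lim: "(\<lambda>N. (V N)\<^sup>2 / U N) \<longlonglongrightarrow> v\<^sup>2 / u" using U V u by (intro tendsto_intros) auto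
    have ev1: "\<forall>\<^sub>F N in sequentially. V N > 0" "\<forall>\<^sub>F N in sequentially. U N > 0"
      using V U v u by (auto intro: order_tendstoD)
    have ev2: "\<forall>\<^sub>F N in sequentially. \<forall>h. h \<noteq> 0 \<longrightarrow> real (prime_pair_count h (real N)) \<le> (c + e) * real N * W h / (ln (real N))\<^sup>2"
      using prime_pair_count_eventually_le[OF C e] filterlim_real_sequentially by (rule eventually_compose_filterlim)
    have ev3: "\<forall>\<^sub>F N in sequentially. W_sum (K N) y \<le> (9 / pi\<^sup>2 + e) * (real (K N))\<^sup>2"
      using W[OF e] log_floor_at_top[OF y] unfolding K_def by (rule eventually_compose_filterlim)
    have "\<forall>\<^sub>F N in sequentially. (V N)\<^sup>2 / U N \<le> D N"
      using ev1 ev2 ev3 eventually_ge_at_top[of 2]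
    proof eventually_elim
      case (elim N)
      define P where "P = real (prime_count (real N))"
      define R where "R = reps y N"
      define B where "B = real (card {(a, b) \<in> R \<times> R. rep_val y a = rep_val y b})"
      have N: "real N > 0" "ln (real N) > 0" using elim by auto
      define t where "t = (c + e) * real N / (ln (real N))\<^sup>2"
      have t: "t \<ge> 0" using c0 e by (simp add: t_def)
      have "V N * real N = (real (K N) - real m) * real (prime_count ((1 - 1 / y ^ m) * real N))"
        using N by (simp add: V_def)
      also have "\<dots> \<le> real (card R)"
        unfolding K_def R_def using elim by (intro card_reps_ge[OF y]) auto
      finally have "(V N * real N)\<^sup>2 \<le> (real (card R))\<^sup>2"
        using elim N by (intro power_mono) auto
      also have "\<dots> \<le> real (card (rep_val y ` R)) * B"
        unfolding B_def R_def by (rule card_image_Cauchy_Schwarz[OF finite_reps[OF y]])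
      also have "\<dots> \<le> real (card (S y \<inter> {1..int N})) * B"
        unfolding R_def by (intro mult_right_mono of_nat_mono card_mono rep_val_subset[OF y]) (auto simp: B_def)
      also have "real (card (S y \<inter> {1..int N})) = D N * real N" using N by (simp add: D_def)
      also have "D N * real N * B \<le> D N * real N * (U N * real N)"
      proof (intro mult_left_mono)
        have "B \<le> real (K N) * P + real Z * P + 2 * (real (K N))\<^sup>2 + t * W_sum (K N) y"
          unfolding B_def R_def K_def P_def Z_def
          by (rule card_collisions_le[OF y]) (use elim in \<open>auto simp: t_def\<close>)
        also have "\<dots> \<le> real (K N) * P + real Z * P + 2 * (real (K N))\<^sup>2 + t * ((9 / pi\<^sup>2 + e) * (real (K N))\<^sup>2)"
          using elim t by (intro add_left_mono mult_left_mono) auto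
        also have "\<dots> = U N * real N"
          using N unfolding U_def t_def P_def by (simp add: field_simps power2_eq_square)
        finally show "B \<le> U N * real N" .
      qed (auto simp: D_def)
      finally have "(V N)\<^sup>2 * (real N * real N) \<le> D N * U N * (real N * real N)"
        by (simp add: power_mult_distrib power2_eq_square mult_ac)
      then have "(V N)\<^sup>2 \<le> D N * U N" using N by (simp add: mult_le_cancel_right)
      then show ?case using elim by (simp add: pos_divide_le_eq)
    qed
    then have "liminf (\<lambda>N. ereal ((V N)\<^sup>2 / U N)) \<le> liminf (\<lambda>N. ereal (D N))"
      by (intro Liminf_mono) (auto elim: eventually_mono)
    moreover have "liminf (\<lambda>N. ereal ((V N)\<^sup>2 / U N)) = ereal (v\<^sup>2 / u)"
      using lim by (intro lim_imp_Liminf) auto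
    ultimately show ?thesis by (simp add: v_def u_def)
  qed
  \<comment> \<open>The two auxiliary parameters are tied by \<open>e = 1 / m\<close> and removed
    together.\<close>
  define q where "q = (\<lambda>m::nat. (((1 - 1 / y ^ m) / L)\<^sup>2) / (1 / L + (c + 1 / m) * (9 / pi\<^sup>2 + 1 / m) / L\<^sup>2))"
  have "(\<lambda>m::nat. 1 / y ^ m) \<longlonglongrightarrow> 0" using y by real_asymp
  moreover have "(\<lambda>m::nat. 1 / real m) \<longlonglongrightarrow> 0" by real_asymp
  moreover have "1 / L + (c + 0) * (9 / pi\<^sup>2 + 0) / L\<^sup>2 > 0" using L c0 by (intro add_pos_nonneg) auto
  ultimately have "q \<longlonglongrightarrow> (((1 - 0) / L)\<^sup>2) / (1 / L + (c + 0) * (9 / pi\<^sup>2 + 0) / L\<^sup>2)"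
    unfolding q_def using L by (intro tendsto_intros) auto
  also have "(((1 - 0) / L)\<^sup>2) / (1 / L + (c + 0) * (9 / pi\<^sup>2 + 0) / L\<^sup>2) = 1 / (L + 9 * c / pi\<^sup>2)"
  proof -
    have "1 / L + (c + 0) * (9 / pi\<^sup>2 + 0) / L\<^sup>2 = (L + 9 * c / pi\<^sup>2) / L\<^sup>2"
      using L by (simp add: add_divide_distrib power2_eq_square)
    then show ?thesis using L by (simp add: power_divide)
  qed
  finally have "(\<lambda>m. ereal (q m)) \<longlonglongrightarrow> ereal (1 / (L + 9 * c / pi\<^sup>2))" by simp
  then have "ereal (1 / (L + 9 * c / pi\<^sup>2)) \<le> liminf (\<lambda>N. ereal (D N))"
  proof (rule LIMSEQ_le_const2)
    show "\<exists>N. \<forall>n\<ge>N. ereal (q n) \<le> liminf (\<lambda>N. ereal (D N))"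
      by (rule exI[of _ 1]) (auto simp: q_def intro!: main)
  qed
  then show ?thesis by (simp add: lower_density_def D_def L_def)
qed

theorem theorem1p1:
  shows "(AE y in lebesgue. y > (1 :: real) \<longrightarrow>
            lower_density (S y) \<ge> 1 / (ereal (ln y) + 9 * C0 / ereal (pi\<^sup>2)))
       \<and> (AE y in lebesgue. y > (1 :: real) \<longrightarrow>
            lower_density ({p :: int. prime p} + {\<lfloor>y ^ k\<rfloor> | k :: nat. k \<ge> 1}) > 0)"
proof -
  \<comment> \<open>With an infinite \<open>C0\<close> the lower bound would read 0 and give no
    positivity.\<close>
  obtain c where c: "C0 = ereal c" "c \<ge> 0"
    using C0_nonneg C0_finite by (cases "C0 :: ereal") (metis ereal_less_eq(5), auto)
  have dens: "AE y in lebesgue. y > 1 \<longrightarrow> lower_density (S y) \<ge> ereal (1 / (ln y + 9 * c / pi\<^sup>2))"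
    \<comment> \<open>The exceptional set is null for \<open>lborel\<close>, hence also for its
      completion.\<close>
    using AE_completion[OF AE_pair_excess]
  proof eventually_elim
    case (elim y)
    then show ?case using S_density_ge[OF _ c(1)] W_sum_eventually_le by blast
  qed
  have pos: "ln y + 9 * c / pi\<^sup>2 > 0" if "y > 1" for y
    using that c by (intro add_pos_nonneg) auto
  have "AE y in lebesgue. y > 1 \<longrightarrow> lower_density (S y) \<ge> 1 / (ereal (ln y) + 9 * C0 / ereal (pi\<^sup>2))"
    using dens
  proof eventually_elim
    case (elim y)
    show ?case
    proof
      assume y: "y > 1"
      have "9 * C0 / ereal (pi\<^sup>2) = ereal (9 * c / pi\<^sup>2)"
      proof -
        have "9 * C0 = ereal (9 * c)" unfolding c(1) by (metis numeral_eq_ereal times_ereal.simps(1))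
        then show ?thesis by simp
      qed
      then show "lower_density (S y) \<ge> 1 / (ereal (ln y) + 9 * C0 / ereal (pi\<^sup>2))"
        using elim y pos[OF y] by (simp add: one_ereal_def)
    qed
  qed
  moreover have "AE y in lebesgue. y > (1 :: real) \<longrightarrow>
      lower_density ({p :: int. prime p} + {\<lfloor>y ^ k\<rfloor> | k :: nat. k \<ge> 1}) > 0"
    using dens
  proof eventually_elim
    case (elim y)
    have eq: "{p :: int. prime p} + {\<lfloor>y ^ k\<rfloor> | k :: nat. k \<ge> 1} = S y"
      by (auto simp: S_def set_plus_def)
    show ?case
    proof
      assume y: "y > 1"
      have "0 < ereal (1 / (ln y + 9 * c / pi\<^sup>2))" using pos[OF y] by simp
      also have "\<dots> \<le> lower_density (S y)" using elim y by blast
      finally show "lower_density ({p :: int. prime p} + {\<lfloor>y ^ k\<rfloor> | k :: nat. k \<ge> 1}) > 0" unfolding eq .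
    qed
  qed
  ultimately show ?thesis by blast
qed

end
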